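(* Let $\Bbbk$ be a field of characteristic zero, let $n\ge 1$, and let $G$ be a finite group of $\Bbbk$-automorphisms of the field of rational functions $\Bbbk(x_1,\dots,x_n)$. Suppose that $G$ has neither nontrivial abelian factor groups (quotient groups) nor factor groups isomorphic to the alternating group $A_5$. Then the subfield of invariants $\Bbbk(x_1,\dots,x_n)^G$ is saturated in $\Bbbk(x_1,\dots,x_n)$.
   Context: Let $K=\Bbbk(x_1,\dots,x_n)$. A subfield $L\subseteq K$ is algebraically closed in $K$ if every element of $K$ that is algebraic over $L$ belongs to $L$. An element $\psi\in K\setminus\Bbbk$ is called closed if the subfield $\Bbbk(\psi)$ is algebraically closed in $K$. For every $\phi\in K\setminus\Bbbk$ there exist a closed $\psi\in K\setminus\Bbbk$ and $H(t)\in\Bbbk(t)$ with $\phi=H(\psi)$; such $\psi$ is called a generative element (generative function) of $\phi$, and it is determined by $\phi$ uniquely up to transformations $\psi\mapsto\frac{\alpha\psi+\beta}{\gamma\psi+\delta}$ with $\alpha,\beta,\gamma,\delta\in\Bbbk$, $\alpha\delta-\beta\gamma\neq 0$. A subfield $L$ with $\Bbbk\subseteq L\subseteq K$ is called saturated in $K$ if for every $\phi\in L\setminus\Bbbk$ a generative element $\psi$ of $\phi$ is contained in $L$ (this does not depend on the choice of $\psi$). For a group $G$ of automorphisms of $K$, $K^G$ denotes the subfield of elements fixed by all of $G$. *)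

theory Defs
  imports
    "HOL-Algebra.Algebra"
    "HOL-Algebra.Algebraic_Closure_Type"
    "HOL-Library.Poly_Mapping"
begin

(* The field k(x_1,...,x_n), where n = CARD('v).  Monomials are exponent functions 'v => nat,
   polynomials are finitely supported functions from monomials to 'k.  The order on the finite
   index type 'v is used only by the library instance that makes polynomials an integral domain. *)
type_synonym ('v, 'k) ratfun = "(('v \<Rightarrow>\<^sub>0 nat) \<Rightarrow>\<^sub>0 'k) fract"

abbreviation ratfun_field :: "('v::{finite,linorder}, 'k::field_char_0) ratfun ring" where
  "ratfun_field \<equiv> ring_of_type_algebra"

definition const :: "'k::field_char_0 \<Rightarrow> ('v::{finite,linorder}, 'k) ratfun" where
  "const c = Fract (Poly_Mapping.single 0 c) 1"

definition constants :: "('v::{finite,linorder}, 'k::field_char_0) ratfun set" where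
  "constants = range const"

definition algebraically_closed_in :: "'a set \<Rightarrow> ('a, 'b) ring_scheme \<Rightarrow> bool" where
  "algebraically_closed_in L R \<longleftrightarrow> (\<forall>x\<in>carrier R. (ring.algebraic R over L) x \<longrightarrow> x \<in> L)"

definition closed_ratfun :: "('v::{finite,linorder}, 'k::field_char_0) ratfun \<Rightarrow> bool" where
  "closed_ratfun \<psi> \<longleftrightarrow> \<psi> \<notin> constants \<and>
     algebraically_closed_in (generate_field ratfun_field (insert \<psi> constants)) ratfun_field"

(* The univariate rational function H = p / q is represented by its numerator and denominator. *)
definition generative ::
  "('v::{finite,linorder}, 'k::field_char_0) ratfun \<Rightarrow> ('v, 'k) ratfun \<Rightarrow> bool" where
  "generative \<psi> \<phi> \<longleftrightarrow> closed_ratfun \<psi> \<and>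
     (\<exists>p q :: 'k poly. poly (map_poly const q) \<psi> \<noteq> 0 \<and>
        \<phi> = poly (map_poly const p) \<psi> / poly (map_poly const q) \<psi>)"

definition saturated :: "('v::{finite,linorder}, 'k::field_char_0) ratfun set \<Rightarrow> bool" where
  "saturated L \<longleftrightarrow> subfield L ratfun_field \<and> constants \<subseteq> L \<and>
     (\<forall>\<phi> \<in> L - constants. \<exists>\<psi> \<in> L. generative \<psi> \<phi>)"

definition ratfun_aut ::
  "(('v::{finite,linorder}, 'k::field_char_0) ratfun \<Rightarrow> ('v, 'k) ratfun) monoid" where
  "ratfun_aut = \<lparr>carrier = {\<sigma> \<in> ring_iso ratfun_field ratfun_field. \<forall>c. \<sigma> (const c) = const c},
     monoid.mult = (\<circ>), one = id\<rparr>"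

definition fixed_subfield ::
  "(('v::{finite,linorder}, 'k::field_char_0) ratfun \<Rightarrow> ('v, 'k) ratfun) set \<Rightarrow> ('v, 'k) ratfun set"
  where "fixed_subfield G = {\<phi>. \<forall>\<sigma>\<in>G. \<sigma> \<phi> = \<phi>}"

lemma group_ratfun_aut:
  "group (ratfun_aut :: (('v::{finite,linorder}, 'k::field_char_0) ratfun \<Rightarrow> ('v, 'k) ratfun) monoid)"
proof -
  let ?K = "ratfun_field :: ('v, 'k) ratfun ring"
  interpret K: Ring.field ?K by (rule field_from_type_algebra)
  have carr: "carrier ?K = UNIV" by (simp add: ring_of_type_algebra_def)
  show ?thesis
  proof (rule groupI)
    fix \<sigma> :: "('v, 'k) ratfun \<Rightarrow> ('v, 'k) ratfun"
    assume "\<sigma> \<in> carrier ratfun_aut"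
    then have iso: "\<sigma> \<in> ring_iso ?K ?K" and fixc: "\<And>c. \<sigma> (const c) = const c"
      by (auto simp: ratfun_aut_def)
    have bij: "bij \<sigma>"
      using iso by (simp add: ring_iso_def carr)
    have "inv_into (carrier ?K) \<sigma> \<in> ring_iso ?K ?K"
      by (rule ring_iso_set_sym[OF K.ring_axioms iso])
    moreover have "(inv_into UNIV \<sigma>) (const c) = const c" for c
      using bij fixc by (metis bij_inv_eq_iff)
    moreover have "inv_into UNIV \<sigma> \<circ> \<sigma> = id"
      using bij by (simp add: bij_is_inj)
    ultimately show "\<exists>\<tau>\<in>carrier ratfun_aut. \<tau> \<otimes>\<^bsub>ratfun_aut\<^esub> \<sigma> = \<one>\<^bsub>ratfun_aut\<^esub>"
      by (intro bexI[of _ "inv_into UNIV \<sigma>"]) (auto simp: ratfun_aut_def carr)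
  qed (auto simp: ratfun_aut_def ring_iso_set_refl o_assoc intro: ring_iso_set_trans)
qed

end

theory Submission
  imports Defs
begin

text \<open>
Write K for the field of rational functions, and let \<phi> be a nonconstant element of K that is
fixed by G. Let L be the field of all elements of K that are algebraic over k(\<phi>). It is
algebraically closed in K, it contains \<phi>, and G maps it to itself because G fixes \<phi>. The
claim follows once L = k(\<psi>) for an element \<psi> that G fixes: such a \<psi> is a generative
element of \<phi> and lies among the invariants.

That L has a single generator is the classical theorem of Gordan and Igusa. Substitute
x_i = s_i + t^w_i, where the weights w_i separate the monomials that occur in \<phi>, and send a
rational function to the quotient of the lowest coefficients in s. This is a place of K with values
in k(t). Its value at \<phi> is not constant, so it is defined on k(\<phi>), and then on L, since
valuation rings are integrally closed (\<open>exists_place\<close>, \<open>Pl_algebraic\<close>). A place that is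
defined on a whole field is injective there. Hence L is isomorphic to a subfield of k(t), and such
subfields are simple by Lueroth's theorem in one variable (\<open>luroth\<close>).

For \<sigma> in G the element \<sigma>(\<psi>) is again a generator of L, hence a Moebius transform of
\<psi> (\<open>same_fracs_moebius\<close>). So G acts on the projective line over the algebraic closure of k,
here the set of lines in the plane. The image H of this action is finite. It is also perfect: the
derived quotient of G is abelian, hence trivial by assumption, so G is perfect and so is every
image of G.

A finite perfect group of Moebius transformations is trivial or isomorphic to the alternating group
on five letters (\<open>line_action.trivial_or_alt_group_5\<close>). In characteristic zero an element of finite
order other than the identity has exactly two fixed points, and the stabilizer of a point is
commutative. Counting the points that are fixed by some element other than the identity (the poles)
leaves three orbits of poles, with stabilizers of orders (2, 3, 3), (2, 3, 4) or (2, 3, 5).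
Perfectness excludes orbits with at most three poles. In the first two cases an orbit of
six poles falls into three pairs that H permutes, which is impossible for the same reason. In the
last case the thirty poles of order two fall into five blocks, and the action on the blocks
identifies H with the alternating group.

The latter is excluded by assumption, so H is trivial and G fixes \<psi>.
\<close>

section \<open>Subfields with one generator\<close>

text \<open>
The constant field k is given by an embedding \<open>c\<close> into a field, rather than as a subset of
it, so that polynomials over k keep a type of their own and can be reused for several fields. The two
fields of interest are k(t) and the field of rational functions.
\<close>

locale field_embedding =
  fixes c :: "'k::field \<Rightarrow> 'f::field"
  assumes c_add: "c (a + b) = c a + c b"
    and c_mult: "c (a * b) = c a * c b"
    and c_1 [simp]: "c 1 = 1"
begin

lemma c_0 [simp]: "c 0 = 0"
proof -
  have "c 0 = c 0 + c 0" using c_add[of 0 0] by (simp only: add_0)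
  thus ?thesis by (simp only: add_cancel_right_right)
qed

lemma c_minus: "c (- a) = - c a"
  using c_add[of a "- a"] minus_unique[of "c a" "c (- a)"] by simp

lemma c_diff: "c (a - b) = c a - c b"
  using c_add[of a "- b"] by (simp add: c_minus)

lemma c_eq_0_iff [simp]: "c a = 0 \<longleftrightarrow> a = 0"
  using c_mult[of a "inverse a"] by (cases "a = 0") auto

lemma c_inj: "c a = c b \<longleftrightarrow> a = b"
  using c_eq_0_iff[of "a - b"] by (simp add: c_diff)

lemma c_inverse: "c (inverse a) = inverse (c a)"
  using c_mult[of a "inverse a"] by (cases "a = 0") (auto simp: inverse_unique)

lemma c_divide: "c (a / b) = c a / c b"
  by (simp add: divide_inverse c_mult c_inverse)

lemma c_power: "c (a ^ n) = c a ^ n"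
  by (induction n) (auto simp: c_mult)

lemma c_sum: "c (sum f A) = (\<Sum>i\<in>A. c (f i))"
  by (induction A rule: infinite_finite_induct) (auto simp: c_add)

definition ev :: "'k poly \<Rightarrow> 'f \<Rightarrow> 'f" where
  "ev p x = poly (map_poly c p) x"

lemma map_poly_c_add: "map_poly c (p + q) = map_poly c p + map_poly c q"
  by (rule poly_eqI) (simp add: coeff_map_poly c_add)

lemma map_poly_c_mult: "map_poly c (p * q) = map_poly c p * map_poly c q"
  by (rule poly_eqI) (simp add: coeff_map_poly coeff_mult c_sum c_mult)

lemma ev_0 [simp]: "ev 0 x = 0"
  and ev_1 [simp]: "ev 1 x = 1"
  and ev_pCons: "ev (pCons a p) x = c a + x * ev p x"
  and ev_add: "ev (p + q) x = ev p x + ev q x"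
  and ev_mult: "ev (p * q) x = ev p x * ev q x"
  by (simp_all add: ev_def map_poly_pCons map_poly_c_add map_poly_c_mult)

lemma ev_const [simp]: "ev [:a:] x = c a"
  by (simp add: ev_pCons)

lemma ev_minus: "ev (- p) x = - ev p x"
  using ev_add[of p "- p" x] minus_unique[of "ev p x" "ev (- p) x"] by simp

lemma ev_power: "ev (p ^ n) x = ev p x ^ n"
  by (induction n) (auto simp: ev_mult)

lemma ev_sum: "ev (sum f A) x = (\<Sum>i\<in>A. ev (f i) x)"
  by (induction A rule: infinite_finite_induct) (auto simp: ev_add)

lemma degree_map_poly_c [simp]: "degree (map_poly c p) = degree p"
  by (rule degree_map_poly) simp

lemma ev_altdef: "ev p x = (\<Sum>i\<le>degree p. c (coeff p i) * x ^ i)"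
  by (simp add: ev_def poly_altdef coeff_map_poly)

definition is_subfield :: "'f set \<Rightarrow> bool" where
  "is_subfield S \<longleftrightarrow> range c \<subseteq> S \<and> (\<forall>x\<in>S. \<forall>y\<in>S. x + y \<in> S \<and> x * y \<in> S) \<and> (\<forall>x\<in>S. - x \<in> S \<and> inverse x \<in> S)"

lemma is_subfieldD:
  assumes "is_subfield S"
  shows "c a \<in> S" "0 \<in> S" "1 \<in> S"
    "x \<in> S \<Longrightarrow> y \<in> S \<Longrightarrow> x + y \<in> S" "x \<in> S \<Longrightarrow> y \<in> S \<Longrightarrow> x * y \<in> S"
    "x \<in> S \<Longrightarrow> y \<in> S \<Longrightarrow> x - y \<in> S" "x \<in> S \<Longrightarrow> y \<in> S \<Longrightarrow> x / y \<in> S"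
    "x \<in> S \<Longrightarrow> - x \<in> S" "x \<in> S \<Longrightarrow> inverse x \<in> S"
proof -
  note d = assms[unfolded is_subfield_def]
  show c: "c a \<in> S" for a using d by auto
  show "0 \<in> S" "1 \<in> S" using c[of 0] c[of 1] by auto
  show "x \<in> S \<Longrightarrow> y \<in> S \<Longrightarrow> x + y \<in> S" "x \<in> S \<Longrightarrow> y \<in> S \<Longrightarrow> x * y \<in> S"
    "x \<in> S \<Longrightarrow> - x \<in> S" "x \<in> S \<Longrightarrow> inverse x \<in> S" using d by blast+
  show "x \<in> S \<Longrightarrow> y \<in> S \<Longrightarrow> x - y \<in> S"  using d by (metis diff_conv_add_uminus)
  show "x \<in> S \<Longrightarrow> y \<in> S \<Longrightarrow> x / y \<in> S" using d by (metis divide_inverse)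
qed

lemma ev_in_subfield: "is_subfield S \<Longrightarrow> x \<in> S \<Longrightarrow> ev p x \<in> S"
  by (induction p) (auto simp: ev_pCons is_subfieldD)

text \<open>
The field k(x).
\<close>

definition fracs :: "'f \<Rightarrow> 'f set" where
  "fracs x = {y. \<exists>p q. ev q x \<noteq> 0 \<and> y = ev p x / ev q x}"

lemma fracs_least: "is_subfield S \<Longrightarrow> x \<in> S \<Longrightarrow> fracs x \<subseteq> S"
  by (auto simp: fracs_def is_subfieldD ev_in_subfield)

lemma fracsI: "ev q x \<noteq> 0 \<Longrightarrow> ev p x / ev q x \<in> fracs x"
  by (auto simp: fracs_def)

lemma ev_in_fracs: "ev p x \<in> fracs x"
  using fracsI[of 1 x p] by simp

lemma self_in_fracs: "x \<in> fracs x"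
  using ev_in_fracs[of "[:0,1:]" x] by (simp add: ev_pCons)

lemma is_subfield_fracs: "is_subfield (fracs x)"
  unfolding is_subfield_def
proof (intro conjI ballI subsetI)
  fix y assume "y \<in> range c"
  thus "y \<in> fracs x" using ev_in_fracs[of "[:_:]"] by auto
next
  fix y z assume "y \<in> fracs x" "z \<in> fracs x"
  then obtain p q r s where
    *: "ev q x \<noteq> 0" "y = ev p x / ev q x" "ev s x \<noteq> 0" "z = ev r x / ev s x"
    by (auto simp: fracs_def)
  have "y + z = ev (p * s + r * q) x / ev (q * s) x" "y * z = ev (p * r) x / ev (q * s) x"
    using * by (simp_all add: ev_add ev_mult add_frac_eq)
  thus "y + z \<in> fracs x" "y * z \<in> fracs x"
    using * fracsI[of "q * s" x "p * s + r * q"] fracsI[of "q * s" x "p * r"] by (auto simp only: ev_mult mult_eq_0_iff)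
next
  fix y assume "y \<in> fracs x"
  then obtain p q where *: "ev q x \<noteq> 0" "y = ev p x / ev q x"
    by (auto simp: fracs_def)
  have "- y = ev (- p) x / ev q x" using * by (simp add: ev_minus)
  thus "- y \<in> fracs x" using * fracsI by simp
  show "inverse y \<in> fracs x"
  proof (cases "ev p x = 0")
    case True thus ?thesis using * ev_in_fracs[of 0] by simp
  next
    case False
    moreover have "inverse y = ev q x / ev p x" using * by simp
    ultimately show ?thesis using * fracsI[of p x q] by (simp only: simp_thms)
  qed
qed

definition transcendental :: "'f \<Rightarrow> bool" where
  "transcendental x \<longleftrightarrow> (\<forall>p. ev p x = 0 \<longrightarrow> p = 0)"

lemma transcendentalD: "transcendental x \<Longrightarrow> ev p x = 0 \<longleftrightarrow> p = 0"
  by (auto simp: transcendental_def)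

text \<open>
Intermediate fields are sets, and so polynomials over them form a subset of a polynomial type.
Division with remainder has to be redone because the quotient and the remainder must stay in it.
\<close>

definition poly_over :: "'f set \<Rightarrow> 'f poly \<Rightarrow> bool" where
  "poly_over S f \<longleftrightarrow> (\<forall>i. coeff f i \<in> S)"

lemma poly_over_arith:
  assumes "is_subfield S"
  shows "poly_over S 0" "poly_over S (map_poly c p)"
    "poly_over S f \<Longrightarrow> poly_over S g \<Longrightarrow> poly_over S (f + g)"
    "poly_over S f \<Longrightarrow> poly_over S g \<Longrightarrow> poly_over S (f - g)"
    "poly_over S f \<Longrightarrow> poly_over S g \<Longrightarrow> poly_over S (f * g)"
    "a \<in> S \<Longrightarrow> poly_over S f \<Longrightarrow> poly_over S (smult a f)"
    "a \<in> S \<Longrightarrow> poly_over S (monom a n)"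
proof -
  have "sum h A \<in> S" if "\<And>i. h i \<in> S" for h :: "nat \<Rightarrow> 'f" and A
    using that assms by (induction A rule: infinite_finite_induct) (auto simp: is_subfieldD)
  thus "poly_over S f \<Longrightarrow> poly_over S g \<Longrightarrow> poly_over S (f * g)"
    using assms by (auto simp: poly_over_def coeff_mult is_subfieldD)
qed (use assms in \<open>auto simp: poly_over_def coeff_map_poly is_subfieldD\<close>)

lemma poly_over_division:
  assumes S: "is_subfield S" and g: "poly_over S g" "g \<noteq> 0" and "poly_over S f"
  shows "\<exists>q r. poly_over S q \<and> poly_over S r \<and> f = q * g + r \<and> (r = 0 \<or> degree r < degree g)"
  using assms(4)
proof (induction "degree f" arbitrary: f rule: less_induct)
  case less
  show ?case
  proof (cases "f = 0 \<or> degree f < degree g")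
    case True
    thus ?thesis using poly_over_arith(1)[OF S] less(2) by (intro exI[of _ 0] exI[of _ f]) auto
  next
    case False
    hence f: "f \<noteq> 0" "degree g \<le> degree f" by auto
    define m where "m = monom (lead_coeff f / lead_coeff g) (degree f - degree g)"
    have m: "poly_over S m"
      unfolding m_def using less(2) g S by (intro poly_over_arith) (auto simp: poly_over_def is_subfieldD)
    define f' where "f' = f - m * g"
    have f': "poly_over S f'"
      unfolding f'_def using less(2) m g S by (intro poly_over_arith) auto
    have dm: "degree (m * g) = degree f" "lead_coeff (m * g) = lead_coeff f"
      using f g lead_coeff_mult[of m g] unfolding m_def
      by (auto simp: degree_mult_eq degree_monom_eq lead_coeff_monom)
    show ?thesis
    proof (cases "degree f = 0")
      case True
      hence "degree f' = 0" "coeff f' 0 = 0" unfolding f'_def using dm 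
        using degree_diff_le[of f 0 "m * g"] by auto
      hence "f' = 0" by (metis leading_coeff_0_iff)
      hence "f = m * g + 0" unfolding f'_def by simp
      thus ?thesis using m poly_over_arith(1)[OF S] by blast
    next
      case False
      have "degree f' < degree f"
      proof (rule ccontr)
        assume "\<not> ?thesis"
        hence "degree f' = degree f" unfolding f'_def using dm degree_diff_le[of f "degree f" "m * g"] by linarith
        moreover have "coeff f' (degree f) = 0" using dm unfolding f'_def by simp
        ultimately show False using False by (metis leading_coeff_0_iff degree_0)
      qed
      from less(1)[OF this f'] obtain q r where
        qr: "poly_over S q" "poly_over S r" "f' = q * g + r" "r = 0 \<or> degree r < degree g" by blast
      have "f = (m + q) * g + r" using qr(3) unfolding f'_def by (simp add: algebra_simps)
      moreover have "poly_over S (m + q)" using m qr(1) S by (intro poly_over_arith)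
      ultimately show ?thesis using qr(2,4) by blast
    qed
  qed
qed

end

section \<open>Gauss's lemma for polynomials in two variables\<close>

lemma poly_bezout:
  fixes p q :: "'k::field poly"
  assumes "p \<noteq> 0 \<or> q \<noteq> 0"
  obtains g r s p' q' where "g \<noteq> 0" "g = r * p + s * q" "p = p' * g" "q = q' * g" "r * p' + s * q' = 1"
proof -
  define I where "I = {f. f \<noteq> 0 \<and> (\<exists>r s. f = r * p + s * q)}"
  have "p \<in> I \<or> q \<in> I"
    using assms unfolding I_def by (metis (mono_tags, lifting) add_0 add.right_neutral mem_Collect_eq mult_1 mult_zero_left)
  hence "\<exists>f. f \<in> I" by blast
  then obtain g where g: "g \<in> I" "\<And>f. f \<in> I \<Longrightarrow> degree g \<le> degree f"
    using ex_has_least_nat[of "\<lambda>f. f \<in> I" _ degree] by metis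
  obtain r s where rs: "g = r * p + s * q" using g by (auto simp: I_def)
  have dvd: "g dvd f" if "f = r' * p + s' * q" for f r' s'
  proof (rule ccontr)
    assume n: "\<not> g dvd f"
    have "f mod g = f - f div g * g" by (simp add: minus_div_mult_eq_mod)
    also have "\<dots> = (r' - f div g * r) * p + (s' - f div g * s) * q"
      unfolding that by (subst (2) rs) (simp add: algebra_simps)
    finally have "f mod g \<in> I" using n by (auto simp: I_def dvd_eq_mod_eq_0)
    moreover have "degree (f mod g) < degree g"
      using n degree_mod_less[of g f] g by (auto simp: I_def dvd_eq_mod_eq_0)
    ultimately show False using g(2) by fastforce
  qed
  have "g dvd p" "g dvd q" using dvd[of p 1 0] dvd[of q 0 1] by auto
  then obtain p' q' where pq: "p = p' * g" "q = q' * g" by (metis dvd_def mult.commute)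
  have g0: "g \<noteq> 0" using g(1) by (simp add: I_def)
  have "(r * p' + s * q') * g = r * p + s * q" unfolding pq by (simp add: algebra_simps)
  hence "(r * p' + s * q') * g = 1 * g" using rs by simp
  hence "r * p' + s * q' = 1" using g0 mult_right_cancel by blast
  thus ?thesis using that[OF g0 rs pq] by blast
qed

lemma bezout_cancel:
  fixes p q :: "'a::comm_ring_1"
  assumes "r * p + s * q = 1" "p dvd q ^ n * x"
  shows "p dvd x"
proof -
  have step: "p dvd y" if "p dvd q * y" for y
  proof -
    have "p dvd p * (r * y) + s * (q * y)" using that by simp
    also have "p * (r * y) + s * (q * y) = (r * p + s * q) * y" by (simp add: algebra_simps)
    finally show ?thesis using assms(1) by simp
  qed
  show ?thesis using assms(2)
  proof (induction n)
    case 0 thus ?case by simp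
  next
    case (Suc n)
    show ?case by (rule Suc.IH, rule step) (use Suc.prems in \<open>simp add: mult.assoc\<close>)
  qed
qed

text \<open>
A nonconstant divisor of least degree is prime: a common divisor of it and a factor a is either a
unit, so that Bezout applies, or has the same degree, so that it divides a.
\<close>

lemma ex_prime_factor_poly:
  fixes s :: "'k::field poly"
  assumes "degree s > 0"
  obtains \<pi> where "prime_elem \<pi>" "\<pi> dvd s" "degree \<pi> > 0"
proof -
  define D where "D = {f. f dvd s \<and> degree f > 0}"
  have "s \<in> D" using assms by (auto simp: D_def)
  then obtain \<pi> where \<pi>: "\<pi> \<in> D" "\<And>f. f \<in> D \<Longrightarrow> degree \<pi> \<le> degree f"
    using ex_has_least_nat[of "\<lambda>f. f \<in> D" _ degree] by metis
  have "prime_elem \<pi>"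
  proof (rule prime_elemI)
    show "\<pi> \<noteq> 0" using \<pi> by (auto simp: D_def)
    show "\<not> \<pi> dvd 1" using \<pi>(1) \<open>\<pi> \<noteq> 0\<close> by (auto simp: D_def is_unit_iff_degree)
    fix a b assume ab: "\<pi> dvd a * b"
    obtain g r s' p' q' where g: "g \<noteq> 0" "g = r * \<pi> + s' * a" "\<pi> = p' * g" "a = q' * g"
      using poly_bezout[of \<pi> a] \<open>\<pi> \<noteq> 0\<close> by metis
    show "\<pi> dvd a \<or> \<pi> dvd b"
    proof (cases "degree g = 0")
      case True
      hence "g dvd 1" using g(1) by (simp add: is_unit_iff_degree)
      have "\<pi> dvd \<pi> * (r * b) + s' * (a * b)" using ab by simp
      also have "\<dots> = g * b" unfolding g(2) by (simp add: algebra_simps)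
      finally have "\<pi> dvd g * b" .
      moreover obtain g' where "g * g' = 1" using \<open>g dvd 1\<close> by (metis dvdE)
      ultimately have "\<pi> dvd g * b * g'" by simp
      also have "g * b * g' = (g * g') * b" by (simp only: ac_simps)
      also have "\<dots> = b" using \<open>g * g' = 1\<close> by simp
      finally show ?thesis ..
    next
      case False
      have "g dvd \<pi>" by (subst g(3)) simp
      hence "g dvd s" using \<pi>(1) dvd_trans by (auto simp: D_def)
      hence "degree \<pi> \<le> degree g" using False \<pi>(2)[of g] by (auto simp: D_def)
      moreover have "p' \<noteq> 0" using g(3) \<open>\<pi> \<noteq> 0\<close> by auto
      moreover have "degree \<pi> = degree p' + degree g"
        using g(1) \<open>p' \<noteq> 0\<close> by (subst g(3)) (simp add: degree_mult_eq)
      ultimately have "degree p' = 0" by simp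
      hence "p' dvd 1" using \<open>p' \<noteq> 0\<close> by (simp add: is_unit_iff_degree)
      then obtain u where "u * p' = 1" by (metis dvdE mult.commute)
      hence "a = q' * (u * p') * g" using g(4) by simp
      also have "\<dots> = q' * u * (p' * g)" by (simp only: ac_simps)
      finally have "a = q' * u * \<pi>" using g(3) by (simp only:)
      thus ?thesis by simp
    qed
  qed
  thus ?thesis using that \<pi> by (auto simp: D_def)
qed

text \<open>
A factorization over k(t), cleared of denominators, becomes a factorization over k[t] when s is
removed one prime factor at a time: a prime of k[t] remains prime in k[t][X] and hence divides G or
H as a whole. What is divided out of G is collected in u.
\<close>

lemma gauss_lemma:
  fixes F G H :: "'k::field poly poly"
  assumes "s \<noteq> 0" "smult s F = G * H"
  shows "\<exists>u G' H'. u \<noteq> 0 \<and> F = G' * H' \<and> G = smult u G'"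
  using assms
proof (induction "degree s" arbitrary: s G H rule: less_induct)
  case less
  show ?case
  proof (cases "degree s = 0")
    case True
    then obtain a where a: "s = [:a:]" by (metis degree_eq_zeroE)
    hence "a \<noteq> 0" using less by auto
    have "F = smult [:inverse a:] (smult s F)" using \<open>a \<noteq> 0\<close> a by (simp flip: one_pCons)
    also have "\<dots> = G * smult [:inverse a:] H" using less(3) by simp
    finally show ?thesis by (intro exI[of _ 1] exI[of _ G] exI[of _ "smult [:inverse a:] H"]) auto
  next
    case False
    then obtain \<pi> where \<pi>: "prime_elem \<pi>" "\<pi> dvd s" "degree \<pi> > 0"
      using ex_prime_factor_poly by blast
    then obtain s' where s': "s = \<pi> * s'" by (auto simp: dvd_def)
    have "s' \<noteq> 0" "\<pi> \<noteq> 0" using less(2) s' by auto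
    have deg: "degree s' < degree s" using s' \<pi>(3) \<open>s' \<noteq> 0\<close> \<open>\<pi> \<noteq> 0\<close> by (simp add: degree_mult_eq)
    have "[:\<pi>:] dvd smult s F" unfolding s' by (simp add: const_poly_dvd_iff)
    hence "[:\<pi>:] dvd G \<or> [:\<pi>:] dvd H"
      using less(3) lift_prime_elem_poly[OF \<pi>(1)] prime_elem_dvd_mult_iff by metis
    thus ?thesis
    proof
      assume "[:\<pi>:] dvd G"
      then obtain G1 where G1: "G = smult \<pi> G1" by (auto simp: dvd_def)
      have "smult \<pi> (smult s' F) = smult \<pi> (G1 * H)" using less(3) s' G1 by simp
      hence "smult s' F = G1 * H" using \<open>\<pi> \<noteq> 0\<close> by (simp add: smult_cancel)
      from less(1)[OF deg \<open>s' \<noteq> 0\<close> this] obtain u G' H' where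
        "u \<noteq> 0" "F = G' * H'" "G1 = smult u G'" by blast
      thus ?thesis using \<open>\<pi> \<noteq> 0\<close> G1 by (intro exI[of _ "\<pi> * u"]) auto
    next
      assume "[:\<pi>:] dvd H"
      then obtain H1 where H1: "H = smult \<pi> H1" by (auto simp: dvd_def)
      have "smult \<pi> (smult s' F) = smult \<pi> (G * H1)" using less(3) s' H1 by simp
      hence "smult s' F = G * H1" using \<open>\<pi> \<noteq> 0\<close> by (simp add: smult_cancel)
      from less(1)[OF deg \<open>s' \<noteq> 0\<close> this] show ?thesis .
    qed
  qed
qed

text \<open>
Degrees with respect to the inner variable add up. Among the coefficients of largest inner degree
take the last one in each factor; their product cannot be cancelled in the coefficient of the product.
\<close>

lemma inner_degree_mult:
  fixes A B :: "'k::field poly poly"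
  assumes "degree (coeff A i) \<ge> d" "A \<noteq> 0" "degree (coeff B j) \<ge> e" "B \<noteq> 0"
  shows "\<exists>n. degree (coeff (A * B) n) \<ge> d + e"
proof -
  have *: "\<exists>m N. N \<ge> d \<and> degree (coeff A m) = N \<and> coeff A m \<noteq> 0 \<and>
      (\<forall>k. degree (coeff A k) \<le> N) \<and> (\<forall>k>m. degree (coeff A k) < N \<or> coeff A k = 0)"
    if "degree (coeff A i) \<ge> d" "A \<noteq> 0" for A :: "'k poly poly" and i d
  proof -
    define Z where "Z = {k. coeff A k \<noteq> 0}"
    have "Z \<subseteq> {..degree A}" by (auto simp: Z_def le_degree)
    hence fin: "finite Z" using finite_subset by blast
    have ne: "Z \<noteq> {}" using that by (auto simp: Z_def poly_eq_iff)
    define N where "N = Max ((\<lambda>k. degree (coeff A k)) ` Z)"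
    have N: "degree (coeff A k) \<le> N" for k
      using fin by (cases "k \<in> Z") (auto simp: N_def Z_def)
    have "N \<in> (\<lambda>k. degree (coeff A k)) ` Z" unfolding N_def using fin ne by (intro Max_in) auto
    define Y where "Y = {k\<in>Z. degree (coeff A k) = N}"
    have Y: "finite Y" "Y \<noteq> {}" using fin \<open>N \<in> _\<close> by (auto simp: Y_def)
    hence "Max Y \<in> Y" by simp
    moreover have "degree (coeff A k) < N \<or> coeff A k = 0" if "k > Max Y" for k
    proof (rule ccontr)
      assume "\<not> ?thesis"
      hence "k \<in> Y" using N[of k] by (auto simp: Y_def Z_def)
      thus False using that Y by (simp add: Max_ge leD)
    qed
    moreover have "N \<ge> d" using N[of i] that by simp
    ultimately show ?thesis using N by (intro exI[of _ "Max Y"] exI[of _ N]) (auto simp: Y_def Z_def)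
  qed
  obtain m N where A: "N \<ge> d" "degree (coeff A m) = N" "coeff A m \<noteq> 0"
      "\<And>k. degree (coeff A k) \<le> N" "\<And>k. k > m \<Longrightarrow> degree (coeff A k) < N \<or> coeff A k = 0"
    using *[OF assms(1,2)] by blast
  obtain m' N' where B: "N' \<ge> e" "degree (coeff B m') = N'" "coeff B m' \<noteq> 0"
      "\<And>k. degree (coeff B k) \<le> N'" "\<And>k. k > m' \<Longrightarrow> degree (coeff B k) < N' \<or> coeff B k = 0"
    using *[OF assms(3,4)] by blast
  have "coeff (coeff (A * B) (m + m')) (N + N') =
     (\<Sum>k\<le>m + m'. coeff (coeff A k * coeff B (m + m' - k)) (N + N'))"
    by (simp add: coeff_mult coeff_sum)
  also have "\<dots> = (\<Sum>k\<in>{m}. coeff (coeff A k * coeff B (m + m' - k)) (N + N'))"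
  proof (rule sum.mono_neutral_right)
    show "\<forall>k\<in>{..m + m'} - {m}. coeff (coeff A k * coeff B (m + m' - k)) (N + N') = 0"
    proof
      fix k assume k: "k \<in> {..m + m'} - {m}"
      show "coeff (coeff A k * coeff B (m + m' - k)) (N + N') = 0"
      proof (cases "coeff A k = 0 \<or> coeff B (m + m' - k) = 0")
        case False
        hence "degree (coeff A k) < N \<or> degree (coeff B (m + m' - k)) < N'"
          using A(5)[of k] B(5)[of "m + m' - k"] k by (cases "k > m") auto
        hence "degree (coeff A k) + degree (coeff B (m + m' - k)) < N + N'"
          using A(4)[of k] B(4)[of "m + m' - k"] by linarith
        hence "degree (coeff A k * coeff B (m + m' - k)) < N + N'"
          using degree_mult_le le_less_trans by blast
        thus ?thesis by (rule coeff_eq_0)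
      qed auto
    qed
  qed auto
  also have "\<dots> \<noteq> 0"
    using coeff_mult_degree_sum[of "coeff A m" "coeff B m'"] A(2,3) B(2,3) by (auto simp: leading_coeff_0_iff)
  finally have "degree (coeff (A * B) (m + m')) \<ge> N + N'" by (rule le_degree)
  thus ?thesis using A(1) B(1) by (intro exI[of _ "m + m'"]) linarith
qed

lemma common_denominator:
  fixes f :: "'a::idom fract poly"
  shows "\<exists>b F. b \<noteq> 0 \<and> smult (to_fract b) f = map_poly to_fract F"
proof (induction f)
  case 0
  show ?case by (intro exI[of _ 1] exI[of _ 0]) auto
next
  case (pCons a f)
  then obtain b F where b: "b \<noteq> 0" "smult (to_fract b) f = map_poly to_fract F" by blast
  obtain x y where a: "a = Fract x y" "y \<noteq> 0" by (cases a) auto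
  have "to_fract y * to_fract b * a = to_fract (b * x)"
    using a by (simp add: Fract_conv_to_fract)
  moreover have "smult (to_fract y * to_fract b) f = smult (to_fract y) (map_poly to_fract F)"
    by (simp flip: b(2))
  ultimately have "smult (to_fract (y * b)) (pCons a f) = map_poly to_fract (pCons (b * x) (smult y F))"
    by (simp add: map_poly_pCons)
  thus ?case using a(2) b(1) by (intro exI[of _ "y * b"] exI[of _ "pCons (b * x) (smult y F)"]) simp
qed

section \<open>Lueroth's theorem in one variable\<close>

definition fconst :: "'k::field \<Rightarrow> 'k poly fract" where
  "fconst a = to_fract [:a:]"

definition fvar :: "'k::field poly fract" where
  "fvar = to_fract [:0, 1:]"

interpretation ft: field_embedding "fconst :: 'k::field \<Rightarrow> 'k poly fract"
proof
  fix a b :: 'k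
  have "[:a + b:] = [:a:] + [:b:]" "[:a * b:] = [:a:] * [:b:]" by simp_all
  thus "fconst (a + b) = fconst a + fconst b" "fconst (a * b) = fconst a * fconst b"
    unfolding fconst_def by (simp_all only: to_fract_add to_fract_mult)
qed (simp add: fconst_def flip: one_pCons)

lemma ev_fvar: "ft.ev p fvar = to_fract p"
proof (induction p)
  case (pCons a p)
  have "pCons a p = [:a:] + [:0,1:] * p" by simp
  hence "to_fract (pCons a p) = to_fract [:a:] + to_fract [:0,1:] * to_fract p"
    by (simp only: to_fract_add to_fract_mult)
  thus ?case using pCons.IH by (simp only: ft.ev_pCons fvar_def) (simp add: fconst_def)
qed simp

lemma to_fract_power: "to_fract (a ^ n) = to_fract a ^ n"
  by (induction n) auto

text \<open>
This is the rational root theorem. If y = p/q in lowest terms is a root of f, then q divides the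
leading coefficient of f, so y is a polynomial, and f(y) = 0 forces its degree to be zero.
\<close>

lemma nonconstant_imp_transcendental:
  fixes y :: "'k::field poly fract"
  assumes "y \<notin> range fconst"
  shows "ft.transcendental y"
  unfolding ft.transcendental_def
proof (intro allI impI, rule ccontr)
  fix f :: "'k poly" assume f: "ft.ev f y = 0" "f \<noteq> 0"
  obtain a b where y: "y = Fract a b" "b \<noteq> 0" by (cases y)
  obtain g r s p q where g: "g \<noteq> 0" "g = r * a + s * b" "a = p * g" "b = q * g" "r * p + s * q = 1"
    using poly_bezout[of a b] y(2) by blast
  have q: "q \<noteq> 0" using y(2) g(4) by auto
  have y': "y * to_fract q = to_fract p"
    using y(1) g(1) q unfolding g(3,4) by (simp add: Fract_conv_to_fract)
  define n where "n = degree f"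
  have "to_fract q ^ n * ft.ev f y = (\<Sum>i\<le>n. to_fract q ^ n * (fconst (coeff f i) * y ^ i))"
    by (simp add: ft.ev_altdef n_def sum_distrib_left)
  also have "\<dots> = (\<Sum>i\<le>n. to_fract ([:coeff f i:] * p ^ i * q ^ (n - i)))"
  proof (rule sum.cong[OF refl])
    fix i assume "i \<in> {..n}"
    hence "to_fract q ^ n = to_fract q ^ i * to_fract q ^ (n - i)" by (simp flip: power_add)
    hence "to_fract q ^ n * (fconst (coeff f i) * y ^ i)
        = fconst (coeff f i) * (y * to_fract q) ^ i * to_fract q ^ (n - i)"
      by (simp add: power_mult_distrib)
    thus "to_fract q ^ n * (fconst (coeff f i) * y ^ i) = to_fract ([:coeff f i:] * p ^ i * q ^ (n - i))"
      by (simp only: y' fconst_def to_fract_mult to_fract_power)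
  qed
  finally have "to_fract (\<Sum>i\<le>n. [:coeff f i:] * p ^ i * q ^ (n - i)) = to_fract 0"
    using f(1) by simp
  hence sum0: "(\<Sum>i\<le>n. [:coeff f i:] * p ^ i * q ^ (n - i)) = 0"
    by (simp only: to_fract_eq_iff)
  have "q dvd (\<Sum>i<n. [:coeff f i:] * p ^ i * q ^ (n - i))"
    by (intro dvd_sum dvd_mult) (simp add: dvd_power)
  moreover have "(\<Sum>i\<le>n. [:coeff f i:] * p ^ i * q ^ (n - i)) =
      (\<Sum>i<n. [:coeff f i:] * p ^ i * q ^ (n - i)) + [:coeff f n:] * p ^ n"
    by (simp add: lessThan_Suc_atMost[symmetric])
  ultimately have "q dvd [:coeff f n:] * p ^ n"
    using sum0 dvd_add_right_iff[of q "\<Sum>i<n. [:coeff f i:] * p ^ i * q ^ (n - i)" "[:coeff f n:] * p ^ n"]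
    by simp
  hence "q dvd p ^ n * [:coeff f n:]" by (simp only: mult.commute)
  moreover have "s * q + r * p = 1" using g(5) by (simp only: add.commute)
  ultimately have "q dvd [:coeff f n:]" by (rule bezout_cancel[rotated])
  hence "degree q = 0"
    using dvd_imp_degree_le[of q "[:coeff f n:]"] f(2) by (simp add: n_def)
  then obtain b0 where b0: "q = [:b0:]" by (metis degree_eq_zeroE)
  hence "b0 \<noteq> 0" using q by auto
  define p' where "p' = smult (inverse b0) p"
  have yp: "y = to_fract p'"
  proof -
    have "to_fract [:b0:] * y = to_fract [:b0:] * to_fract p'"
      using y' \<open>b0 \<noteq> 0\<close> unfolding b0 p'_def to_fract_mult[symmetric] by (simp add: mult.commute)
    thus ?thesis using \<open>b0 \<noteq> 0\<close> by simp
  qed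
  have "ft.ev f y = to_fract (pcompose f p')"
    unfolding yp
  proof (induction f)
    case (pCons a f)
    thus ?case unfolding ft.ev_pCons by (simp add: pcompose_pCons) (simp add: fconst_def)
  qed simp
  hence "pcompose f p' = 0" using f(1) by simp
  hence "degree p' = 0" using f(2) by (metis pcompose_eq_0 neq0_conv)
  then obtain a0 where "p' = [:a0:]" by (metis degree_eq_zeroE)
  thus False using assms yp by (auto simp: fconst_def)
qed

text \<open>
Let \<eta> = p/q be a nonconstant element of L for which d = max(deg p, deg q) is least. The
polynomial P = p(X) - \<eta> q(X) over L vanishes at t; it is shown to be the minimal polynomial g of t
over L. Clearing the denominator gives F = q(t) p(X) - p(t) q(X), whose degree in t is at most d.
Gauss's lemma writes F = G' H' over k[t], where G' is proportional to g. As t is transcendental, some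
quotient of coefficients of g is a nonconstant element of L, and by the choice of \<eta> this forces
degree at least d in t for G'. So H' has degree zero in t and is a common factor of p and q, that is,
a constant. Finally, a/b in L means that t is a root of a(X) - (a/b) b(X); reducing a(X) and b(X)
modulo P expresses a/b by the coefficients of the remainders, which lie in k(\<eta>).
\<close>

theorem luroth:
  fixes L :: "'k::field poly fract set"
  assumes L: "ft.is_subfield L" and nontriv: "\<exists>y\<in>L. y \<notin> range fconst"
  shows "\<exists>\<eta>\<in>L. \<eta> \<notin> range fconst \<and> L \<subseteq> ft.fracs \<eta>"
proof -
  define D where "D = (\<lambda>(p :: 'k poly, q :: 'k poly). max (degree p) (degree q))"
  define A where "A = (\<lambda>(p, q). q \<noteq> 0 \<and> Fract p q \<in> L \<and> Fract p q \<notin> range fconst)"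
  have "\<exists>z. A z"
  proof -
    obtain y where "y \<in> L" "y \<notin> range fconst" using nontriv by blast
    moreover obtain a b where "y = Fract a b" "b \<noteq> 0" by (cases y)
    ultimately show ?thesis by (auto simp: A_def)
  qed
  then obtain z where z: "A z" "\<And>z'. A z' \<Longrightarrow> D z \<le> D z'"
    using ex_has_least_nat[of A _ D] by metis
  obtain p q where pq: "z = (p, q)" by (cases z)
  define d where "d = D z"
  define \<eta> where "\<eta> = Fract p q"
  have q: "q \<noteq> 0" and \<eta>L: "\<eta> \<in> L" and \<eta>c: "\<eta> \<notin> range fconst"
    using z(1) by (auto simp: A_def pq \<eta>_def)
  have d: "degree p \<le> d" "degree q \<le> d" by (auto simp: d_def D_def pq)
  have min: "d \<le> max (degree a) (degree b)" if "b \<noteq> 0" "Fract a b \<in> L" "Fract a b \<notin> range fconst" for a b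
    using z(2)[of "(a, b)"] that by (simp add: A_def D_def d_def)
  have p: "p \<noteq> 0"
    using \<eta>c unfolding \<eta>_def by (auto simp: Fract_conv_to_fract image_iff fconst_def intro: exI[of _ 0])
  have \<eta>q: "\<eta> * to_fract q = to_fract p"
    using q by (simp add: \<eta>_def Fract_conv_to_fract)

  define V where "V = (\<lambda>f. f \<noteq> 0 \<and> ft.poly_over L f \<and> poly f fvar = 0)"
  define P where "P = map_poly fconst p - smult \<eta> (map_poly fconst q)"
  have P_over: "ft.poly_over S P" if "ft.is_subfield S" "\<eta> \<in> S" for S
    unfolding P_def using that by (intro ft.poly_over_arith)
  have P0: "P \<noteq> 0"
  proof
    assume "P = 0"
    hence "coeff P (degree q) = 0" by simp
    hence "\<eta> = fconst (coeff p (degree q) / coeff q (degree q))"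
      using q by (simp add: P_def coeff_map_poly ft.c_divide field_simps)
    thus False using \<eta>c by blast
  qed
  have P_root: "poly P fvar = 0"
    using \<eta>q by (simp add: P_def ft.ev_def[symmetric] ev_fvar)
  have "V P" using P0 P_over[OF L \<eta>L] P_root by (simp add: V_def)
  then obtain g where g: "V g" "\<And>f. V f \<Longrightarrow> degree g \<le> degree f"
    using ex_has_least_nat[of V _ degree] by metis
  have g_dvd: "g dvd f" if f: "ft.poly_over L f" "poly f fvar = 0" for f
  proof -
    obtain u r where ur: "ft.poly_over L r" "f = u * g + r" "r = 0 \<or> degree r < degree g"
      using ft.poly_over_division[OF L _ _ f(1), of g] g(1) by (auto simp: V_def)
    have "poly g fvar = 0" using g(1) by (simp add: V_def)
    hence "poly r fvar = poly (u * g + r) fvar" by simp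
    also have "\<dots> = 0" using f(2) by (simp only: ur(2))
    finally have "poly r fvar = 0" .
    hence "r \<noteq> 0 \<Longrightarrow> V r" using ur(1) by (simp add: V_def)
    hence "r = 0" using g(2)[of r] ur(3) by linarith
    thus ?thesis using ur(2) by simp
  qed

  define \<kappa> where "\<kappa> = map_poly (\<lambda>a::'k. [:a:])"
  define F where "F = smult q (\<kappa> p) - smult p (\<kappa> q)"
  have coeff_\<kappa>: "coeff (\<kappa> f) i = [:coeff f i:]" for f i
    by (simp add: \<kappa>_def coeff_map_poly)
  have fract_\<kappa>: "map_poly to_fract (\<kappa> f) = map_poly fconst f" for f
    by (rule poly_eqI) (simp add: coeff_map_poly coeff_\<kappa> fconst_def)
  have fractF: "map_poly to_fract F = smult (to_fract q) P"
  proof (rule poly_eqI)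
    fix i
    have "to_fract q * coeff P i = to_fract q * fconst (coeff p i) - (\<eta> * to_fract q) * fconst (coeff q i)"
      by (simp add: P_def coeff_map_poly algebra_simps)
    also have "\<dots> = to_fract (coeff F i)"
      by (simp only: \<eta>q F_def coeff_diff coeff_smult coeff_\<kappa> to_fract_diff to_fract_mult fconst_def)
    finally show "coeff (map_poly to_fract F) i = coeff (smult (to_fract q) P) i"
      by (simp add: coeff_map_poly)
  qed
  have degF: "degree (coeff F i) \<le> d" for i
  proof -
    have "coeff F i = smult (coeff p i) q - smult (coeff q i) p"
      by (simp add: F_def coeff_\<kappa> mult.commute)
    thus ?thesis using d by (metis degree_diff_le degree_smult_le order_trans)
  qed
  have F0: "F \<noteq> 0"
  proof
    assume "F = 0"
    hence "smult (to_fract q) P = 0" using fractF by simp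
    thus False using P0 q by simp
  qed

  obtain h where h: "P = g * h" using g_dvd[OF P_over[OF L \<eta>L] P_root] by (auto simp: dvd_def)
  obtain b1 G1 where G1: "b1 \<noteq> 0" "smult (to_fract b1) g = map_poly to_fract G1"
    using common_denominator by blast
  obtain b2 H1 where H1: "b2 \<noteq> 0" "smult (to_fract b2) h = map_poly to_fract H1"
    using common_denominator by blast
  have "map_poly to_fract (smult (b1 * b2) F) = map_poly to_fract (G1 * smult q H1)"
    by (simp add: fractF h mult_ac flip: G1 H1)
  hence "smult (b1 * b2) F = G1 * smult q H1"
    by (simp only: fract_poly_eq_iff)
  then obtain w G' H' where w: "w \<noteq> 0" "F = G' * H'" "G1 = smult w G'"
    using gauss_lemma[of "b1 * b2" F G1 "smult q H1"] G1(1) H1(1) by auto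
  define v where "v = to_fract b1 / to_fract w"
  have v: "v \<noteq> 0" "map_poly to_fract G' = smult v g"
  proof -
    have "smult (to_fract w) (smult v g) = smult (to_fract w) (map_poly to_fract G')"
      using w(1) G1(2) w(3) by (simp add: v_def)
    thus "map_poly to_fract G' = smult v g" using w(1) by (metis smult_cancel to_fract_eq_0_iff)
  qed (use w G1 in \<open>simp add: v_def\<close>)
  have G'0: "G' \<noteq> 0" "H' \<noteq> 0" using F0 w(2) by auto
  have degG': "degree G' = degree g"
    using arg_cong[OF v(2), of degree] v(1) by (simp add: degree_map_poly)

  \<comment> \<open>If all coefficients of \<open>G'\<close> had degree below d, the quotients of coefficients of g would be constants, and t would be algebraic over k.\<close>
  have "\<exists>i. d \<le> degree (coeff G' i)"
  proof (rule ccontr)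
    assume "\<not> ?thesis"
    hence small: "degree (coeff G' i) < d" for i by (simp add: not_le)
    have "coeff g i / lead_coeff g \<in> range fconst" for i
    proof (rule ccontr)
      assume nc: "coeff g i / lead_coeff g \<notin> range fconst"
      have cG: "to_fract (coeff G' j) = v * coeff g j" for j
        using arg_cong[OF v(2), of "\<lambda>f. coeff f j"] by (simp add: coeff_map_poly)
      have e: "coeff g i / lead_coeff g = Fract (coeff G' i) (lead_coeff G')"
        using v(1) by (simp add: Fract_conv_to_fract cG degG')
      have "coeff g i / lead_coeff g \<in> L"
        using g(1) L by (auto simp: V_def ft.poly_over_def ft.is_subfieldD)
      hence "d \<le> max (degree (coeff G' i)) (degree (lead_coeff G'))"
        using nc G'0 unfolding e by (intro min) auto
      thus False using small[of i] small[of "degree G'"] by simp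
    qed
    hence "\<forall>i. \<exists>a. coeff g i / lead_coeff g = fconst a" by blast
    then obtain c where c: "coeff g i / lead_coeff g = fconst (c i)" for i
      by (auto dest!: choice)
    define g1 where "g1 = smult (inverse (lead_coeff g)) g"
    define f where "f = map_poly (inv_into UNIV fconst) g1"
    have inj: "inj (fconst :: 'k \<Rightarrow> 'k poly fract)" by (rule injI) (simp add: ft.c_inj)
    have inv0: "inv_into UNIV fconst (0 :: 'k poly fract) = 0"
      using inv_into_f_f[OF inj, of 0] by simp
    have "map_poly fconst f = g1"
    proof (rule poly_eqI)
      fix i
      have "coeff g1 i = fconst (c i)" using c[of i] by (simp add: g1_def divide_inverse mult.commute)
      thus "coeff (map_poly fconst f) i = coeff g1 i"
        by (simp add: coeff_map_poly f_def inv0 inv_into_f_f[OF inj])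
    qed
    moreover have "poly g1 fvar = 0" using g(1) by (simp add: g1_def V_def)
    ultimately have "ft.ev f fvar = 0" by (simp add: ft.ev_def)
    hence "f = 0" by (simp add: ev_fvar)
    hence "g1 = 0" using \<open>map_poly fconst f = g1\<close> by simp
    thus False using g(1) by (simp add: g1_def V_def)
  qed
  then obtain i0 where i0: "d \<le> degree (coeff G' i0)" by blast
  \<comment> \<open>All of the degree d in t is used up by \<open>G'\<close>.\<close>
  have H'c: "degree (coeff H' j) = 0" for j
  proof (rule ccontr)
    assume "degree (coeff H' j) \<noteq> 0"
    hence "1 \<le> degree (coeff H' j)" by simp
    from inner_degree_mult[OF i0 G'0(1) this G'0(2)] obtain n where "d + 1 \<le> degree (coeff F n)"
      unfolding w(2) by blast
    thus False using degF[of n] by linarith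
  qed
  define h0 where "h0 = map_poly (\<lambda>a. coeff a 0) H'"
  have h0: "H' = \<kappa> h0"
  proof (rule poly_eqI)
    fix j show "coeff H' j = coeff (\<kappa> h0) j"
      using H'c[of j] by (simp add: coeff_\<kappa> h0_def coeff_map_poly) (metis degree_0_id)
  qed
  have "h0 \<noteq> 0" using G'0(2) h0 by (auto simp: \<kappa>_def)
  have Ph: "smult (to_fract q) P = smult v g * map_poly fconst h0"
    unfolding fractF[symmetric] w(2) h0 by (simp add: v(2) fract_\<kappa>)
  have "map_poly fconst h0 dvd smult (to_fract q) P" unfolding Ph by (rule dvd_triv_right)
  hence h0P: "map_poly fconst h0 dvd P" using q by (simp add: dvd_smult_iff)
  \<comment> \<open>A factor of P with constant coefficients divides p and q, because \<open>\<eta>\<close> is not constant; and p/q cannot be cancelled without lowering d.\<close>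
  have h0_deg: "degree h0 = 0"
  proof -
    define rp rq where "rp = p mod h0" "rq = q mod h0"
    have "map_poly fconst p = map_poly fconst h0 * map_poly fconst (p div h0) + map_poly fconst rp"
         "map_poly fconst q = map_poly fconst h0 * map_poly fconst (q div h0) + map_poly fconst rq"
      unfolding rp_rq_def ft.map_poly_c_mult[symmetric] ft.map_poly_c_add[symmetric] by simp_all
    hence "map_poly fconst rp - smult \<eta> (map_poly fconst rq) =
      P - map_poly fconst h0 * (map_poly fconst (p div h0) - smult \<eta> (map_poly fconst (q div h0)))"
      unfolding P_def by (simp only:) (simp add: algebra_simps smult_diff_right smult_add_right)
    hence dv: "map_poly fconst h0 dvd map_poly fconst rp - smult \<eta> (map_poly fconst rq)"
      using h0P by simp
    show ?thesis
    proof (rule ccontr)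
      assume pos: "degree h0 \<noteq> 0"
      have dr: "degree rp < degree h0" "degree rq < degree h0"
        using pos unfolding rp_rq_def by (metis degree_mod_less' degree_0 neq0_conv)+
      have z: "map_poly fconst rp - smult \<eta> (map_poly fconst rq) = 0"
      proof (rule ccontr)
        assume n: "\<not> ?thesis"
        have "degree (map_poly fconst rp - smult \<eta> (map_poly fconst rq)) < degree (map_poly fconst h0)"
          using dr by (intro degree_diff_less) (auto intro: le_less_trans[OF degree_smult_le])
        thus False using dvd_imp_degree_le[OF dv n] by simp
      qed
      have "coeff rq i = 0" for i
      proof (rule ccontr)
        assume n: "coeff rq i \<noteq> 0"
        have "fconst (coeff rp i) = \<eta> * fconst (coeff rq i)"
          using arg_cong[OF z, of "\<lambda>f. coeff f i"] by (simp add: coeff_map_poly)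
        hence "\<eta> = fconst (coeff rp i / coeff rq i)" using n by (simp add: ft.c_divide)
        thus False using \<eta>c by blast
      qed
      hence "rq = 0" by (simp add: poly_eq_iff)
      hence "rp = 0" using z by (auto simp: poly_eq_iff coeff_map_poly)
      hence "h0 dvd p" "h0 dvd q" using \<open>rq = 0\<close> by (auto simp: rp_rq_def dvd_eq_mod_eq_0)
      then obtain p' q' where p'q': "p = h0 * p'" "q = h0 * q'" by (auto simp: dvd_def)
      hence nz: "p' \<noteq> 0" "q' \<noteq> 0" using p q by auto
      have "\<eta> = Fract p' q'"
        using \<open>h0 \<noteq> 0\<close> nz by (simp add: \<eta>_def p'q' Fract_conv_to_fract)
      hence "d \<le> max (degree p') (degree q')" using min[OF nz(2)] \<eta>L \<eta>c by simp
      thus False using d pos nz \<open>h0 \<noteq> 0\<close> unfolding p'q' by (simp add: degree_mult_eq)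
    qed
  qed
  then obtain e0 where e0: "h0 = [:e0:]" by (metis degree_eq_zeroE)
  define \<epsilon> where "\<epsilon> = v * fconst e0"
  have "\<epsilon> \<noteq> 0" using v(1) \<open>h0 \<noteq> 0\<close> e0 by (simp add: \<epsilon>_def)
  have "g = smult (inverse \<epsilon>) (smult \<epsilon> g)" using \<open>\<epsilon> \<noteq> 0\<close> by simp
  also have "smult \<epsilon> g = smult (to_fract q) P"
    unfolding Ph e0 by (simp add: map_poly_pCons \<epsilon>_def mult.commute)
  finally have "P dvd g" by (metis dvd_refl dvd_smult)

  have "\<theta> \<in> ft.fracs \<eta>" if \<theta>: "\<theta> \<in> L" for \<theta>
  proof -
    let ?M = "ft.fracs \<eta>"
    note M = ft.is_subfield_fracs[of \<eta>]
    have PM: "ft.poly_over ?M P" using P_over[OF M ft.self_in_fracs] .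
    obtain a b where ab: "\<theta> = Fract a b" "b \<noteq> 0" by (cases \<theta>)
    let ?A = "map_poly fconst a - smult \<theta> (map_poly fconst b)"
    have "ft.poly_over L ?A" using L \<theta> by (intro ft.poly_over_arith)
    moreover have "poly ?A fvar = 0" using ab by (simp add: ft.ev_def[symmetric] ev_fvar Fract_conv_to_fract)
    ultimately have "P dvd ?A" using g_dvd \<open>P dvd g\<close> dvd_trans by blast
    obtain ua ra where ra: "ft.poly_over ?M ra" "map_poly fconst a = ua * P + ra" "ra = 0 \<or> degree ra < degree P"
      using ft.poly_over_division[OF M PM P0 ft.poly_over_arith(2)[OF M]] by blast
    obtain ub rb where rb: "ft.poly_over ?M rb" "map_poly fconst b = ub * P + rb" "rb = 0 \<or> degree rb < degree P"
      using ft.poly_over_division[OF M PM P0 ft.poly_over_arith(2)[OF M]] by blast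
    have "rb \<noteq> 0"
    proof
      assume "rb = 0"
      hence "poly (map_poly fconst b) fvar = 0" using rb(2) P_root by simp
      thus False using ab(2) by (simp add: ft.ev_def[symmetric] ev_fvar)
    qed
    have "ra - smult \<theta> rb = ?A - (ua - smult \<theta> ub) * P"
      by (simp add: ra(2) rb(2) algebra_simps smult_add_right smult_diff_right)
    hence dv: "P dvd ra - smult \<theta> rb" using \<open>P dvd ?A\<close> by simp
    have "ra - smult \<theta> rb = 0"
    proof (rule ccontr)
      assume n: "\<not> ?thesis"
      have "degree ra < degree P \<or> ra = 0" "degree rb < degree P" using ra(3) rb(3) \<open>rb \<noteq> 0\<close> by auto
      hence "degree (ra - smult \<theta> rb) < degree P"
        by (intro degree_diff_less) (auto intro: le_less_trans[OF degree_smult_le])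
      thus False using dvd_imp_degree_le[OF dv n] by simp
    qed
    hence "coeff ra (degree rb) = \<theta> * lead_coeff rb"
      using arg_cong[of "ra - smult \<theta> rb" 0 "\<lambda>f. coeff f (degree rb)"] by simp
    hence "\<theta> = coeff ra (degree rb) / lead_coeff rb" using \<open>rb \<noteq> 0\<close> by simp
    thus ?thesis using M ra(1) rb(1) by (simp add: ft.poly_over_def ft.is_subfieldD)
  qed
  thus ?thesis using \<eta>L \<eta>c by blast
qed

section \<open>Polynomials in several variables\<close>

abbreviation lookup where "lookup \<equiv> Poly_Mapping.lookup"
abbreviation keys where "keys \<equiv> Poly_Mapping.keys"
abbreviation single where "single \<equiv> Poly_Mapping.single"

lemma sum_singles: "f = (\<Sum>i\<in>keys f. single i (lookup f i))"
proof (rule poly_mapping_eqI)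
  fix k
  have "lookup (\<Sum>i\<in>keys f. single i (lookup f i)) k = (\<Sum>i\<in>keys f. if i = k then lookup f i else 0)"
    by (simp add: lookup_sum lookup_single when_def)
  also have "\<dots> = lookup f k" by (simp add: in_keys_iff)
  finally show "lookup f k = lookup (\<Sum>i\<in>keys f. single i (lookup f i)) k" by simp
qed

lemma mult_as_sum:
  "f * g = (\<Sum>i\<in>keys f. \<Sum>j\<in>keys g. single (i + j) (lookup f i * lookup g j))"
  by (subst (1) sum_singles[of f], subst (1) sum_singles[of g]) (simp add: sum_product mult_single)

text \<open>
The lowest coefficient is multiplicative. Stated for arbitrary lower bounds m and n of the
exponents, it also covers factors whose coefficient at the bound is zero.
\<close>

lemma lookup_mult_lowest:
  fixes f g :: "'m::{ordered_cancel_comm_monoid_add, linorder} \<Rightarrow>\<^sub>0 'a::semiring_0"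
  assumes "\<And>i. i \<in> keys f \<Longrightarrow> m \<le> i" "\<And>j. j \<in> keys g \<Longrightarrow> n \<le> j"
  shows "lookup (f * g) (m + n) = lookup f m * lookup g n"
proof -
  have *: "i + j = m + n \<longleftrightarrow> i = m \<and> j = n" if "i \<in> keys f" "j \<in> keys g" for i j
    using assms(1)[OF that(1)] assms(2)[OF that(2)]
    by (metis add_le_less_mono add_less_le_mono less_irrefl order.not_eq_order_implies_strict)
  have "lookup (f * g) (m + n) =
      (\<Sum>i\<in>keys f. \<Sum>j\<in>keys g. if i + j = m + n then lookup f i * lookup g j else 0)"
    by (subst mult_as_sum) (simp add: lookup_sum lookup_single when_def)
  also have "\<dots> = (\<Sum>i\<in>keys f. \<Sum>j\<in>keys g. if i = m then if j = n then lookup f i * lookup g j else 0 else 0)"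
    by (intro sum.cong refl) (auto simp: *)
  also have "\<dots> = (\<Sum>i\<in>keys f. if i = m then lookup f m * lookup g n else 0)"
    by (intro sum.cong refl) (auto simp: in_keys_iff)
  also have "\<dots> = lookup f m * lookup g n" by (simp add: in_keys_iff)
  finally show ?thesis .
qed

lemma keys_mult_ge:
  fixes f g :: "'m::{ordered_cancel_comm_monoid_add, linorder} \<Rightarrow>\<^sub>0 'a::semiring_0"
  assumes "\<And>i. i \<in> keys f \<Longrightarrow> m \<le> i" "\<And>j. j \<in> keys g \<Longrightarrow> n \<le> j" "k \<in> keys (f * g)"
  shows "m + n \<le> k"
  using keys_mult[of f g] assms by (auto intro!: add_mono)

lemma keys_add_ge:
  assumes "\<And>i. i \<in> keys f \<Longrightarrow> m \<le> i" "\<And>j. j \<in> keys g \<Longrightarrow> m \<le> j" "k \<in> keys (f + g)"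
  shows "m \<le> k"
  using Poly_Mapping.keys_add[of f g] assms by auto

text \<open>
Monomials are compared lexicographically, the least index first.
\<close>

lemma zero_le_monomial: "(0 :: 'v::linorder \<Rightarrow>\<^sub>0 nat) \<le> m"
proof (cases "m = 0")
  case False
  hence ne: "keys m \<noteq> {}" by simp
  define k where "k = Min (keys m)"
  have "k \<in> keys m" using ne by (simp add: k_def)
  moreover have "lookup m k' = 0" if "k' < k" for k'
  proof (rule ccontr)
    assume "lookup m k' \<noteq> 0"
    hence "k \<le> k'" unfolding k_def by (intro Min_le) (auto simp: in_keys_iff)
    thus False using that by simp
  qed
  ultimately have "less_fun (lookup 0) (lookup m)"
    unfolding less_fun_def by (intro exI[of _ k]) (auto simp: in_keys_iff)
  hence "0 < m" by (simp add: less_poly_mapping.rep_eq)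
  thus ?thesis by simp
qed simp

definition eval_pm :: "('a::comm_ring_1 \<Rightarrow> 'b::comm_ring_1) \<Rightarrow> ('v::finite \<Rightarrow> 'b) \<Rightarrow> (('v \<Rightarrow>\<^sub>0 nat) \<Rightarrow>\<^sub>0 'a) \<Rightarrow> 'b" where
  "eval_pm h x f = (\<Sum>m\<in>keys f. h (lookup f m) * (\<Prod>i\<in>UNIV. x i ^ lookup m i))"

text \<open>
Polynomial evaluation is a ring homomorphism as soon as the map on coefficients is one.
\<close>

locale coeff_hom =
  fixes h :: "'a::comm_ring_1 \<Rightarrow> 'b::comm_ring_1"
  assumes h_add: "h (a + b) = h a + h b" and h_mult: "h (a * b) = h a * h b" and h_1: "h 1 = 1"
begin

lemma h_0: "h 0 = 0"
  using h_add[of 0 0] by simp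

lemma eval_pm_superset:
  assumes "finite A" "keys f \<subseteq> A"
  shows "eval_pm h x f = (\<Sum>m\<in>A. h (lookup f m) * (\<Prod>i\<in>UNIV. x i ^ lookup m i))"
  unfolding eval_pm_def using assms
  by (intro sum.mono_neutral_left) (auto simp: in_keys_iff h_0)

lemma eval_pm_add: "eval_pm h x (f + g) = eval_pm h x f + eval_pm h x g"
  using eval_pm_superset[of "keys f \<union> keys g"] Poly_Mapping.keys_add[of f g]
  by (simp add: lookup_add h_add distrib_right sum.distrib)

lemma eval_pm_0: "eval_pm h x 0 = 0"
  by (simp add: eval_pm_def)

lemma eval_pm_sum: "eval_pm h x (sum F A) = (\<Sum>i\<in>A. eval_pm h x (F i))"
  by (induction A rule: infinite_finite_induct) (auto simp: eval_pm_add eval_pm_0)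

lemma eval_pm_single: "eval_pm h x (single m a) = h a * (\<Prod>i\<in>UNIV. x i ^ lookup m i)"
  by (cases "a = 0") (auto simp: eval_pm_def h_0)

lemma eval_pm_mult: "eval_pm h x (f * g) = eval_pm h x f * eval_pm h x g"
proof -
  have s: "eval_pm h x (single (m + n) (a * b)) = eval_pm h x (single m a) * eval_pm h x (single n b)" for m n a b
    by (simp add: eval_pm_single h_mult lookup_add power_add prod.distrib mult_ac)
  have e: "eval_pm h x f = (\<Sum>i\<in>keys f. eval_pm h x (single i (lookup f i)))" for f
    unfolding eval_pm_single by (simp add: eval_pm_def)
  show ?thesis
    by (subst mult_as_sum) (simp add: eval_pm_sum s e[of f] e[of g] sum_product)
qed

lemma eval_pm_1: "eval_pm h x 1 = 1"
  using eval_pm_single[of x 0 1] by (simp add: h_1)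

lemma eval_pm_power: "eval_pm h x (f ^ n) = eval_pm h x f ^ n"
  by (induction n) (auto simp: eval_pm_mult eval_pm_1)

lemma eval_pm_prod: "eval_pm h x (\<Prod>i\<in>A. F i) = (\<Prod>i\<in>A. eval_pm h x (F i))"
  by (induction A rule: infinite_finite_induct) (auto simp: eval_pm_mult eval_pm_1)

lemma eval_pm_var: "eval_pm h x (single (single i 1) 1) = x i"
proof -
  have "(\<Prod>j\<in>UNIV. x j ^ lookup (single i (1::nat)) j) = (\<Prod>j\<in>UNIV. if j = i then x j else 1)"
    by (intro prod.cong refl) (auto simp: lookup_single when_def)
  thus ?thesis by (simp add: eval_pm_single h_1)
qed

lemma eval_pm_const: "eval_pm h x (single 0 a) = h a"
  by (simp add: eval_pm_single)

end

lemma monomial_as_product: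
  "single m (a::'a::comm_ring_1) = single 0 a * (\<Prod>i\<in>(UNIV::'v::finite set). single (single i 1) 1 ^ lookup m i)"
proof -
  have pow: "single (single i 1) (1::'a) ^ n = single (single i n) 1" for i :: 'v and n
    by (induction n) (auto simp: mult_single simp flip: single_add)
  have prod: "(\<Prod>i\<in>A. single (F i) (1::'a)) = single (\<Sum>i\<in>A. F i) 1" if "finite A"
    for A :: "'v set" and F :: "'v \<Rightarrow> 'v \<Rightarrow>\<^sub>0 nat"
    using that by induction (auto simp: mult_single)
  have m: "m = (\<Sum>i\<in>UNIV. single i (lookup m i))"
    by (rule poly_mapping_eqI) (simp add: lookup_sum lookup_single when_def)
  have "(\<Prod>i\<in>UNIV. single (single i 1) (1::'a) ^ lookup m i) = single m 1"
    unfolding pow by (subst (2) m) (simp add: prod)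
  thus ?thesis by (simp add: mult_single)
qed

text \<open>
Kronecker substitution. One index is added at a time, and its weight M exceeds every weighted sum
over the earlier indices, so that M acts as the base of a positional notation.
\<close>

lemma separating_weights:
  fixes S :: "('v::finite \<Rightarrow>\<^sub>0 nat) set"
  assumes "finite S"
  shows "\<exists>w :: 'v \<Rightarrow> nat. inj_on (\<lambda>m. \<Sum>i\<in>UNIV. w i * lookup m i) S"
proof -
  have "\<exists>w :: 'v \<Rightarrow> nat. \<forall>m\<in>S. \<forall>m'\<in>S. (\<Sum>i\<in>A. w i * lookup m i) = (\<Sum>i\<in>A. w i * lookup m' i) \<longrightarrow>
      (\<forall>i\<in>A. lookup m i = lookup m' i)" if "finite A" for A
    using that
  proof induction
    case (insert j A)
    then obtain w where w: "\<And>m m'. m \<in> S \<Longrightarrow> m' \<in> S \<Longrightarrow> (\<Sum>i\<in>A. w i * lookup m i) = (\<Sum>i\<in>A. w i * lookup m' i) \<Longrightarrow>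
      (\<forall>i\<in>A. lookup m i = lookup m' i)" by blast
    define M where "M = Suc (\<Sum>m\<in>S. \<Sum>i\<in>A. w i * lookup m i)"
    have M: "(\<Sum>i\<in>A. w i * lookup m i) < M" if "m \<in> S" for m
      unfolding M_def less_Suc_eq_le using assms that by (intro member_le_sum) auto
    define w' where "w' = w(j := M)"
    have sw: "(\<Sum>i\<in>insert j A. w' i * lookup m i) = lookup m j * M + (\<Sum>i\<in>A. w i * lookup m i)" for m
    proof -
      have "(\<Sum>i\<in>A. w' i * lookup m i) = (\<Sum>i\<in>A. w i * lookup m i)"
        using insert(2) by (intro sum.cong) (auto simp: w'_def)
      thus ?thesis using insert(1,2) by (simp add: w'_def mult.commute)
    qed
    have "lookup m i = lookup m' i"
      if m: "m \<in> S" "m' \<in> S" and e: "(\<Sum>i\<in>insert j A. w' i * lookup m i) = (\<Sum>i\<in>insert j A. w' i * lookup m' i)"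
        and i: "i \<in> insert j A" for m m' i
    proof -
      have e': "lookup m j * M + (\<Sum>i\<in>A. w i * lookup m i) = lookup m' j * M + (\<Sum>i\<in>A. w i * lookup m' i)"
        using e unfolding sw .
      have "(\<Sum>i\<in>A. w i * lookup m i) = (\<Sum>i\<in>A. w i * lookup m' i)"
        using arg_cong[OF e', of "\<lambda>x. x mod M"] M[OF m(1)] M[OF m(2)] by simp
      moreover have "lookup m j = lookup m' j"
        using arg_cong[OF e', of "\<lambda>x. x div M"] M[OF m(1)] M[OF m(2)] by simp
      ultimately show ?thesis using w[OF m] i by auto
    qed
    thus ?case by blast
  qed auto
  from this[of UNIV] obtain w where w: "\<And>m m'. m \<in> S \<Longrightarrow> m' \<in> S \<Longrightarrow>
      (\<Sum>i\<in>UNIV. w i * lookup m i) = (\<Sum>i\<in>UNIV. w i * lookup m' i) \<Longrightarrow> (\<forall>i. lookup m i = lookup m' i)" by auto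
  show ?thesis
    by (rule exI[of _ w], rule inj_onI) (rule poly_mapping_eqI, use w in blast)
qed

section \<open>Places\<close>

text \<open>
A place is encoded as a relation: \<open>Pl x y\<close> says that x lies in the valuation ring and has
residue y. The last axiom is the defining property of a valuation ring, that it contains x or its
inverse; an element outside has an inverse with residue zero.
\<close>

locale place =
  K: field_embedding c + F: field_embedding c'
  for c :: "'k::field \<Rightarrow> 'f::field" and c' :: "'k \<Rightarrow> 'g::field" +
  fixes Pl :: "'f \<Rightarrow> 'g \<Rightarrow> bool"
  assumes Pl_const: "Pl (c a) (c' a)"
    and Pl_add: "Pl x x' \<Longrightarrow> Pl y y' \<Longrightarrow> Pl (x + y) (x' + y')"
    and Pl_mult: "Pl x x' \<Longrightarrow> Pl y y' \<Longrightarrow> Pl (x * y) (x' * y')"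
    and Pl_unique: "Pl x x' \<Longrightarrow> Pl x x'' \<Longrightarrow> x' = x''"
    and Pl_total: "(\<exists>x'. Pl x x') \<or> Pl (inverse x) 0"
begin

lemma Pl_0: "Pl 0 0" and Pl_1: "Pl 1 1"
  using Pl_const[of 0] Pl_const[of 1] by simp_all

lemma Pl_minus: "Pl x x' \<Longrightarrow> Pl (- x) (- x')"
  using Pl_mult[OF Pl_const[of "- 1"]] by (fastforce simp: K.c_minus F.c_minus)

lemma Pl_sum: "(\<And>i. i \<in> A \<Longrightarrow> Pl (f i) (g i)) \<Longrightarrow> Pl (sum f A) (sum g A)"
  by (induction A rule: infinite_finite_induct) (auto simp: Pl_0 Pl_add)

lemma Pl_ev: "Pl x y \<Longrightarrow> Pl (K.ev p x) (F.ev p y)"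
  by (induction p) (auto simp: Pl_0 K.ev_pCons F.ev_pCons intro: Pl_add Pl_mult Pl_const)

lemma Pl_unit: 
  assumes "Pl x y" "Pl (inverse x) z" "x \<noteq> 0"
  shows "y \<noteq> 0"
proof
  assume "y = 0"
  hence "Pl 1 0" using Pl_mult[OF assms(1,2)] assms(3) by simp
  thus False using Pl_unique Pl_1 by fastforce
qed

text \<open>
A place that is finite on a whole field is injective there: the inverse of a nonzero element also
has a residue, and the two residues have product one.
\<close>

lemma Pl_subfield_inj:
  assumes "K.is_subfield S" "\<forall>x\<in>S. \<exists>y. Pl x y" "x \<in> S" "Pl x 0"
  shows "x = 0"
  using assms Pl_unit K.is_subfieldD(9) by blast

lemma Pl_inverse:
  assumes "Pl x y" "y \<noteq> 0" shows "Pl (inverse x) (inverse y)"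
proof -
  have "x \<noteq> 0" using assms Pl_0 Pl_unique by blast
  from Pl_total[of "inverse x"] obtain z where z: "Pl (inverse x) z"
  proof
    assume "Pl (inverse (inverse x)) 0"
    hence "y = 0" using assms Pl_unique by simp
    thus thesis using assms by simp
  qed auto
  have "Pl 1 (y * z)" using Pl_mult[OF assms(1) z] \<open>x \<noteq> 0\<close> by simp
  hence "y * z = 1" using Pl_1 Pl_unique by blast
  hence "z = inverse y" using assms(2) by (simp add: inverse_unique)
  thus ?thesis using z by simp
qed

lemma Pl_fracs:
  assumes "Pl x y" "F.transcendental y" "z \<in> K.fracs x"
  shows "\<exists>z'. Pl z z'"
proof -
  obtain p q where pq: "K.ev q x \<noteq> 0" "z = K.ev p x / K.ev q x" using assms(3) by (auto simp: K.fracs_def)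
  have "q \<noteq> 0" using pq(1) by auto
  hence "F.ev q y \<noteq> 0" using assms(2) F.transcendentalD by blast
  hence "Pl (inverse (K.ev q x)) (inverse (F.ev q y))" using Pl_ev[OF assms(1)] Pl_inverse by blast
  from Pl_mult[OF Pl_ev[OF assms(1), of p] this] show ?thesis unfolding pq(2) divide_inverse by blast
qed

text \<open>
Valuation rings are integrally closed. If x had no residue, its inverse would have residue zero;
dividing the equation of x by the highest power of x would give residue zero to the leading
coefficient, although the place is injective on S.
\<close>

lemma Pl_algebraic:
  assumes S: "K.is_subfield S" "\<forall>x\<in>S. \<exists>y. Pl x y"
    and f: "K.poly_over S f" "f \<noteq> 0" "poly f x = 0"
  shows "\<exists>y. Pl x y"
proof (rule ccontr)
  assume n: "\<not> ?thesis"
  hence P: "Pl (inverse x) 0" and x0: "x \<noteq> 0" using Pl_total[of x] Pl_0 by auto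
  define n where "n = degree f"
  have co: "coeff f i \<in> S" for i using f(1) by (simp add: K.poly_over_def)
  have "0 = inverse x ^ n * poly f x" using f(3) by simp
  also have "\<dots> = (\<Sum>i\<le>n. coeff f i * (inverse x ^ n * x ^ i))"
    by (simp add: poly_altdef n_def sum_distrib_left mult_ac)
  also have "\<dots> = (\<Sum>i\<le>n. coeff f i * inverse x ^ (n - i))"
  proof (intro sum.cong refl)
    fix i assume "i \<in> {..n}"
    hence "inverse x ^ n = inverse x ^ (n - i) * inverse x ^ i" by (simp flip: power_add)
    thus "coeff f i * (inverse x ^ n * x ^ i) = coeff f i * inverse x ^ (n - i)"
      using x0 by (simp add: mult.assoc flip: power_mult_distrib)
  qed
  also have "\<dots> = (\<Sum>i<n. coeff f i * inverse x ^ (n - i)) + lead_coeff f"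
    by (simp add: lessThan_Suc_atMost[symmetric] n_def)
  finally have "(\<Sum>i<n. coeff f i * inverse x ^ (n - i)) + lead_coeff f = 0" by (rule sym)
  hence lc: "lead_coeff f = - (\<Sum>i<n. coeff f i * inverse x ^ (n - i))"
    by (rule minus_unique[symmetric])
  have "Pl (coeff f i * inverse x ^ (n - i)) 0" if i: "i < n" for i
  proof -
    have pw: "Pl (inverse x ^ Suc k) 0" for k
    proof (induction k)
      case (Suc k)
      show ?case using Pl_mult[OF P Suc.IH] by simp
    qed (use P in simp)
    obtain k where "n - i = Suc k" using i by (cases "n - i") auto
    moreover obtain z where "Pl (coeff f i) z" using S(2) co by blast
    ultimately show ?thesis using Pl_mult[OF _ pw[of k], of "coeff f i" z] by simp
  qed
  hence "Pl (\<Sum>i<n. coeff f i * inverse x ^ (n - i)) (\<Sum>i<n. 0)" by (intro Pl_sum) auto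
  hence "Pl (lead_coeff f) 0" unfolding lc using Pl_minus by fastforce
  hence "lead_coeff f = 0" using Pl_subfield_inj[OF S co] by blast
  thus False using f(2) by simp
qed

end

text \<open>
If the place is defined on all of L, it is an isomorphism of L with a subfield of k(t), and
Lueroth's theorem can be pulled back along it.
\<close>

lemma subfield_with_trivial_place_is_simple:
  fixes c :: "'k::field \<Rightarrow> 'f::field" and Pl :: "'f \<Rightarrow> 'k poly fract \<Rightarrow> bool"
  assumes "place c fconst Pl"
    and L: "field_embedding.is_subfield c L"
    and def: "\<forall>x\<in>L. \<exists>y. Pl x y"
    and \<phi>: "\<phi> \<in> L" "Pl \<phi> y" "y \<notin> range fconst"
  shows "\<exists>\<psi>\<in>L. field_embedding.transcendental c \<psi> \<and> L = field_embedding.fracs c \<psi>"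
proof -
  interpret place c fconst Pl by fact
  define R where "R = {y. \<exists>x\<in>L. Pl x y}"
  have R: "ft.is_subfield R"
    unfolding ft.is_subfield_def
  proof (intro conjI ballI subsetI)
    fix z :: "'k poly fract" assume "z \<in> range fconst"
    thus "z \<in> R" using Pl_const K.is_subfieldD(1)[OF L] by (auto simp: R_def)
  next
    fix z w assume "z \<in> R" "w \<in> R"
    thus "z + w \<in> R" "z * w \<in> R"
      using Pl_add Pl_mult K.is_subfieldD(4,5)[OF L] unfolding R_def by blast+
  next
    fix z assume z: "z \<in> R"
    thus "- z \<in> R" using Pl_minus K.is_subfieldD(8)[OF L] unfolding R_def by blast
    show "inverse z \<in> R"
    proof (cases "z = 0")
      case False
      thus ?thesis using z Pl_inverse K.is_subfieldD(9)[OF L] unfolding R_def by blast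
    qed (use z in simp)
  qed
  have "y \<in> R" using \<phi> by (auto simp: R_def)
  then obtain \<eta> where \<eta>: "\<eta> \<in> R" "\<eta> \<notin> range fconst" "R \<subseteq> ft.fracs \<eta>"
    using luroth[OF R] \<phi>(3) by blast
  then obtain \<psi> where \<psi>: "\<psi> \<in> L" "Pl \<psi> \<eta>" by (auto simp: R_def)
  have transcendental: "ft.transcendental \<eta>" using nonconstant_imp_transcendental[OF \<eta>(2)] .
  have "L \<subseteq> K.fracs \<psi>"
  proof
    fix x assume x: "x \<in> L"
    then obtain z where z: "Pl x z" using def by blast
    hence "z \<in> R" using x by (auto simp: R_def)
    then obtain p q where pq: "ft.ev q \<eta> \<noteq> 0" "z = ft.ev p \<eta> / ft.ev q \<eta>"
      using \<eta>(3) by (auto simp: ft.fracs_def)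
    have "Pl (x * K.ev q \<psi> - K.ev p \<psi>) (z * ft.ev q \<eta> - ft.ev p \<eta>)"
      unfolding diff_conv_add_uminus by (intro Pl_add Pl_minus Pl_mult Pl_ev z \<psi>)
    hence "Pl (x * K.ev q \<psi> - K.ev p \<psi>) 0" using pq by simp
    moreover have "x * K.ev q \<psi> - K.ev p \<psi> \<in> L"
      using x K.ev_in_subfield[OF L \<psi>(1)] by (intro K.is_subfieldD[OF L]) auto
    ultimately have e: "x * K.ev q \<psi> - K.ev p \<psi> = 0" using Pl_subfield_inj[OF L def] by blast
    have "Pl (K.ev q \<psi>) (ft.ev q \<eta>)" using Pl_ev \<psi>(2) by blast
    hence "K.ev q \<psi> \<noteq> 0" using pq(1) Pl_unique Pl_0 by metis
    moreover from this e have "x = K.ev p \<psi> / K.ev q \<psi>" by (simp add: field_simps)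
    ultimately show "x \<in> K.fracs \<psi>" by (auto simp: K.fracs_def)
  qed
  moreover have "K.transcendental \<psi>"
    unfolding K.transcendental_def
  proof (intro allI impI)
    fix p assume "K.ev p \<psi> = 0"
    hence "ft.ev p \<eta> = 0" using Pl_ev[OF \<psi>(2), of p] Pl_0 Pl_unique by metis
    thus "p = 0" using transcendental by (simp add: ft.transcendentalD)
  qed
  ultimately show ?thesis using K.fracs_least[OF L \<psi>(1)] \<psi>(1) by blast
qed

text \<open>
Substitute x_i = s_i + t^w_i in the numerator and the denominator and compare the lowest monomials
in s: a function has a residue if the lowest monomial of the denominator is not larger than that of
the numerator, and the residue is the quotient of the coefficients there, an element of k(t). For
\<phi> the lowest monomial of the denominator is s^0, so its residue is \<phi>(t^w_1, ..., t^w_n). The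
weights give different powers of t to different monomials of numerator and denominator, so this is
constant only if \<phi> is.
\<close>

lemma exists_place:
  fixes \<phi> :: "(('v::{finite,linorder} \<Rightarrow>\<^sub>0 nat) \<Rightarrow>\<^sub>0 'k::field_char_0) fract"
  assumes "\<phi> \<notin> range const"
  shows "\<exists>Pl y. place const fconst Pl \<and> Pl \<phi> y \<and> y \<notin> range fconst"
proof -
  obtain p q where \<phi>: "\<phi> = Fract p q" "q \<noteq> 0" by (cases \<phi>)
  define S where "S = keys p \<union> keys q"
  obtain w :: "'v \<Rightarrow> nat" where w: "inj_on (\<lambda>m. \<Sum>i\<in>UNIV. w i * lookup m i) S"
    using separating_weights[of S] by (auto simp: S_def)
  define \<omega> where "\<omega> m = (\<Sum>i\<in>UNIV. w i * lookup m i)" for m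
  define h :: "'k \<Rightarrow> ('v \<Rightarrow>\<^sub>0 nat) \<Rightarrow>\<^sub>0 'k poly" where "h a = single 0 [:a:]" for a
  define x :: "'v \<Rightarrow> ('v \<Rightarrow>\<^sub>0 nat) \<Rightarrow>\<^sub>0 'k poly" where
    "x i = single (single i 1) 1 + single 0 (monom 1 (w i))" for i
  define \<Phi> where "\<Phi> = eval_pm h x"
  interpret \<Phi>: coeff_hom h
    by standard (simp_all add: h_def mult_single mult.commute flip: single_add one_pCons)
  have \<Phi>_mult: "\<Phi> (f * g) = \<Phi> f * \<Phi> g" and \<Phi>_add: "\<Phi> (f + g) = \<Phi> f + \<Phi> g" and \<Phi>_0: "\<Phi> 0 = 0"
    and \<Phi>_1: "\<Phi> 1 = 1" for f g
    by (simp_all add: \<Phi>_def \<Phi>.eval_pm_mult \<Phi>.eval_pm_add \<Phi>.eval_pm_0 \<Phi>.eval_pm_1)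

  \<comment> \<open>The substitution is injective, because \<open>t = 1\<close>, \<open>s_i = x_i - 1\<close> reverses it.\<close>
  define h' :: "'k poly \<Rightarrow> ('v \<Rightarrow>\<^sub>0 nat) \<Rightarrow>\<^sub>0 'k" where "h' a = single 0 (poly a 1)" for a
  define x' :: "'v \<Rightarrow> ('v \<Rightarrow>\<^sub>0 nat) \<Rightarrow>\<^sub>0 'k" where "x' i = single (single i 1) 1 - 1" for i
  interpret \<Psi>: coeff_hom h'
    by standard (simp_all add: h'_def mult_single flip: single_add)
  have \<Psi>x: "eval_pm h' x' (x i) = single (single i 1) 1" for i
    unfolding x_def \<Psi>.eval_pm_add \<Psi>.eval_pm_var \<Psi>.eval_pm_const
    by (simp add: x'_def h'_def poly_monom)
  have "eval_pm h' x' (\<Phi> f) = f" for f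
  proof -
    have "eval_pm h' x' (\<Phi> f) = (\<Sum>m\<in>keys f. h' [:lookup f m:] * (\<Prod>i\<in>UNIV. single (single i 1) 1 ^ lookup m i))"
      unfolding \<Phi>_def eval_pm_def[of h] \<Psi>.eval_pm_sum \<Psi>.eval_pm_mult \<Psi>.eval_pm_prod \<Psi>.eval_pm_power \<Psi>x
      by (simp add: h_def \<Psi>.eval_pm_const)
    also have "\<dots> = (\<Sum>m\<in>keys f. single m (lookup f m))"
    proof (intro sum.cong refl)
      fix m
      show "h' [:lookup f m:] * (\<Prod>i\<in>UNIV. single (single i 1) 1 ^ lookup m i) = single m (lookup f m)"
        unfolding h'_def by (subst monomial_as_product[of m "lookup f m"]) simp
    qed
    also have "\<dots> = f" by (rule sum_singles[symmetric])
    finally show ?thesis .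
  qed
  hence \<Phi>_inj: "\<Phi> f = 0 \<longleftrightarrow> f = 0" for f
    by (metis \<Phi>_0 \<Psi>.eval_pm_0)

  \<comment> \<open>E f is f evaluated at the powers of t, the part of lowest degree in s.\<close>
  define E where "E f = lookup (\<Phi> f) 0" for f
  have E_mult: "E (f * g) = E f * E g" for f g
    using lookup_mult_lowest[of "\<Phi> f" 0 "\<Phi> g" 0] by (simp add: E_def \<Phi>_mult zero_le_monomial)
  have lookup0_mult: "lookup (f * g) 0 = lookup f 0 * lookup g 0" for f g :: "('v \<Rightarrow>\<^sub>0 nat) \<Rightarrow>\<^sub>0 'k poly"
    using lookup_mult_lowest[of f 0 g 0] by (simp add: zero_le_monomial)
  have lookup0_power: "lookup (f ^ n) 0 = lookup f 0 ^ n" for f :: "('v \<Rightarrow>\<^sub>0 nat) \<Rightarrow>\<^sub>0 'k poly" and n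
    by (induction n) (simp_all add: lookup0_mult)
  have lookup0_prod: "lookup (prod F A) 0 = (\<Prod>i\<in>A. lookup (F i) 0)" for F :: "'v \<Rightarrow> ('v \<Rightarrow>\<^sub>0 nat) \<Rightarrow>\<^sub>0 'k poly" and A
    by (induction A rule: infinite_finite_induct) (simp_all add: lookup0_mult)
  have x0: "lookup (x i) 0 = monom 1 (w i)" for i
  proof -
    have "single i (1::nat) \<noteq> 0" by (metis lookup_single_eq lookup_zero zero_neq_one)
    thus ?thesis by (simp add: x_def lookup_add lookup_single when_def)
  qed
  have mp: "(\<Prod>i\<in>A. monom (1::'k) (w i) ^ lookup m i) = monom 1 (\<Sum>i\<in>A. w i * lookup m i)" for m A
    by (induction A rule: infinite_finite_induct) (auto simp: monom_power mult_monom simp flip: one_pCons monom_0)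
  have E: "E f = (\<Sum>m\<in>keys f. monom (lookup f m) (\<omega> m))" for f
    unfolding E_def \<Phi>_def eval_pm_def lookup_sum lookup0_mult lookup0_prod lookup0_power x0 mp \<omega>_def
    by (simp add: h_def smult_monom)
  have coeffE: "coeff (E f) (\<omega> m) = lookup f m" if "keys f \<subseteq> S" "m \<in> S" for f m
  proof -
    have "coeff (E f) (\<omega> m) = (\<Sum>m'\<in>keys f. if m' = m then lookup f m' else 0)"
      unfolding E coeff_sum using w that by (intro sum.cong refl) (auto simp: inj_on_def \<omega>_def)
    thus ?thesis by (simp add: in_keys_iff)
  qed
  have Eq: "E q \<noteq> 0"
  proof
    assume "E q = 0"
    obtain m where m: "m \<in> keys q" using \<phi>(2) by (metis ex_in_conv keys_eq_empty)
    hence "coeff (E q) (\<omega> m) = lookup q m" by (intro coeffE) (auto simp: S_def)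
    thus False using m \<open>E q = 0\<close> by (simp add: in_keys_iff)
  qed

  \<comment> \<open>The monomial m need only bound the numerator from below; if it is not attained there, the residue is zero.\<close>
  define Pl where "Pl = (\<lambda>x y. \<exists>a b m. x = Fract a b \<and> b \<noteq> 0 \<and> (\<forall>i\<in>keys (\<Phi> a). m \<le> i) \<and> (\<forall>i\<in>keys (\<Phi> b). m \<le> i)
      \<and> lookup (\<Phi> b) m \<noteq> 0 \<and> y = Fract (lookup (\<Phi> a) m) (lookup (\<Phi> b) m))"
  have PlI: "Pl (Fract a b) (Fract (lookup (\<Phi> a) m) (lookup (\<Phi> b) m))"
    if "\<And>i. i \<in> keys (\<Phi> a) \<Longrightarrow> m \<le> i" "\<And>i. i \<in> keys (\<Phi> b) \<Longrightarrow> m \<le> i" "lookup (\<Phi> b) m \<noteq> 0" for a b m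
    using that \<Phi>_0 unfolding Pl_def by fastforce
  have PlE: "\<exists>a b m. x = Fract a b \<and> b \<noteq> 0 \<and> (\<forall>i\<in>keys (\<Phi> a). m \<le> i) \<and> (\<forall>i\<in>keys (\<Phi> b). m \<le> i)
      \<and> lookup (\<Phi> b) m \<noteq> 0 \<and> y = Fract (lookup (\<Phi> a) m) (lookup (\<Phi> b) m)" if "Pl x y" for x y
    using that unfolding Pl_def .
  have arith: "Pl (u + v) (u' + v')" "Pl (u * v) (u' * v')" "u = v \<Longrightarrow> u' = v'"
    if "Pl u u'" "Pl v v'" for u u' v v'
  proof -
    from PlE[OF that(1)] PlE[OF that(2)] obtain a b m a2 b2 m2 where
      1: "u = Fract a b" "b \<noteq> 0" "\<forall>i\<in>keys (\<Phi> a). m \<le> i" "\<forall>i\<in>keys (\<Phi> b). m \<le> i"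
        "lookup (\<Phi> b) m \<noteq> 0" "u' = Fract (lookup (\<Phi> a) m) (lookup (\<Phi> b) m)" and
      2: "v = Fract a2 b2" "b2 \<noteq> 0" "\<forall>i\<in>keys (\<Phi> a2). m2 \<le> i" "\<forall>i\<in>keys (\<Phi> b2). m2 \<le> i"
        "lookup (\<Phi> b2) m2 \<noteq> 0" "v' = Fract (lookup (\<Phi> a2) m2) (lookup (\<Phi> b2) m2)" by blast
    have k: "\<And>i. i \<in> keys (\<Phi> a) \<Longrightarrow> m \<le> i" "\<And>i. i \<in> keys (\<Phi> b) \<Longrightarrow> m \<le> i"
      "\<And>i. i \<in> keys (\<Phi> a2) \<Longrightarrow> m2 \<le> i" "\<And>i. i \<in> keys (\<Phi> b2) \<Longrightarrow> m2 \<le> i" using 1 2 by auto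
    have lb: "lookup (\<Phi> (b * b2)) (m + m2) = lookup (\<Phi> b) m * lookup (\<Phi> b2) m2"
      unfolding \<Phi>_mult by (rule lookup_mult_lowest[OF k(2,4)])
    have kb: "m + m2 \<le> i" if "i \<in> keys (\<Phi> (b * b2))" for i
      using that unfolding \<Phi>_mult by (rule keys_mult_ge[OF k(2,4), rotated -1])
    have l1: "lookup (\<Phi> a * \<Phi> b2) (m + m2) = lookup (\<Phi> a) m * lookup (\<Phi> b2) m2"
      by (rule lookup_mult_lowest[OF k(1,4)])
    have l2: "lookup (\<Phi> b * \<Phi> a2) (m + m2) = lookup (\<Phi> b) m * lookup (\<Phi> a2) m2"
      by (rule lookup_mult_lowest[OF k(2,3)])
    have ks: "m + m2 \<le> i" if "i \<in> keys (\<Phi> (a * b2 + b * a2))" for i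
      using that unfolding \<Phi>_mult \<Phi>_add
      by (rule keys_add_ge[rotated -1]) (rule keys_mult_ge[OF k(1,4)] keys_mult_ge[OF k(2,3)]; assumption)+
    have "Pl (Fract (a * b2 + b * a2) (b * b2))
        (Fract (lookup (\<Phi> (a * b2 + b * a2)) (m + m2)) (lookup (\<Phi> (b * b2)) (m + m2)))"
      using 1 2 by (intro PlI ks kb) (auto simp: lb)
    moreover have "u + v = Fract (a * b2 + b * a2) (b * b2)"
      using 1(1,2) 2(1,2) by (simp add: mult.commute)
    moreover have "u' + v' = Fract (lookup (\<Phi> (a * b2 + b * a2)) (m + m2)) (lookup (\<Phi> (b * b2)) (m + m2))"
      using 1(5,6) 2(5,6) unfolding lb unfolding \<Phi>_add \<Phi>_mult lookup_add l1 l2 by (simp add: mult.commute)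
    ultimately show "Pl (u + v) (u' + v')" by simp
    have la: "lookup (\<Phi> (a * a2)) (m + m2) = lookup (\<Phi> a) m * lookup (\<Phi> a2) m2"
      unfolding \<Phi>_mult by (rule lookup_mult_lowest[OF k(1,3)])
    have ka: "m + m2 \<le> i" if "i \<in> keys (\<Phi> (a * a2))" for i
      using that unfolding \<Phi>_mult by (rule keys_mult_ge[OF k(1,3), rotated -1])
    have "Pl (Fract (a * a2) (b * b2)) (Fract (lookup (\<Phi> (a * a2)) (m + m2)) (lookup (\<Phi> (b * b2)) (m + m2)))"
      using 1 2 by (intro PlI ka kb) (auto simp: lb)
    thus "Pl (u * v) (u' * v')" using 1 2 by (simp add: la lb)
    show "u' = v'" if uv: "u = v"
    proof -
      have "a * b2 = b * a2" using uv 1(1,2) 2(1,2) by (simp add: eq_fract mult.commute)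
      hence "lookup (\<Phi> a * \<Phi> b2) (m + m2) = lookup (\<Phi> b * \<Phi> a2) (m + m2)"
        by (simp flip: \<Phi>_mult)
      thus ?thesis using 1(5,6) 2(5,6) unfolding l1 l2 by (simp add: eq_fract mult.commute)
    qed
  qed
  have "place const fconst Pl"
  proof
    fix a b :: 'k
    show "const (a + b) = const a + const b" by (simp add: const_def single_add)
    show "const (a * b) = const a * const b" by (simp add: const_def mult_single)
    show "const 1 = 1" by (simp add: const_def One_fract_def)
    have "Pl (Fract (single 0 a) 1) (Fract (lookup (\<Phi> (single 0 a)) 0) (lookup (\<Phi> 1) 0))"
      by (rule PlI) (auto simp: zero_le_monomial \<Phi>_1 lookup_one)
    thus "Pl (const a) (fconst a)"
      by (simp add: const_def fconst_def to_fract_def \<Phi>_1 lookup_one) (simp add: \<Phi>_def \<Phi>.eval_pm_const h_def)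
  next
    show "\<And>u u' v v'. Pl u u' \<Longrightarrow> Pl v v' \<Longrightarrow> Pl (u + v) (u' + v')"
      "\<And>u u' v v'. Pl u u' \<Longrightarrow> Pl v v' \<Longrightarrow> Pl (u * v) (u' * v')"
      "\<And>u u' u''. Pl u u' \<Longrightarrow> Pl u u'' \<Longrightarrow> u' = u''"
      using arith by blast+
  next
    fix u :: "(('v \<Rightarrow>\<^sub>0 nat) \<Rightarrow>\<^sub>0 'k) fract"
    obtain a b where u: "u = Fract a b" "b \<noteq> 0" by (cases u)
    show "(\<exists>y. Pl u y) \<or> Pl (inverse u) 0"
    proof (cases "a = 0")
      case True
      define m where "m = Min (keys (\<Phi> b))"
      have "keys (\<Phi> b) \<noteq> {}" using u(2) \<Phi>_inj by simp
      hence "m \<in> keys (\<Phi> b)" by (simp add: m_def)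
      thus ?thesis using PlI[of a m b] u True by (auto simp: \<Phi>_0 m_def in_keys_iff)
    next
      case False
      define ma mb where "ma = Min (keys (\<Phi> a))" "mb = Min (keys (\<Phi> b))"
      have "keys (\<Phi> a) \<noteq> {}" "keys (\<Phi> b) \<noteq> {}" using False u(2) \<Phi>_inj by auto
      hence ab: "ma \<in> keys (\<Phi> a)" "mb \<in> keys (\<Phi> b)"
        "\<And>i. i \<in> keys (\<Phi> a) \<Longrightarrow> ma \<le> i" "\<And>i. i \<in> keys (\<Phi> b) \<Longrightarrow> mb \<le> i" by (simp_all add: ma_mb_def)
      show ?thesis
      proof (cases "mb \<le> ma")
        case True
        thus ?thesis using PlI[of a mb b] ab u by (fastforce simp: in_keys_iff)
      next
        case mab: False
        hence "lookup (\<Phi> b) ma = 0" using ab(4)[of ma] by (auto simp: in_keys_iff)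
        moreover have "Pl (Fract b a) (Fract (lookup (\<Phi> b) ma) (lookup (\<Phi> a) ma))"
        proof (rule PlI)
          show "ma \<le> i" if "i \<in> keys (\<Phi> b)" for i using ab(4)[OF that] mab by simp
        qed (use ab in \<open>auto simp: in_keys_iff\<close>)
        moreover have "Fract 0 (lookup (\<Phi> a) ma) = 0" using ab(1) by (simp add: Zero_fract_def eq_fract in_keys_iff)
        ultimately show ?thesis using u by simp
      qed
    qed
  qed
  moreover have "Pl \<phi> (Fract (E p) (E q))"
    unfolding \<phi> E_def using Eq by (intro PlI) (auto simp: zero_le_monomial E_def)
  moreover have "Fract (E p) (E q) \<notin> range fconst"
  proof
    assume "Fract (E p) (E q) \<in> range fconst"
    then obtain a where "Fract (E p) (E q) = to_fract [:a:]" by (auto simp: fconst_def)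
    hence Epq: "E p = smult a (E q)" using Eq by (simp add: to_fract_def eq_fract)
    have "lookup p m = a * lookup q m" for m
    proof (cases "m \<in> S")
      case True
      have "lookup p m = coeff (E p) (\<omega> m)" using True by (intro coeffE[symmetric]) (auto simp: S_def)
      also have "\<dots> = a * lookup q m" unfolding Epq using True coeffE[of q m] by (simp add: S_def)
      finally show ?thesis .
    qed (auto simp: S_def in_keys_iff)
    hence "p = single 0 a * q"
      by (intro poly_mapping_eqI) (simp add: Poly_Mapping.map.rep_eq when_def flip: mult_map_scale_conv_mult)
    hence "\<phi> = const a" using \<phi> by (simp add: const_def eq_fract)
    thus False using assms by blast
  qed
  ultimately show ?thesis by blast
qed

section \<open>Actions of perfect groups\<close>

definition perfect :: "('a, 'b) monoid_scheme \<Rightarrow> bool" where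
  "perfect G \<longleftrightarrow> derived G (carrier G) = carrier G"

lemma perfect_hom_to_comm_group:
  assumes "group_hom G A f" "comm_group A" "perfect G" "x \<in> carrier G"
  shows "f x = \<one>\<^bsub>A\<^esub>"
proof -
  interpret group_hom G A f by fact
  interpret A: comm_group A by fact
  have "f ` carrier G \<subseteq> carrier A" by auto
  hence "derived A (f ` carrier G) = {\<one>\<^bsub>A\<^esub>}" by (rule A.derived_eq_singleton)
  moreover have "derived A (f ` carrier G) = f ` carrier G"
    using derived_img[of "carrier G"] assms(3) by (simp add: perfect_def)
  ultimately show ?thesis using assms(4) by blast
qed

lemma perfect_hom_image:
  assumes "group_hom G A f" "f ` carrier G = carrier A" "perfect G"
  shows "perfect A"
proof -
  have "derived A (f ` carrier G) = f ` derived G (carrier G)"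
    using group_hom.derived_img[OF assms(1)] by blast
  thus ?thesis using assms(3) unfolding perfect_def assms(2) by (simp only: assms(2))
qed

lemma comm_group_of_card_le_3:
  fixes G (structure)
  assumes "group G" "finite (carrier G)" "card (carrier G) \<le> 3"
  shows "comm_group G"
proof -
  interpret group G by fact
  show ?thesis
  proof (rule group_comm_groupI)
    fix x y assume xy: "x \<in> carrier G" "y \<in> carrier G"
    show "x \<otimes> y = y \<otimes> x"
    proof (cases "x = \<one> \<or> y = \<one> \<or> x = y")
      case False
      hence "card {\<one>, x, y} = 3" by auto
      hence "{\<one>, x, y} = carrier G" using assms xy by (intro card_seteq) auto
      hence "x \<otimes> y \<in> {\<one>, x, y}" "y \<otimes> x \<in> {\<one>, x, y}" using xy by auto
      moreover have "x \<otimes> y \<noteq> x" "x \<otimes> y \<noteq> y" "y \<otimes> x \<noteq> x" "y \<otimes> x \<noteq> y"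
        using False xy by (simp_all add: r_cancel_one l_cancel_one)
      ultimately show ?thesis by simp
    qed (use xy in auto)
  qed
qed

lemma comm_group_alt_group:
  assumes "n \<le> 3" shows "comm_group (alt_group n)"
proof (rule comm_group_of_card_le_3[OF alt_group_is_group])
  have sub: "carrier (alt_group n) \<subseteq> carrier (sym_group n)"
    by (auto simp: alt_group_carrier sym_group_carrier)
  have fin: "finite (carrier (sym_group n))"
    by (simp add: sym_group_def finite_permutations)
  show "finite (carrier (alt_group n))" using sub fin finite_subset by blast
  show "card (carrier (alt_group n)) \<le> 3"
  proof (cases "n \<ge> 2")
    case True
    hence "n = 2 \<or> n = 3" using assms by auto
    thus ?thesis using alt_group_card_carrier[OF True] by (auto simp: fact_numeral)
  next
    case False
    hence "n = 0 \<or> n = 1" by auto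
    thus ?thesis using card_mono[OF fin sub] by (auto simp: sym_group_card_carrier)
  qed
qed

lemma comm_group_sign_img: "comm_group sign_img"
  by (rule group.group_comm_groupI[OF sign_img_is_group]) (auto simp: sign_img_def)

text \<open>
The signs of the permutations form a homomorphism into a commutative group, which is trivial on a
perfect group.
\<close>

lemma perfect_action_even:
  fixes G (structure) and act :: "'g \<Rightarrow> 'x \<Rightarrow> 'x"
  assumes G: "group G" "perfect G" and fin: "finite B"
    and closed: "\<And>g x. g \<in> carrier G \<Longrightarrow> x \<in> B \<Longrightarrow> act g x \<in> B"
    and one: "\<And>x. x \<in> B \<Longrightarrow> act \<one>\<^bsub>G\<^esub> x = x"
    and mult: "\<And>g h x. g \<in> carrier G \<Longrightarrow> h \<in> carrier G \<Longrightarrow> x \<in> B \<Longrightarrow> act (g \<otimes>\<^bsub>G\<^esub> h) x = act g (act h x)"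
  shows "\<exists>\<pi>. group_hom G (alt_group (card B)) \<pi> \<and>
    (\<forall>g\<in>carrier G. \<pi> g = id \<longrightarrow> (\<forall>x\<in>B. act g x = x))"
proof -
  interpret group G by fact
  define n where "n = card B"
  obtain b where b: "bij_betw b {1..n} B"
    using ex_bij_betw_nat_finite_1[OF fin] by (auto simp: n_def)
  define b' where "b' = the_inv_into {1..n} b"
  have b'b: "b' (b i) = i" if "i \<in> {1..n}" for i
    using b that by (simp add: b'_def bij_betw_def the_inv_into_f_f)
  have bb': "b (b' x) = x" "b' x \<in> {1..n}" if "x \<in> B" for x
    using b that the_inv_into_into[of b "{1..n}" x "{1..n}"] f_the_inv_into_f[of b "{1..n}" x]
    unfolding b'_def bij_betw_def by blast+
  have bB: "b i \<in> B" if "i \<in> {1..n}" for i using b that by (auto simp: bij_betw_def)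
  define \<pi> where "\<pi> g = (\<lambda>i. if i \<in> {1..n} then b' (act g (b i)) else i)" for g
  have \<pi>_in: "\<pi> g i \<in> {1..n}" if "g \<in> carrier G" "i \<in> {1..n}" for g i
    using that bB closed bb'(2) by (simp add: \<pi>_def)
  have \<pi>_mult: "\<pi> (g \<otimes> h) = \<pi> g \<circ> \<pi> h" if "g \<in> carrier G" "h \<in> carrier G" for g h
  proof
    fix i show "\<pi> (g \<otimes> h) i = (\<pi> g \<circ> \<pi> h) i"
    proof (cases "i \<in> {1..n}")
      case True
      have "b' (act h (b i)) \<in> {1..n}" "b (b' (act h (b i))) = act h (b i)"
        using True that bB closed bb' by auto
      thus ?thesis using True that bB mult by (simp add: \<pi>_def)
    qed (simp only: \<pi>_def comp_apply if_False)
  qed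
  have \<pi>_1: "\<pi> \<one> = id"
    using b'b bB one by (auto simp: \<pi>_def)
  have perm: "\<pi> g permutes {1..n}" if "g \<in> carrier G" for g
  proof (rule bij_imp_permutes)
    have "\<pi> (inv g) (\<pi> g i) = i" "\<pi> g (\<pi> (inv g) i) = i" for i
      using \<pi>_mult[of "inv g" g] \<pi>_mult[of g "inv g"] that \<pi>_1 by (simp_all add: fun_eq_iff)
    thus "bij_betw (\<pi> g) {1..n} {1..n}"
      using \<pi>_in that by (intro bij_betwI[of _ _ _ "\<pi> (inv g)"]) auto
  qed (auto simp: \<pi>_def)
  have sym: "group_hom G (sym_group n) \<pi>"
    using perm \<pi>_mult by (intro group_hom.intro group_axioms sym_group_is_group)
      (auto simp: group_hom_axioms_def hom_def sym_group_carrier sym_group_mult)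
  have "sign (\<pi> g) = 1" if g: "g \<in> carrier G" for g
  proof -
    have "group_hom G sign_img (sign \<circ> \<pi>)"
      using group_hom.homh[OF sym] sign_is_hom[of n]
      by (intro group_hom.intro group_axioms sign_img_is_group) (auto simp: group_hom_axioms_def hom_def Pi_iff)
    from perfect_hom_to_comm_group[OF this comm_group_sign_img G(2) g]
    show ?thesis by (simp add: sign_img_def)
  qed
  hence even: "evenperm (\<pi> g)" if "g \<in> carrier G" for g
    using that by (force simp: sign_def split: if_splits)
  have "group_hom G (alt_group n) \<pi>"
    using perm \<pi>_mult even by (intro group_hom.intro group_axioms alt_group_is_group)
      (auto simp: group_hom_axioms_def hom_def alt_group_carrier alt_group_mult)
  moreover have "act g x = x" if "g \<in> carrier G" "\<pi> g = id" "x \<in> B" for g x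
  proof -
    have "\<pi> g (b' x) = b' x" using that by simp
    hence "b' (act g x) = b' x" using that bb' by (simp add: \<pi>_def split: if_splits)
    thus ?thesis using that bb' closed by metis
  qed
  ultimately show ?thesis unfolding n_def by blast
qed

text \<open>
The alternating group on at most three letters is commutative.
\<close>

lemma perfect_action_le_3_trivial:
  fixes act :: "'g \<Rightarrow> 'x \<Rightarrow> 'x"
  assumes "group G" "perfect G" "finite B"
    and "\<And>g x. g \<in> carrier G \<Longrightarrow> x \<in> B \<Longrightarrow> act g x \<in> B"
    and "\<And>x. x \<in> B \<Longrightarrow> act \<one>\<^bsub>G\<^esub> x = x"
    and "\<And>g h x. g \<in> carrier G \<Longrightarrow> h \<in> carrier G \<Longrightarrow> x \<in> B \<Longrightarrow> act (g \<otimes>\<^bsub>G\<^esub> h) x = act g (act h x)"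
    and "card B \<le> 3" "g \<in> carrier G" "x \<in> B"
  shows "act g x = x"
proof -
  obtain \<pi> where \<pi>: "group_hom G (alt_group (card B)) \<pi>" "\<forall>g\<in>carrier G. \<pi> g = id \<longrightarrow> (\<forall>x\<in>B. act g x = x)"
    using perfect_action_even[OF assms(1-6)] by blast
  have "\<pi> g = id"
    using perfect_hom_to_comm_group[OF \<pi>(1) comm_group_alt_group[OF assms(7)] assms(2,8)]
    by (simp add: alt_group_one)
  thus ?thesis using \<pi>(2) assms(8,9) by blast
qed

text \<open>
The e's are the orders of the point stabilizers in a group of order N, and the c's the sizes of the
orbits. Divided by N the equation reads 1/e1 + 1/e2 + 1/e3 = 1 + 2/N; the dihedral solution (2, 2, N/2)
is ruled out by the last assumption.
\<close>

lemma spherical_orders: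
  fixes e1 e2 e3 c1 c2 c3 N :: nat
  assumes "2 \<le> e1" "e1 \<le> e2" "e2 \<le> e3" "e1 * c1 = N" "e2 * c2 = N" "e3 * c3 = N"
    and "c1 + c2 + c3 = N + 2" "3 \<le> c3"
  shows "e1 = 2 \<and> e2 = 3 \<and> (e3 = 3 \<and> N = 12 \<or> e3 = 4 \<and> N = 24 \<or> e3 = 5 \<and> N = 60)"
proof -
  have le: "k * c \<le> N" if "k \<le> e" "e * c = N" for k e c :: nat
    using that by (metis mult_le_mono1)
  have "e1 = 2"
  proof (rule ccontr)
    assume "e1 \<noteq> 2"
    hence "3 * c1 \<le> N" "3 * c2 \<le> N" "3 * c3 \<le> N" using assms by (intro le[OF _ assms(4)] le[OF _ assms(5)] le[OF _ assms(6)]; simp)+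
    thus False using assms(7) by linarith
  qed
  moreover have "e2 = 3"
  proof (rule ccontr)
    assume "e2 \<noteq> 3"
    show False
    proof (cases "e2 = 2")
      case True
      hence "2 * c2 = N" "2 * c1 = N" using \<open>e1 = 2\<close> assms by simp_all
      thus False using assms(7,8) by linarith
    next
      case False
      hence "4 * c2 \<le> N" "4 * c3 \<le> N" using \<open>e2 \<noteq> 3\<close> assms by (intro le[OF _ assms(5)] le[OF _ assms(6)]; simp)+
      thus False using assms(4,7) unfolding \<open>e1 = 2\<close> by linarith
    qed
  qed
  moreover have "e3 \<le> 5"
  proof (rule ccontr)
    assume "\<not> e3 \<le> 5"
    hence "6 * c3 \<le> N" by (intro le[OF _ assms(6)]) simp
    thus False using assms(4,5,7) unfolding \<open>e1 = 2\<close> \<open>e2 = 3\<close> by linarith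
  qed
  ultimately have "e3 = 3 \<or> e3 = 4 \<or> e3 = 5" using assms(3) by linarith
  thus ?thesis using \<open>e1 = 2\<close> \<open>e2 = 3\<close> assms(4-7) by auto
qed

lemma (in group) pow_card_subgroup:
  assumes "subgroup K G" "x \<in> K"
  shows "x [^] card K = \<one>"
proof -
  interpret K: group "G\<lparr>carrier := K\<rparr>" using subgroup_imp_group[OF assms(1)] .
  show ?thesis using K.pow_order_eq_1[of x] assms(2) nat_pow_consistent[of x "card K"] by (simp add: Coset.order_def)
qed

lemma restrict_group_action:
  fixes G (structure)
  assumes "group G"
    and closed: "\<And>g x. g \<in> carrier G \<Longrightarrow> x \<in> E \<Longrightarrow> act g x \<in> E"
    and one: "\<And>x. x \<in> E \<Longrightarrow> act \<one>\<^bsub>G\<^esub> x = x"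
    and mult: "\<And>g h x. g \<in> carrier G \<Longrightarrow> h \<in> carrier G \<Longrightarrow> x \<in> E \<Longrightarrow> act (g \<otimes>\<^bsub>G\<^esub> h) x = act g (act h x)"
  shows "group_action G E (\<lambda>g. restrict (act g) E)"
proof -
  interpret group G by fact
  have inv: "act (inv g) (act g x) = x" "act g (act (inv g) x) = x" if "g \<in> carrier G" "x \<in> E" for g x
    using that mult[of "inv g" g x] mult[of g "inv g" x] one by simp_all
  have bij: "restrict (act g) E \<in> Bij E" if g: "g \<in> carrier G" for g
    unfolding Bij_def
    using g closed inv by (auto intro!: bij_betwI[of _ _ _ "act (inv g)"])
  have comp: "restrict (act (g \<otimes> h)) E = compose E (restrict (act g) E) (restrict (act h) E)"
    if "g \<in> carrier G" "h \<in> carrier G" for g h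
    using that closed mult by (auto simp: compose_def fun_eq_iff)
  show ?thesis
    by (intro group_action.intro group_hom.intro group_axioms group_BijGroup)
      (auto simp: group_hom_axioms_def hom_def BijGroup_def bij comp)
qed

section \<open>Groups whose elements have two fixed points\<close>

text \<open>
The combinatorial properties of a finite group of rotations of the sphere, acting on the set P of
its poles, that suffice for its classification when the group is perfect.
\<close>

locale pole_action = group_action G P \<phi> for G (structure) and P and \<phi> :: "'g \<Rightarrow> 'p \<Rightarrow> 'p" +
  assumes finG: "finite (carrier G)" and finP: "finite P" and perf: "perfect G"
    and two_fixed: "g \<in> carrier G \<Longrightarrow> g \<noteq> \<one> \<Longrightarrow> card {x\<in>P. \<phi> g x = x} = 2"
    and stab_comm: "x \<in> P \<Longrightarrow> g \<in> stabilizer G \<phi> x \<Longrightarrow> h \<in> stabilizer G \<phi> x \<Longrightarrow> g \<otimes> h = h \<otimes> g"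
    and is_pole: "x \<in> P \<Longrightarrow> stabilizer G \<phi> x \<noteq> {\<one>}"
begin

sublocale group G using group_hom group_hom.axioms(1) by blast

abbreviation Stab where "Stab \<equiv> stabilizer G \<phi>"

lemma Stab_iff: "g \<in> Stab x \<longleftrightarrow> g \<in> carrier G \<and> \<phi> g x = x"
  by (simp add: stabilizer_def)

lemma act_1: "x \<in> P \<Longrightarrow> \<phi> \<one> x = x"
  unfolding id_eq_one[symmetric] by simp

lemma act_P: "g \<in> carrier G \<Longrightarrow> x \<in> P \<Longrightarrow> \<phi> g x \<in> P"
  using element_image by blast

lemma act_inv: "g \<in> carrier G \<Longrightarrow> x \<in> P \<Longrightarrow> \<phi> (inv g) (\<phi> g x) = x"
  "g \<in> carrier G \<Longrightarrow> x \<in> P \<Longrightarrow> \<phi> g (\<phi> (inv g) x) = x"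
proof -
  assume g: "g \<in> carrier G" and x: "x \<in> P"
  show "\<phi> (inv g) (\<phi> g x) = x"
    using composition_rule[OF x inv_closed[OF g] g] act_1[OF x] g by simp
  show "\<phi> g (\<phi> (inv g) x) = x"
    using composition_rule[OF x g inv_closed[OF g]] act_1[OF x] g by simp
qed

lemma act_inj: "g \<in> carrier G \<Longrightarrow> x \<in> P \<Longrightarrow> y \<in> P \<Longrightarrow> \<phi> g x = \<phi> g y \<longleftrightarrow> x = y"
proof -
  assume g: "g \<in> carrier G" and x: "x \<in> P" and y: "y \<in> P"
  show ?thesis using act_inv(1)[OF g x] act_inv(1)[OF g y] by metis
qed

lemma Stab_subgroup: "x \<in> P \<Longrightarrow> subgroup (Stab x) G"
  by (rule stabilizer_subgroup)

lemma finite_Stab: "finite (Stab x)"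
  using finG by (rule finite_subset[rotated]) (auto simp: Stab_iff)

lemma card_Stab_ge_2: assumes "x \<in> P" shows "card (Stab x) \<ge> 2"
proof -
  have "\<one> \<in> Stab x" using Stab_subgroup[OF assms] subgroup.one_closed by blast
  then obtain g where "g \<in> Stab x" "g \<noteq> \<one>" using is_pole[OF assms] by blast
  thus ?thesis using \<open>\<one> \<in> Stab x\<close> finite_Stab card_mono[of "Stab x" "{\<one>, g}"] by auto
qed

lemma Stab_act: 
  assumes "g \<in> carrier G" "x \<in> P"
  shows "Stab (\<phi> g x) = (\<lambda>h. g \<otimes> h \<otimes> inv g) ` Stab x"
proof -
  have 1: "g \<otimes> h \<otimes> inv g \<in> Stab (\<phi> g x)" if "g \<in> carrier G" "x \<in> P" "h \<in> Stab x" for g h x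
    using that by (simp add: Stab_iff composition_rule act_P act_inv)
  have "h \<in> (\<lambda>h. g \<otimes> h \<otimes> inv g) ` Stab x" if h: "h \<in> Stab (\<phi> g x)" for h
  proof -
    have "inv g \<otimes> h \<otimes> inv (inv g) \<in> Stab x"
      using 1[of "inv g" "\<phi> g x" h] h assms by (simp add: act_P act_inv)
    moreover have "g \<otimes> (inv g \<otimes> h \<otimes> g) = h \<otimes> g" "h \<otimes> g \<otimes> inv g = h"
      using h assms by (simp_all add: Stab_iff m_assoc[symmetric]) (simp add: m_assoc)
    ultimately show ?thesis using assms by (auto intro!: image_eqI[of _ _ "inv g \<otimes> h \<otimes> g"])
  qed
  thus ?thesis using 1[OF assms] by blast
qed

lemma Stab_act_cong:
  "g \<in> carrier G \<Longrightarrow> x \<in> P \<Longrightarrow> y \<in> P \<Longrightarrow> Stab x = Stab y \<Longrightarrow> Stab (\<phi> g x) = Stab (\<phi> g y)"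
  by (simp only: Stab_act)

text \<open>
Every h in the stabilizer of x commutes with g and therefore permutes the two fixed points x and y
of g. As h fixes x, it fixes y too. So a stabilizer is shared by exactly two poles, the ends of an axis.
\<close>

lemma common_fixer:
  assumes "x \<in> P" "y \<in> P" "g \<in> Stab x" "g \<in> Stab y" "g \<noteq> \<one>"
  shows "Stab x \<subseteq> Stab y"
proof (cases "x = y")
  case False
  have g: "g \<in> carrier G" using assms by (simp add: Stab_iff)
  have "{x, y} \<subseteq> {z\<in>P. \<phi> g z = z}" using assms by (auto simp: Stab_iff)
  moreover have "card {x, y} = 2" using False by simp
  ultimately have Fix: "{z\<in>P. \<phi> g z = z} = {x, y}"
    using two_fixed[OF g assms(5)] finP by (intro card_subset_eq[symmetric]) auto
  show ?thesis
  proof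
    fix h assume h: "h \<in> Stab x"
    hence hc: "h \<in> carrier G" "\<phi> h x = x" by (simp_all add: Stab_iff)
    have "\<phi> g (\<phi> h y) = \<phi> h (\<phi> g y)"
      using stab_comm[OF assms(1,3) h] composition_rule[OF assms(2) g hc(1)]
        composition_rule[OF assms(2) hc(1) g] by simp
    also have "\<dots> = \<phi> h y" using assms(4) by (simp add: Stab_iff)
    finally have "\<phi> h y \<in> {x, y}" using Fix act_P hc assms(2) by blast
    moreover have "\<phi> h y \<noteq> x" using act_inj[OF hc(1) assms(1,2)] hc(2) False by auto
    ultimately show "h \<in> Stab y" using hc(1) by (simp add: Stab_iff)
  qed
qed simp

lemma same_Stab:
  "x \<in> P \<Longrightarrow> y \<in> P \<Longrightarrow> g \<in> Stab x \<Longrightarrow> g \<in> Stab y \<Longrightarrow> g \<noteq> \<one> \<Longrightarrow> Stab x = Stab y"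
  by (intro equalityI common_fixer[of x y g] common_fixer[of y x g])

lemma same_Stab_as_fixed_points:
  assumes "x \<in> P" "g \<in> Stab x" "g \<noteq> \<one>"
  shows "{y\<in>P. Stab y = Stab x} = {y\<in>P. \<phi> g y = y}"
proof (intro Collect_cong conj_cong refl)
  fix y assume y: "y \<in> P"
  have g: "g \<in> carrier G" using assms(2) by (simp add: Stab_iff)
  show "Stab y = Stab x \<longleftrightarrow> \<phi> g y = y"
  proof
    assume "Stab y = Stab x"
    hence "g \<in> Stab y" using assms(2) by simp
    thus "\<phi> g y = y" by (simp add: Stab_iff)
  next
    assume "\<phi> g y = y"
    hence "g \<in> Stab y" using g by (simp add: Stab_iff)
    thus "Stab y = Stab x" using same_Stab[OF y assms(1) _ assms(2,3)] by blast
  qed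
qed

lemma card_same_Stab:
  assumes "x \<in> P" shows "card {y\<in>P. Stab y = Stab x} = 2"
proof -
  obtain g where "g \<in> Stab x" "g \<noteq> \<one>"
    using is_pole[OF assms] subgroup.one_closed[OF Stab_subgroup[OF assms]] by blast
  thus ?thesis using same_Stab_as_fixed_points[OF assms] two_fixed[of g] by (simp add: Stab_iff)
qed

lemma orbit_sub: "x \<in> P \<Longrightarrow> orbit G \<phi> x \<subseteq> P"
  by (auto simp: orbit_def act_P)

lemma in_orbit: "g \<in> carrier G \<Longrightarrow> \<phi> g x \<in> orbit G \<phi> x"
  by (auto simp: orbit_def)

lemma orbit_closed: "x \<in> P \<Longrightarrow> g \<in> carrier G \<Longrightarrow> y \<in> orbit G \<phi> x \<Longrightarrow> \<phi> g y \<in> orbit G \<phi> x"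
proof -
  assume x: "x \<in> P" and g: "g \<in> carrier G" and "y \<in> orbit G \<phi> x"
  then obtain h where h: "h \<in> carrier G" "y = \<phi> h x" by (auto simp: orbit_def)
  hence "\<phi> g y = \<phi> (g \<otimes> h) x" using composition_rule[OF x g h(1)] by simp
  thus ?thesis using in_orbit[of "g \<otimes> h" x] g h by simp
qed

lemma orbit_transitive:
  assumes "x \<in> P" "y \<in> orbit G \<phi> x" "z \<in> orbit G \<phi> x"
  obtains g where "g \<in> carrier G" "z = \<phi> g y"
proof -
  obtain h k where hk: "h \<in> carrier G" "y = \<phi> h x" "k \<in> carrier G" "z = \<phi> k x"
    using assms by (auto simp: orbit_def)
  have "z = \<phi> (k \<otimes> inv h) y"
    using hk assms(1) by (simp add: composition_rule act_P act_inv)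
  moreover have "k \<otimes> inv h \<in> carrier G" using hk by simp
  ultimately show ?thesis using that by metis
qed

lemma finite_orbit: "finite (orbit G \<phi> x)"
  using finG by (auto simp: orbit_def)

lemma card_Stab_orbit: 
  assumes "x \<in> P" "y \<in> orbit G \<phi> x" shows "card (Stab y) = card (Stab x)"
proof -
  obtain g where g: "g \<in> carrier G" "y = \<phi> g x" using assms by (auto simp: orbit_def)
  have "inj_on (\<lambda>h. g \<otimes> h \<otimes> inv g) (Stab x)"
    using g by (intro inj_onI) (auto simp: Stab_iff)
  thus ?thesis using Stab_act[OF g(1) assms(1)] g(2) by (simp add: card_image)
qed

lemma card_transporter:
  assumes "x \<in> P" "Y \<subseteq> orbit G \<phi> x"
  shows "card {g\<in>carrier G. \<phi> g x \<in> Y} = card Y * card (Stab x)"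
proof -
  have 1: "card {g\<in>carrier G. \<phi> g x = y} = card (Stab x)" if y: "y \<in> Y" for y
  proof -
    obtain h where h: "h \<in> carrier G" "y = \<phi> h x" using y assms by (auto simp: orbit_def)
    have "bij_betw (\<lambda>g. h \<otimes> g) (Stab x) {g\<in>carrier G. \<phi> g x = y}"
      using h assms(1)
      by (intro bij_betwI[of _ _ _ "\<lambda>g. inv h \<otimes> g"]) (auto simp: Stab_iff composition_rule act_inv m_assoc[symmetric])
    thus ?thesis using bij_betw_same_card by metis
  qed
  have "{g\<in>carrier G. \<phi> g x \<in> Y} = (\<Union>y\<in>Y. {g\<in>carrier G. \<phi> g x = y})" by blast
  also have "card \<dots> = (\<Sum>y\<in>Y. card {g\<in>carrier G. \<phi> g x = y})"
    using finG finite_subset[OF assms(2) finite_orbit] by (intro card_UN_disjoint) auto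
  also have "\<dots> = card Y * card (Stab x)" using 1 by simp
  finally show ?thesis .
qed

text \<open>
An invariant function on an orbit cuts it into blocks, its level sets, that the group permutes. By
perfectness there cannot be two or three of them.
\<close>

definition block :: "('p \<Rightarrow> 'b) \<Rightarrow> 'p \<Rightarrow> 'p \<Rightarrow> 'p set" where
  "block f z x = {y \<in> orbit G \<phi> z. f y = f x}"

definition invariant_on :: "('p \<Rightarrow> 'b) \<Rightarrow> 'p \<Rightarrow> bool" where
  "invariant_on f z \<longleftrightarrow> (\<forall>g\<in>carrier G. \<forall>x\<in>orbit G \<phi> z. \<forall>y\<in>orbit G \<phi> z. f x = f y \<longrightarrow> f (\<phi> g x) = f (\<phi> g y))"

lemma act_block:
  assumes z: "z \<in> P" and f: "invariant_on f z" and g: "g \<in> carrier G" and x: "x \<in> orbit G \<phi> z"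
  shows "\<phi> g ` block f z x = block f z (\<phi> g x)"
proof -
  have sub: "\<phi> g y \<in> block f z (\<phi> g x)" if "g \<in> carrier G" "x \<in> orbit G \<phi> z" "y \<in> block f z x" for g x y
  proof -
    have y: "y \<in> orbit G \<phi> z" "f y = f x" using that(3) by (simp_all add: block_def)
    hence "f (\<phi> g y) = f (\<phi> g x)" using f that(1,2) unfolding invariant_on_def by blast
    thus ?thesis using orbit_closed[OF z that(1) y(1)] by (simp add: block_def)
  qed
  have "y \<in> \<phi> g ` block f z x" if y: "y \<in> block f z (\<phi> g x)" for y
  proof -
    have yP: "y \<in> P" "x \<in> P" using y x orbit_sub[OF z] by (auto simp: block_def)
    have "\<phi> (inv g) y \<in> block f z (\<phi> (inv g) (\<phi> g x))"
      using sub[of "inv g" "\<phi> g x" y] g y orbit_closed[OF z g x] by blast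
    hence "\<phi> (inv g) y \<in> block f z x" using g yP by (simp add: act_inv)
    thus ?thesis using g yP act_inv(2)[of g y] by (metis image_eqI)
  qed
  thus ?thesis using sub[OF g x] by blast
qed

lemma blocks:
  assumes z: "z \<in> P" and f: "invariant_on f z"
  defines "B \<equiv> block f z ` orbit G \<phi> z"
  shows "finite B" "card (orbit G \<phi> z) = card B * card (block f z z)"
    "\<And>g b. g \<in> carrier G \<Longrightarrow> b \<in> B \<Longrightarrow> \<phi> g ` b \<in> B"
    "\<And>b. b \<in> B \<Longrightarrow> \<phi> \<one> ` b = b"
    "\<And>g h b. g \<in> carrier G \<Longrightarrow> h \<in> carrier G \<Longrightarrow> b \<in> B \<Longrightarrow> \<phi> (g \<otimes> h) ` b = \<phi> g ` \<phi> h ` b"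
proof -
  have bP: "b \<subseteq> P" if "b \<in> B" for b using that orbit_sub[OF z] by (auto simp: B_def block_def)
  show finB: "finite B" using finite_orbit by (simp add: B_def)
  show "\<And>g b. g \<in> carrier G \<Longrightarrow> b \<in> B \<Longrightarrow> \<phi> g ` b \<in> B"
    using act_block[OF z f] orbit_closed[OF z] by (auto simp: B_def)
  show "\<And>b. b \<in> B \<Longrightarrow> \<phi> \<one> ` b = b"
    using bP act_1 by (force simp: image_iff)
  show "\<And>g h b. g \<in> carrier G \<Longrightarrow> h \<in> carrier G \<Longrightarrow> b \<in> B \<Longrightarrow> \<phi> (g \<otimes> h) ` b = \<phi> g ` \<phi> h ` b"
    unfolding image_image using bP by (intro image_cong refl composition_rule) auto
  have zO: "z \<in> orbit G \<phi> z" using orbit_refl z by blast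
  have cb: "card b = card (block f z z)" if b: "b \<in> B" for b
  proof -
    obtain x where x: "x \<in> orbit G \<phi> z" "b = block f z x" using b by (auto simp: B_def)
    obtain g where g: "g \<in> carrier G" "x = \<phi> g z" using x by (auto simp: orbit_def)
    have "block f z z \<subseteq> P" using orbit_sub[OF z] by (auto simp: block_def)
    hence "inj_on (\<phi> g) (block f z z)" using inj_prop[OF g(1)] inj_on_subset by blast
    thus ?thesis using act_block[OF z f g(1) zO] x g by (metis card_image)
  qed
  have "orbit G \<phi> z = \<Union> B" by (auto simp: B_def block_def)
  also have "card \<dots> = (\<Sum>b\<in>B. card b)"
  proof (rule card_Union_disjoint)
    show "disjoint B" by (auto simp: B_def disjoint_def block_def)
  qed (auto simp: B_def block_def intro: finite_subset[OF _ finite_orbit])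
  also have "\<dots> = card B * card (block f z z)" using cb by simp
  finally show "card (orbit G \<phi> z) = card B * card (block f z z)" .
qed

lemma card_blocks_not_small:
  assumes z: "z \<in> P" and f: "invariant_on f z"
  shows "card (block f z ` orbit G \<phi> z) = 1 \<or> card (block f z ` orbit G \<phi> z) > 3"
proof (rule disjCI)
  assume "\<not> 3 < card (block f z ` orbit G \<phi> z)"
  hence "\<phi> g ` b = b" if "g \<in> carrier G" "b \<in> block f z ` orbit G \<phi> z" for g b
    using that perfect_action_le_3_trivial[OF group_axioms perf blocks(1,3,4,5)[OF z f], of g b] by simp
  moreover have zO: "z \<in> orbit G \<phi> z" using orbit_refl z by blast
  ultimately have "block f z (\<phi> g z) = block f z z" if "g \<in> carrier G" for g
    using that act_block[OF z f that zO] by simp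
  hence "block f z ` orbit G \<phi> z = {block f z z}" using zO by (auto simp: orbit_def)
  thus "card (block f z ` orbit G \<phi> z) = 1" by simp
qed

text \<open>
The identity function has one-point blocks, which excludes two and three poles. If the orbit were a
single pole, the group would be its stabilizer, hence commutative and perfect, hence trivial.
\<close>

lemma card_orbit_gt_3:
  assumes z: "z \<in> P" shows "card (orbit G \<phi> z) > 3"
proof -
  have inv: "invariant_on (\<lambda>x. x) z" by (simp add: invariant_on_def)
  have "z \<in> orbit G \<phi> z" using orbit_refl z by blast
  hence "block (\<lambda>x. x) z z = {z}" by (auto simp: block_def)
  hence "card (block (\<lambda>x. x) z z) = 1" by simp
  hence eq: "card (orbit G \<phi> z) = card (block (\<lambda>x. x) z ` orbit G \<phi> z)" using blocks(2)[OF z inv] by simp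
  have "card (orbit G \<phi> z) \<noteq> 1"
  proof
    assume "card (orbit G \<phi> z) = 1"
    hence "orbit G \<phi> z = {z}" using \<open>z \<in> orbit G \<phi> z\<close> by (metis card_1_singletonE singletonD)
    hence Sz: "Stab z = carrier G" using in_orbit[of _ z] by (auto simp: Stab_iff)
    hence "comm_group G" using stab_comm[OF z] by (intro group_comm_groupI) auto
    hence "derived G (carrier G) = {\<one>}" using comm_group.derived_eq_singleton by blast
    thus False using perf is_pole[OF z] Sz by (simp add: perfect_def)
  qed
  thus ?thesis using card_blocks_not_small[OF z inv] eq by linarith
qed

lemma orbit_stabilizer: "x \<in> P \<Longrightarrow> card (Stab x) * card (orbit G \<phi> x) = Coset.order G"
  using orbit_stabilizer_theorem by (simp add: mult.commute)

text \<open>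
Burnside's lemma for r orbits and N = |G| reads r N = |P| + 2 (N - 1). As every orbit has between
4 and N/2 elements, r is at least 3 and less than 4.
\<close>

lemma three_orbits:
  assumes nontriv: "carrier G \<noteq> {\<one>}"
  shows "card (orbits G P \<phi>) = 3" "(\<Sum>U\<in>orbits G P \<phi>. card U) = Coset.order G + 2"
proof -
  define N r C where "N = Coset.order G" and "r = card (orbits G P \<phi>)" and "C = (\<Sum>U\<in>orbits G P \<phi>. card U)"
  have N: "N \<ge> 2"
  proof -
    obtain g where "g \<in> carrier G" "g \<noteq> \<one>" using nontriv by auto
    thus ?thesis using card_mono[OF finG, of "{\<one>, g}"] by (simp add: N_def Coset.order_def)
  qed
  have CP: "C = card P"
    using disjoint_sum[OF finP, of "\<lambda>_. 1 :: nat"] by (simp add: C_def)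
  have "r * N = (\<Sum>g\<in>carrier G. card (invariants P \<phi> g))"
    using burnside[OF finG finP] by (simp add: r_def N_def)
  also have "\<dots> = card (invariants P \<phi> \<one>) + (\<Sum>g\<in>carrier G - {\<one>}. card (invariants P \<phi> g))"
    using finG by (intro sum.remove) auto
  also have "invariants P \<phi> \<one> = P" using act_1 by (auto simp: invariants_def)
  also have "(\<Sum>g\<in>carrier G - {\<one>}. card (invariants P \<phi> g)) = (\<Sum>g\<in>carrier G - {\<one>}. 2)"
    by (rule sum.cong) (auto simp: invariants_def two_fixed)
  also have "\<dots> = 2 * (N - 1)" using finG by (simp add: N_def Coset.order_def)
  finally have rN: "r * N = C + 2 * (N - 1)" by (simp add: CP)
  have orb: "card U \<ge> 4 \<and> 2 * card U \<le> N" if U: "U \<in> orbits G P \<phi>" for U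
  proof -
    obtain x where x: "x \<in> P" "U = orbit G \<phi> x" using U by (auto simp: orbits_def)
    have "2 * card U \<le> card (Stab x) * card U" using card_Stab_ge_2[OF x(1)] by simp
    thus ?thesis using orbit_stabilizer[OF x(1)] card_orbit_gt_3[OF x(1)] x(2) by (simp add: N_def)
  qed
  have "4 * r \<le> C"
    using sum_bounded_below[of "orbits G P \<phi>" 4 card] orb by (simp add: C_def r_def mult.commute)
  moreover have "2 * C \<le> r * N"
    using sum_bounded_above[of "orbits G P \<phi>" "\<lambda>U. 2 * card U" N] orb by (simp add: C_def r_def sum_distrib_left)
  ultimately have "r = 3"
  proof -
    have "r * N \<le> 4 * N - 4" using rN \<open>2 * C \<le> r * N\<close> N by linarith
    hence "\<not> 4 \<le> r" using N mult_le_mono1[of 4 r N] by linarith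
    moreover have "r \<noteq> 0" using rN N by (cases "r = 0") auto
    moreover have "r \<noteq> 1" using rN N \<open>4 * r \<le> C\<close> by (cases "r = 1") auto
    moreover have "r \<noteq> 2" using rN N \<open>4 * r \<le> C\<close> by (cases "r = 2") auto
    ultimately show ?thesis by linarith
  qed
  thus "card (orbits G P \<phi>) = 3" "(\<Sum>U\<in>orbits G P \<phi>. card U) = Coset.order G + 2"
    using rN N by (simp_all add: r_def C_def N_def)
qed

text \<open>
The assumption on z says that both ends of the axis through z lie in one orbit. With six poles this
orbit would consist of three axes, and the group would permute these three blocks. This excludes the
groups of the tetrahedron and of the octahedron.
\<close>

lemma no_orbit_of_three_pairs:
  assumes z: "z \<in> P" and same: "\<And>y. y \<in> P \<Longrightarrow> Stab y = Stab z \<Longrightarrow> y \<in> orbit G \<phi> z"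
  shows "card (orbit G \<phi> z) \<noteq> 6"
proof
  assume six: "card (orbit G \<phi> z) = 6"
  have inv: "invariant_on Stab z"
    using Stab_act_cong orbit_sub[OF z] unfolding invariant_on_def by blast
  have "block Stab z z = {y\<in>P. Stab y = Stab z}"
    using same orbit_sub[OF z] by (auto simp: block_def)
  hence "card (block Stab z z) = 2" using card_same_Stab[OF z] by simp
  hence "card (block Stab z ` orbit G \<phi> z) = 3" using blocks(2)[OF z inv] six by simp
  thus False using card_blocks_not_small[OF z inv] by simp
qed

text \<open>
The normalizer of the stabilizer of x, that is, the stabilizer of the axis through x.
\<close>

definition Nstab where "Nstab x = {g\<in>carrier G. Stab (\<phi> g x) = Stab x}"

lemma Nstab_conj:
  assumes g: "g \<in> carrier G" and x: "x \<in> P" and h: "h \<in> carrier G"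
  shows "h \<in> Nstab (\<phi> g x) \<longleftrightarrow> inv g \<otimes> h \<otimes> g \<in> Nstab x"
proof -
  have 1: "\<phi> (inv g \<otimes> h \<otimes> g) x = \<phi> (inv g) (\<phi> h (\<phi> g x))"
    using assms by (simp add: composition_rule act_P)
  have 2: "\<phi> h (\<phi> g x) = \<phi> g (\<phi> (inv g \<otimes> h \<otimes> g) x)"
    unfolding 1 using assms by (simp add: act_P act_inv)
  have P: "\<phi> g x \<in> P" "\<phi> h (\<phi> g x) \<in> P" "\<phi> (inv g \<otimes> h \<otimes> g) x \<in> P" using assms by (auto intro!: act_P)
  have "Stab (\<phi> h (\<phi> g x)) = Stab (\<phi> g x) \<longleftrightarrow> Stab (\<phi> (inv g \<otimes> h \<otimes> g) x) = Stab x"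
  proof
    assume "Stab (\<phi> h (\<phi> g x)) = Stab (\<phi> g x)"
    from Stab_act_cong[OF inv_closed[OF g] P(2,1) this]
    show "Stab (\<phi> (inv g \<otimes> h \<otimes> g) x) = Stab x" unfolding 1 using g x by (simp add: act_inv)
  next
    assume "Stab (\<phi> (inv g \<otimes> h \<otimes> g) x) = Stab x"
    from Stab_act_cong[OF g P(3) x this] show "Stab (\<phi> h (\<phi> g x)) = Stab (\<phi> g x)" unfolding 2 .
  qed
  thus ?thesis using assms by (simp add: Nstab_def)
qed

text \<open>
The fifteen axes of order two of an icosahedron form five triples of mutually orthogonal axes, and
the rotations permute the triples as the alternating group. Orthogonality is expressed by the
normalizer of a stabilizer of order two: it is a Klein four-group, and its three involutions belong to
the three axes of the triple. So a block F consists of the six poles with the same normalizer, and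
there are 30/6 = 5 blocks. The kernel of the action on the blocks is shown to be trivial, and both
groups have 60 elements.
\<close>

lemma icosahedral:
  assumes N: "Coset.order G = 60" and x1: "x1 \<in> P" "card (Stab x1) = 2"
    and types: "\<And>y. y \<in> P \<Longrightarrow> card (Stab y) \<in> {2, 3, 5}"
    and T: "\<And>x y. x \<in> P \<Longrightarrow> y \<in> P \<Longrightarrow> card (Stab x) = card (Stab y) \<Longrightarrow> y \<in> orbit G \<phi> x"
  shows "G \<cong> alt_group 5"
proof -
  let ?O = "orbit G \<phi> x1"
  have cO: "card ?O = 30" using orbit_stabilizer[OF x1(1)] N x1(2) by simp
  have prime_dvd: "k = 1 \<or> k = e" if "k dvd e" "e \<in> {2, 3, 5}" for k e :: nat
  proof -
    have "k \<le> 5" using dvd_imp_le[OF that(1)] that(2) by auto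
    hence "k \<in> {0, 1, 2, 3, 4, 5}" by auto
    thus ?thesis using that by auto
  qed
  have fixer: "\<exists>z\<in>P. u \<in> Stab z" if "u \<in> carrier G" "u \<noteq> \<one>" for u
  proof -
    have "{x\<in>P. \<phi> u x = x} \<noteq> {}" using two_fixed[OF that] by (metis card.empty zero_neq_numeral)
    thus ?thesis using that by (auto simp: Stab_iff)
  qed
  have D_mult: "u \<otimes> v \<in> Nstab x" if "u \<in> Nstab x" "v \<in> Nstab x" "x \<in> P" for u v x
  proof -
    have uv: "u \<in> carrier G" "v \<in> carrier G" "Stab (\<phi> v x) = Stab x" "Stab (\<phi> u x) = Stab x" using that by (auto simp: Nstab_def)
    have "Stab (\<phi> (u \<otimes> v) x) = Stab (\<phi> u (\<phi> v x))" using uv that(3) by (simp add: composition_rule)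
    also have "\<dots> = Stab (\<phi> u x)" using Stab_act_cong[OF uv(1) act_P[OF uv(2) that(3)] that(3) uv(3)] .
    finally show ?thesis using uv by (simp add: Nstab_def)
  qed
  \<comment> \<open>The square of u fixes x, so the fourth power of u is one; but u fixes a pole, so its order also divides 2, 3 or 5.\<close>
  have D_inv: "u \<otimes> u = \<one>" if u: "u \<in> Nstab x" and x: "x \<in> P" "card (Stab x) = 2" for u x
  proof (rule ccontr)
    assume uu: "u \<otimes> u \<noteq> \<one>"
    have uc: "u \<in> carrier G" "Stab (\<phi> u x) = Stab x" using u by (auto simp: Nstab_def)
    have "u \<otimes> u \<in> Stab x"
    proof (cases "\<phi> u x = x")
      case True thus ?thesis using uc x(1) by (simp add: Stab_iff composition_rule)
    next
      case False
      let ?Y = "{y\<in>P. Stab y = Stab x}"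
      have uP: "\<phi> u x \<in> P" "\<phi> u (\<phi> u x) \<in> P" using uc x act_P by auto
      have "{x, \<phi> u x} \<subseteq> ?Y" using uc x uP by auto
      moreover have "card {x, \<phi> u x} = 2" using False by simp
      ultimately have Y: "?Y = {x, \<phi> u x}"
        using card_same_Stab[OF x(1)] finP by (intro card_subset_eq[symmetric]) auto
      have "Stab (\<phi> u (\<phi> u x)) = Stab (\<phi> u x)" using Stab_act_cong[OF uc(1) uP(1) x(1) uc(2)] .
      hence "\<phi> u (\<phi> u x) \<in> {x, \<phi> u x}" using uP uc(2) unfolding Y[symmetric] by simp
      hence "\<phi> u (\<phi> u x) = x" using act_inj[OF uc(1) uP(1) x(1)] False by auto
      thus ?thesis using uc x(1) by (simp add: Stab_iff composition_rule)
    qed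
    hence "(u \<otimes> u) [^] (2::nat) = \<one>" using pow_card_subgroup[OF Stab_subgroup[OF x(1)]] x(2) by metis
    hence u4: "u \<otimes> u \<otimes> u \<otimes> u = \<one>" using uc by (simp add: numeral_2_eq_2 m_assoc)
    have "u \<noteq> \<one>" using uu by auto
    then obtain z where z: "z \<in> P" "u \<in> Stab z" using fixer uc by blast
    have e: "u [^] card (Stab z) = \<one>" by (rule pow_card_subgroup[OF Stab_subgroup[OF z(1)] z(2)])
    have "card (Stab z) = 2 \<or> card (Stab z) = 3 \<or> card (Stab z) = 5" using types[OF z(1)] by auto
    thus False
    proof (elim disjE)
      assume "card (Stab z) = 2" thus False using e uu uc by (simp add: numeral_2_eq_2)
    next
      assume "card (Stab z) = 3"
      hence "u \<otimes> u \<otimes> u = \<one>" using e uc by (simp add: numeral_3_eq_3)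
      thus False using u4 uc \<open>u \<noteq> \<one>\<close> by simp
    next
      assume "card (Stab z) = 5"
      hence "u \<otimes> u \<otimes> u \<otimes> u \<otimes> u = \<one>" using e uc by (simp add: eval_nat_numeral)
      thus False using u4 uc \<open>u \<noteq> \<one>\<close> by simp
    qed
  qed
  \<comment> \<open>A group of exponent two is commutative.\<close>
  have D_comm: "u \<otimes> v = v \<otimes> u" if uv: "u \<in> Nstab x" "v \<in> Nstab x" and x: "x \<in> P" "card (Stab x) = 2" for u v x
  proof -
    have c: "u \<in> carrier G" "v \<in> carrier G" using uv by (auto simp: Nstab_def)
    have i: "inv u = u" "inv v = v" "inv (u \<otimes> v) = u \<otimes> v"
      using D_inv[OF uv(1) x] D_inv[OF uv(2) x] D_inv[OF D_mult[OF uv x(1)] x] c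
      by (simp_all add: inv_equality)
    show ?thesis using inv_mult_group[OF c] i by simp
  qed
  have finD: "finite (Nstab x)" for x using finG by (auto simp: Nstab_def)
  have card_D: "card (Nstab x) = 4" if x: "x \<in> P" "card (Stab x) = 2" for x
  proof -
    let ?Y = "{y\<in>P. Stab y = Stab x}"
    have "Nstab x = {g\<in>carrier G. \<phi> g x \<in> ?Y}" using x act_P by (auto simp: Nstab_def)
    moreover have "?Y \<subseteq> orbit G \<phi> x" using T[OF x(1)] by auto
    ultimately show ?thesis using card_transporter[OF x(1), of ?Y] card_same_Stab[OF x(1)] x(2) by simp
  qed
  \<comment> \<open>Elements that commute with the involution s permute its two poles and hence normalize the stabilizer of z.\<close>
  have same_D: "Nstab x = Nstab z"
    if x: "x \<in> P" "card (Stab x) = 2" and z: "z \<in> P" "card (Stab z) = 2" and s: "s \<in> Stab z" "s \<noteq> \<one>" "s \<in> Nstab x" for x z s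
  proof (rule card_subset_eq[OF finD])
    show "Nstab x \<subseteq> Nstab z"
    proof
      fix u assume u: "u \<in> Nstab x"
      have c: "u \<in> carrier G" "s \<in> carrier G" "\<phi> s z = z" using u s by (auto simp: Nstab_def Stab_iff)
      have "\<phi> s (\<phi> u z) = \<phi> (s \<otimes> u) z" using c z by (simp add: composition_rule)
      also have "\<dots> = \<phi> (u \<otimes> s) z" using D_comm[OF s(3) u x] by simp
      also have "\<dots> = \<phi> u z" using c z by (simp add: composition_rule)
      finally have "s \<in> Stab (\<phi> u z)" using c by (simp add: Stab_iff)
      hence "Stab (\<phi> u z) = Stab z" using same_Stab[OF act_P[OF c(1) z(1)] z(1) _ s(1,2)] by blast
      thus "u \<in> Nstab z" using c by (simp add: Nstab_def)
    qed
    show "card (Nstab x) = card (Nstab z)" using card_D x z by simp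
  qed
  have invD: "invariant_on Nstab x1"
    unfolding invariant_on_def
  proof (intro ballI impI)
    fix g x y assume g: "g \<in> carrier G" and xy: "x \<in> ?O" "y \<in> ?O" "Nstab x = Nstab y"
    have P: "x \<in> P" "y \<in> P" using xy orbit_sub[OF x1(1)] by auto
    have "h \<in> Nstab (\<phi> g x) \<longleftrightarrow> h \<in> Nstab (\<phi> g y)" for h
      using Nstab_conj[OF g P(1), of h] Nstab_conj[OF g P(2), of h] xy(3) by (cases "h \<in> carrier G") (auto simp: Nstab_def)
    thus "Nstab (\<phi> g x) = Nstab (\<phi> g y)" by blast
  qed
  define F where "F = block Nstab x1 x1"
  have x1O: "x1 \<in> ?O" using orbit_refl x1 by blast
  have one_D: "\<one> \<in> Nstab x1" using x1 act_1 by (simp add: Nstab_def)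
  \<comment> \<open>F consists of the poles of the three involutions in the normalizer.\<close>
  have F_eq: "F = (\<Union>t\<in>Nstab x1 - {\<one>}. {y\<in>P. \<phi> t y = y})"
  proof (intro equalityI subsetI)
    fix z assume "z \<in> F"
    hence z: "z \<in> P" "Nstab z = Nstab x1" using orbit_sub[OF x1(1)] by (auto simp: F_def block_def)
    obtain s where s: "s \<in> Stab z" "s \<noteq> \<one>"
      using is_pole[OF z(1)] subgroup.one_closed[OF Stab_subgroup[OF z(1)]] by blast
    hence "s \<in> Nstab z" by (auto simp: Nstab_def Stab_iff)
    thus "z \<in> (\<Union>t\<in>Nstab x1 - {\<one>}. {y\<in>P. \<phi> t y = y})" using z s by (auto simp: Stab_iff)
  next
    fix z assume "z \<in> (\<Union>t\<in>Nstab x1 - {\<one>}. {y\<in>P. \<phi> t y = y})"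
    then obtain t where t: "t \<in> Nstab x1" "t \<noteq> \<one>" "z \<in> P" "\<phi> t z = z" by auto
    have tc: "t \<in> carrier G" using t by (simp add: Nstab_def)
    have tS: "t \<in> Stab z" using t tc by (simp add: Stab_iff)
    have tt: "t \<otimes> t = \<one>" using D_inv[OF t(1) x1] .
    have e: "t [^] card (Stab z) = \<one>" by (rule pow_card_subgroup[OF Stab_subgroup[OF t(3)] tS])
    have "card (Stab z) = 2"
    proof -
      have "card (Stab z) = 2 \<or> card (Stab z) = 3 \<or> card (Stab z) = 5" using types[OF t(3)] by auto
      moreover have "card (Stab z) \<noteq> 3"
        using e tt tc t(2) by (auto simp: numeral_3_eq_3)
      moreover have "card (Stab z) \<noteq> 5"
        using e tt tc t(2) by (auto simp: eval_nat_numeral)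
      ultimately show ?thesis by blast
    qed
    hence "z \<in> ?O" "Nstab x1 = Nstab z" using T[OF x1(1) t(3)] x1(2) same_D[OF x1 t(3) _ tS t(2,1)] by auto
    thus "z \<in> F" by (simp add: F_def block_def)
  qed
  have "card F = (\<Sum>t\<in>Nstab x1 - {\<one>}. card {y\<in>P. \<phi> t y = y})"
    unfolding F_eq
  proof (rule card_UN_disjoint)
    show "\<forall>i\<in>Nstab x1 - {\<one>}. \<forall>j\<in>Nstab x1 - {\<one>}. i \<noteq> j \<longrightarrow> {y\<in>P. \<phi> i y = y} \<inter> {y\<in>P. \<phi> j y = y} = {}"
    proof (intro ballI impI, rule ccontr)
      fix i j assume ij: "i \<in> Nstab x1 - {\<one>}" "j \<in> Nstab x1 - {\<one>}" "i \<noteq> j"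
        and "{y\<in>P. \<phi> i y = y} \<inter> {y\<in>P. \<phi> j y = y} \<noteq> {}"
      then obtain y where y: "y \<in> P" "i \<in> Stab y" "j \<in> Stab y" by (auto simp: Nstab_def Stab_iff)
      have "y \<in> F" using y ij unfolding F_eq by (auto simp: Stab_iff)
      hence "y \<in> ?O" by (simp add: F_def block_def)
      hence "card (Stab y) = 2" using card_Stab_orbit[OF x1(1)] x1(2) by simp
      moreover have "{\<one>, i, j} \<subseteq> Stab y" using y subgroup.one_closed[OF Stab_subgroup[OF y(1)]] by simp
      moreover have "card {\<one>, i, j} = 3" using ij by auto
      ultimately show False using card_mono[OF finite_Stab, of "{\<one>, i, j}" y] by simp
    qed
  qed (use finP finD in auto)
  also have "\<dots> = (\<Sum>t\<in>Nstab x1 - {\<one>}. 2)"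
    by (rule sum.cong) (auto simp: Nstab_def two_fixed)
  also have "\<dots> = 6" using card_D[OF x1] finD one_D by simp
  finally have cF: "card F = 6" .
  let ?B = "block Nstab x1 ` ?O"
  have cB: "card ?B = 5" using blocks(2)[OF x1(1) invD] cO cF by (simp add: F_def)
  obtain \<pi> where \<pi>: "group_hom G (alt_group 5) \<pi>" "\<forall>g\<in>carrier G. \<pi> g = id \<longrightarrow> (\<forall>b\<in>?B. \<phi> g ` b = b)"
  proof -
    have "\<exists>\<pi>. group_hom G (alt_group (card ?B)) \<pi> \<and> (\<forall>g\<in>carrier G. \<pi> g = id \<longrightarrow> (\<forall>b\<in>?B. \<phi> g ` b = b))"
      by (rule perfect_action_even[OF group_axioms perf blocks(1,3,4,5)[OF x1(1) invD]])
    thus thesis using that unfolding cB by blast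
  qed
  interpret \<pi>: group_hom G "alt_group 5" \<pi> by fact
  define K where "K = kernel G (alt_group 5) \<pi>"
  have K_iff: "g \<in> K \<longleftrightarrow> g \<in> carrier G \<and> \<pi> g = id" for g by (simp add: K_def kernel_def alt_group_one)
  have K_sub: "subgroup K G" unfolding K_def by (rule \<pi>.subgroup_kernel)
  have finK: "finite K" using finG by (auto simp: K_iff intro: finite_subset[of K "carrier G"])
  \<comment> \<open>An element of the kernel preserves F, and 6 * 2 = 12 elements of the group do so.\<close>
  have "K \<subseteq> {g\<in>carrier G. \<phi> g x1 \<in> F}"
  proof
    fix g assume g: "g \<in> K"
    have "x1 \<in> F" "F \<in> ?B" using x1O by (auto simp: F_def block_def)
    moreover have "\<phi> g ` F = F" using \<pi>(2) g \<open>F \<in> ?B\<close> unfolding K_iff by blast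
    ultimately have "\<phi> g x1 \<in> F" by blast
    thus "g \<in> {g\<in>carrier G. \<phi> g x1 \<in> F}" using g by (simp add: K_iff)
  qed
  moreover have "card {g\<in>carrier G. \<phi> g x1 \<in> F} = 12"
  proof -
    have "F \<subseteq> ?O" by (auto simp: F_def block_def)
    thus ?thesis using card_transporter[OF x1(1), of F] cF x1(2) by simp
  qed
  ultimately have K12: "card K \<le> 12" using card_mono[of "{g\<in>carrier G. \<phi> g x1 \<in> F}" K] finG by simp
  \<comment> \<open>An element of K other than the identity has a pole z, whose stabilizer has prime order and therefore lies in K. By normality the same holds for the 60/e poles in the orbit of z, where e is the order of the stabilizer. This makes at least 30 incidences of a pole with an element of K, but the at most 11 elements of K other than the identity account for only 22 of them.\<close>
  have "K = {\<one>}"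
  proof (rule ccontr)
    assume "K \<noteq> {\<one>}"
    then obtain g0 where g0: "g0 \<in> K" "g0 \<noteq> \<one>" using subgroup.one_closed[OF K_sub] by blast
    then obtain z where z: "z \<in> P" "g0 \<in> Stab z" using fixer by (auto simp: K_iff)
    have Kz: "Stab z \<subseteq> K"
    proof -
      interpret Sz: group "G\<lparr>carrier := Stab z\<rparr>" using subgroup_imp_group[OF Stab_subgroup[OF z(1)]] .
      have "subgroup (K \<inter> Stab z) (G\<lparr>carrier := Stab z\<rparr>)"
        using subgroups_Inter_pair[OF K_sub Stab_subgroup[OF z(1)]] Stab_subgroup[OF z(1)] by (intro subgroup_incl) auto
      from Sz.lagrange[OF this] have "card (K \<inter> Stab z) dvd card (Stab z)" 
        by (simp add: Coset.order_def) (metis dvd_triv_right)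
      moreover have "card (K \<inter> Stab z) \<noteq> 1"
      proof
        assume "card (K \<inter> Stab z) = 1"
        moreover have "{\<one>, g0} \<subseteq> K \<inter> Stab z"
          using g0 z subgroup.one_closed[OF K_sub] subgroup.one_closed[OF Stab_subgroup[OF z(1)]] by auto
        moreover have "card {\<one>, g0} = 2" using g0 by simp
        ultimately show False using card_mono[of "K \<inter> Stab z" "{\<one>, g0}"] finK by simp
      qed
      ultimately have "card (K \<inter> Stab z) = card (Stab z)" using prime_dvd[OF _ types[OF z(1)]] by blast
      hence "K \<inter> Stab z = Stab z" using finite_Stab by (intro card_subset_eq) auto
      thus ?thesis by blast
    qed
    have Kw: "Stab w \<subseteq> K" if w: "w \<in> orbit G \<phi> z" for w
    proof -
      obtain g where g: "g \<in> carrier G" "w = \<phi> g z" using w by (auto simp: orbit_def)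
      have "K \<lhd> G" unfolding K_def by (rule \<pi>.normal_kernel)
      hence "g \<otimes> h \<otimes> inv g \<in> K" if "h \<in> Stab z" for h
        using normal.inv_op_closed2[of K G g h] g Kz that by blast
      thus ?thesis using Stab_act[OF g(1) z(1)] g(2) by auto
    qed
    let ?T = "K - {\<one>}" and ?U = "orbit G \<phi> z"
    have "(\<Sum>w\<in>?U. card {g\<in>?T. \<phi> g w = w}) = (\<Sum>w\<in>?U. \<Sum>g\<in>?T. if \<phi> g w = w then 1 else 0)"
      using finK by (simp add: sum.inter_filter[symmetric])
    also have "\<dots> = (\<Sum>g\<in>?T. \<Sum>w\<in>?U. if \<phi> g w = w then 1 else 0)" by (rule sum.swap)
    also have "\<dots> = (\<Sum>g\<in>?T. card {w\<in>?U. \<phi> g w = w})"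
      using finite_orbit by (simp add: sum.inter_filter[symmetric])
    also have "\<dots> \<le> (\<Sum>g\<in>?T. 2)"
    proof (rule sum_mono)
      fix g assume g: "g \<in> ?T"
      have "card {w\<in>?U. \<phi> g w = w} \<le> card {w\<in>P. \<phi> g w = w}"
        using finP orbit_sub[OF z(1)] by (intro card_mono) auto
      thus "card {w\<in>?U. \<phi> g w = w} \<le> 2" using two_fixed[of g] g by (simp add: K_iff)
    qed
    also have "\<dots> \<le> 22" using K12 finK subgroup.one_closed[OF K_sub] by simp
    finally have le22: "(\<Sum>w\<in>?U. card {g\<in>?T. \<phi> g w = w}) \<le> 22" .
    have "card {g\<in>?T. \<phi> g w = w} = card (Stab z) - 1" if w: "w \<in> ?U" for w
    proof -
      have wP: "w \<in> P" using w orbit_sub[OF z(1)] by blast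
      have "{g\<in>?T. \<phi> g w = w} = Stab w - {\<one>}" using Kw[OF w] by (auto simp: Stab_iff K_iff)
      thus ?thesis using card_Stab_orbit[OF z(1) w] finite_Stab subgroup.one_closed[OF Stab_subgroup[OF wP]] by simp
    qed
    hence "card ?U * (card (Stab z) - 1) \<le> 22" using le22 by simp
    moreover have "card (Stab z) * card ?U = 60" using orbit_stabilizer[OF z(1)] N by simp
    moreover have "card (Stab z) \<in> {2, 3, 5}" using types[OF z(1)] .
    ultimately show False by auto
  qed
  hence inj: "inj_on \<pi> (carrier G)"
    unfolding K_def using \<pi>.trivial_ker_imp_inj by blast
  have "card (carrier (alt_group 5)) = 60"
    using alt_group_card_carrier[of 5] by (simp add: fact_numeral)
  moreover have "card (\<pi> ` carrier G) = 60" using inj N by (simp add: card_image Coset.order_def)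
  moreover have "\<pi> ` carrier G \<subseteq> carrier (alt_group 5)" by auto
  ultimately have "\<pi> ` carrier G = carrier (alt_group 5)"
    by (intro card_subset_eq) (auto intro: card_ge_0_finite)
  hence "\<pi> \<in> iso G (alt_group 5)"
    using inj \<pi>.homh by (simp add: iso_def bij_betw_def)
  thus ?thesis by (rule is_isoI)
qed

text \<open>
The orbit with six poles is the one with stabilizers of order 2 in the case (2, 3, 3), and of
order 4 in the case (2, 3, 4). No other orbit has stabilizers of this order, so it contains both ends
of each of its axes. In the case (2, 3, 5) this holds for all three orbits.
\<close>

theorem trivial_or_alt_group_5: "carrier G = {\<one>} \<or> G \<cong> alt_group 5"
proof (cases "carrier G = {\<one>}")
  case nt: False
  note three = three_orbits[OF nt]
  define e where "e U = (Coset.order G div card U)" for U :: "'p set"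
  have e: "e (orbit G \<phi> x) = card (Stab x)" if "x \<in> P" for x
    using orbit_stabilizer[OF that] card_orbit_gt_3[OF that] by (simp add: e_def div_mult_self_is_m flip: orbit_stabilizer[OF that])
  obtain U V W where UVW: "orbits G P \<phi> = {U, V, W}" "U \<noteq> V" "U \<noteq> W" "V \<noteq> W" "e U \<le> e V" "e V \<le> e W"
  proof -
    obtain a b c where abc: "orbits G P \<phi> = {a, b, c}" "a \<noteq> b" "a \<noteq> c" "b \<noteq> c"
      using three(1) unfolding card_3_iff by auto
    have perm: "{a, b, c} = {a, c, b}" "{a, b, c} = {b, a, c}" "{a, b, c} = {b, c, a}"
      "{a, b, c} = {c, a, b}" "{a, b, c} = {c, b, a}" by auto
    consider "e a \<le> e b" "e b \<le> e c" | "e a \<le> e c" "e c \<le> e b" | "e b \<le> e a" "e a \<le> e c"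
      | "e b \<le> e c" "e c \<le> e a" | "e c \<le> e a" "e a \<le> e b" | "e c \<le> e b" "e b \<le> e a" by linarith
    thus thesis
      by cases (use that abc perm in metis)+
  qed
  have "U \<in> orbits G P \<phi>" "V \<in> orbits G P \<phi>" "W \<in> orbits G P \<phi>" using UVW by auto
  then obtain u v w where uvw: "u \<in> P" "v \<in> P" "w \<in> P" "U = orbit G \<phi> u" "V = orbit G \<phi> v" "W = orbit G \<phi> w"
    unfolding orbits_def by blast
  have sum: "card U + card V + card W = Coset.order G + 2" using three(2) UVW by simp
  have arith: "card (Stab u) = 2 \<and> card (Stab v) = 3 \<and>
      (card (Stab w) = 3 \<and> Coset.order G = 12 \<or> card (Stab w) = 4 \<and> Coset.order G = 24 \<or> card (Stab w) = 5 \<and> Coset.order G = 60)"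
  proof (rule spherical_orders)
    show "card (Stab u) \<le> card (Stab v)" "card (Stab v) \<le> card (Stab w)" using UVW uvw by (simp_all flip: e)
    show "card (Stab u) * card U = Coset.order G" "card (Stab v) * card V = Coset.order G" "card (Stab w) * card W = Coset.order G"
      using orbit_stabilizer uvw by simp_all
    show "3 \<le> card W" using card_orbit_gt_3 uvw by (simp add: less_imp_le)
  qed (use card_Stab_ge_2 uvw sum in auto)
  have cover: "y \<in> U \<or> y \<in> V \<or> y \<in> W" if "y \<in> P" for y
    using orbits_coverture UVW(1) that by auto
  have type: "card (Stab y) = card (Stab u)" if "y \<in> U" for y using card_Stab_orbit[OF uvw(1)] that uvw by simp
  have typev: "card (Stab y) = card (Stab v)" if "y \<in> V" for y using card_Stab_orbit[OF uvw(2)] that uvw by simp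
  have typew: "card (Stab y) = card (Stab w)" if "y \<in> W" for y using card_Stab_orbit[OF uvw(3)] that uvw by simp
  from arith consider "card (Stab w) = 3" "Coset.order G = 12" | "card (Stab w) = 4" "Coset.order G = 24"
    | "card (Stab w) = 5" "Coset.order G = 60" by auto
  hence "G \<cong> alt_group 5"
  proof cases
    case 1
    have "card (orbit G \<phi> u) = 6" using orbit_stabilizer[OF uvw(1)] arith 1 by simp
    moreover have "y \<in> orbit G \<phi> u" if "y \<in> P" "Stab y = Stab u" for y
      using cover[OF that(1)] typev[of y] typew[of y] arith 1 that(2) uvw(4) by auto
    ultimately show ?thesis using no_orbit_of_three_pairs[OF uvw(1)] by blast
  next
    case 2
    have "card (orbit G \<phi> w) = 6" using orbit_stabilizer[OF uvw(3)] arith 2 by simp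
    moreover have "y \<in> orbit G \<phi> w" if "y \<in> P" "Stab y = Stab w" for y
      using cover[OF that(1)] typev[of y] type[of y] arith 2 that(2) uvw(6) by auto
    ultimately show ?thesis using no_orbit_of_three_pairs[OF uvw(3)] by blast
  next
    case 3
    show ?thesis
    proof (rule icosahedral[OF 3(2) uvw(1)])
      show "card (Stab u) = 2" using arith by simp
      show "card (Stab y) \<in> {2, 3, 5}" if "y \<in> P" for y
        using cover[OF that] type[of y] typev[of y] typew[of y] arith 3 by auto
      show "y \<in> orbit G \<phi> x" if xy: "x \<in> P" "y \<in> P" "card (Stab x) = card (Stab y)" for x y
      proof -
        have "(x \<in> U \<and> y \<in> U) \<or> (x \<in> V \<and> y \<in> V) \<or> (x \<in> W \<and> y \<in> W)"
          using cover[OF xy(1)] cover[OF xy(2)] xy(3) type[of x] type[of y] typev[of x] typev[of y] typew[of x] typew[of y] arith 3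
          by auto
        thus ?thesis
          using orbit_transitive[OF uvw(1), of x y] orbit_transitive[OF uvw(2), of x y] orbit_transitive[OF uvw(3), of x y]
            in_orbit uvw(4,5,6) by metis
      qed
    qed
  qed
  thus ?thesis ..
qed simp

end

section \<open>Finite groups acting on the projective line\<close>

text \<open>
A matrix is listed column by column: (a, b) and (c, d) are the images of the unit vectors. Points of
the projective line are represented by lines in the plane, as sets of vectors, so that two
invertible matrices act equally if and only if they are proportional.
\<close>

type_synonym 'a mat2 = "'a \<times> 'a \<times> 'a \<times> 'a"

fun mact :: "'a::field mat2 \<Rightarrow> 'a \<times> 'a \<Rightarrow> 'a \<times> 'a" where
  "mact (a, b, c, d) (x, y) = (a * x + c * y, b * x + d * y)"

fun mdet :: "'a::field mat2 \<Rightarrow> 'a" where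
  "mdet (a, b, c, d) = a * d - b * c"

fun mmul :: "'a::field mat2 \<Rightarrow> 'a mat2 \<Rightarrow> 'a mat2" where
  "mmul (a, b, c, d) (a', b', c', d') =
    (a * a' + c * b', b * a' + d * b', a * c' + c * d', b * c' + d * d')"

fun madj :: "'a::field mat2 \<Rightarrow> 'a mat2" where
  "madj (a, b, c, d) = (d, - b, - c, a)"

text \<open>
The discriminant of the characteristic polynomial.
\<close>

fun mdisc :: "'a::field mat2 \<Rightarrow> 'a" where
  "mdisc (a, b, c, d) = (a - d)\<^sup>2 + 4 * b * c"

fun scale :: "'a::field \<Rightarrow> 'a \<times> 'a \<Rightarrow> 'a \<times> 'a" where
  "scale t (x, y) = (t * x, t * y)"

fun cross :: "'a::field \<times> 'a \<Rightarrow> 'a \<times> 'a \<Rightarrow> 'a" where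
  "cross (x, y) (x', y') = x * y' - x' * y"

definition line :: "'a::field \<times> 'a \<Rightarrow> ('a \<times> 'a) set" where
  "line v = range (\<lambda>t. scale t v)"

definition lines :: "('a::field \<times> 'a) set set" where
  "lines = line ` (- {(0, 0)})"

lemma mact_mmul: "mact (mmul A B) v = mact A (mact B v)"
  by (cases A; cases B; cases v) (simp add: algebra_simps)

lemma mdet_mmul: "mdet (mmul A B) = mdet A * mdet B"
  by (cases A; cases B) (simp add: algebra_simps)

lemma mdet_madj: "mdet (madj A) = mdet A"
  by (cases A) (simp add: algebra_simps)

lemma mact_madj: "mact A (mact (madj A) v) = scale (mdet A) v" "mact (madj A) (mact A v) = scale (mdet A) v"
  by (cases A; cases v; simp add: algebra_simps)+

lemma mact_scale: "mact A (scale t v) = scale t (mact A v)"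
  by (cases A; cases v) (simp add: algebra_simps)

lemma scale_scale: "scale s (scale t v) = scale (s * t) v"
  by (cases v) simp

lemma scale_1: "scale 1 v = v"
  by (cases v) simp

lemma scale_eq_0_iff: "scale t v = (0, 0) \<longleftrightarrow> t = 0 \<or> v = (0, 0)"
  by (cases v) auto

lemma scale_left_inj: "t \<noteq> 0 \<Longrightarrow> scale t v = scale t w \<longleftrightarrow> v = w"
  by (cases v; cases w) auto

lemma mact_nonzero:
  assumes "mdet A \<noteq> 0" "v \<noteq> (0, 0)" shows "mact A v \<noteq> (0, 0)"
proof
  assume z: "mact A v = (0, 0)"
  have "scale (mdet A) v = mact (madj A) (0, 0)" using mact_madj(2)[of A v] z by simp
  also have "\<dots> = (0, 0)" by (cases A) simp
  finally show False using assms by (simp add: scale_eq_0_iff)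
qed

lemma image_line: "mact A ` line v = line (mact A v)"
  by (simp add: line_def image_image mact_scale)

lemma self_in_line: "v \<in> line v"
  unfolding line_def by (rule range_eqI[of _ _ 1]) (simp add: scale_1)

lemma line_scale: assumes t: "t \<noteq> 0" shows "line (scale t v) = line v"
proof -
  have "scale s v \<in> line (scale t v)" for s
    unfolding line_def using t by (intro range_eqI[of _ _ "s / t"]) (simp add: scale_scale)
  thus ?thesis by (auto simp: line_def scale_scale)
qed

lemma line_eq_iff:
  assumes "v \<noteq> (0, 0)" "w \<noteq> (0, 0)"
  shows "line v = line w \<longleftrightarrow> cross v w = 0"
proof
  assume "line v = line w"
  hence "v \<in> line w" using self_in_line[of v] by simp
  thus "cross v w = 0" by (cases v; cases w) (auto simp: line_def)
next
  assume c: "cross v w = 0"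
  obtain x y x' y' where vw: "v = (x, y)" "w = (x', y')" by (cases v; cases w)
  have "\<exists>t. t \<noteq> 0 \<and> w = scale t v"
  proof (cases "x = 0")
    case True
    thus ?thesis using c assms vw by (intro exI[of _ "y' / y"]) auto
  next
    case False
    hence "x' \<noteq> 0" using c assms vw by auto
    thus ?thesis using False c vw by (intro exI[of _ "x' / x"]) (auto simp: field_simps)
  qed
  thus "line v = line w" using line_scale by blast
qed

lemma line_in_lines: "v \<noteq> (0, 0) \<Longrightarrow> line v \<in> lines"
  by (auto simp: lines_def)

lemma linesE:
  assumes "l \<in> lines" obtains v where "v \<noteq> (0, 0)" "l = line v"
  using assms by (auto simp: lines_def)

lemma line_fixed_iff:
  assumes "mdet A \<noteq> 0" "v \<noteq> (0, 0)"
  shows "mact A ` line v = line v \<longleftrightarrow> cross v (mact A v) = 0"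
  using line_eq_iff[OF assms(2) mact_nonzero[OF assms]] unfolding image_line by auto

lemma line_fixed_eigenvector:
  assumes "mact A ` line v = line v"
  obtains t where "mact A v = scale t v"
proof -
  have "mact A v \<in> line v" using self_in_line assms by blast
  thus ?thesis using that by (auto simp: line_def)
qed

text \<open>
The line through v is fixed if and only if v and A v are linearly dependent, that is, if v is a zero of
a binary quadratic form. Its discriminant is that of A, so over an algebraically closed field it is a
product of two linear forms that are not proportional.
\<close>

lemma fixed_lines_two:
  fixes A :: "'a::{alg_closed_field, field_char_0} mat2"
  assumes det: "mdet A \<noteq> 0" and disc: "mdisc A \<noteq> 0"
  shows "card {l\<in>lines. mact A ` l = l} = 2"
proof -
  obtain a b c d where A: "A = (a, b, c, d)" by (cases A)
  obtain \<delta> where \<delta>: "\<delta>\<^sup>2 = mdisc A"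
    using nth_root_exists[of 2 "mdisc A"] by auto
  hence "\<delta> \<noteq> 0" using disc by auto
  have "\<exists>v1 v2. v1 \<noteq> (0, 0) \<and> v2 \<noteq> (0, 0) \<and> cross v1 v2 \<noteq> 0 \<and>
     (\<forall>v. cross v (mact A v) = 0 \<longleftrightarrow> cross v1 v = 0 \<or> cross v2 v = 0)"
  proof (cases "b = 0")
    case True
    hence "a \<noteq> d" using disc by (auto simp: A)
    have "cross v (mact A v) = 0 \<longleftrightarrow> cross (1, 0) v = 0 \<or> cross (c, d - a) v = 0" for v
    proof -
      obtain x y where v: "v = (x, y)" by (cases v)
      have "cross v (mact A v) = - (y * (c * y - x * (d - a)))"
        by (simp add: A v True algebra_simps)
      thus ?thesis by (simp add: v)
    qed
    thus ?thesis using \<open>a \<noteq> d\<close> by (intro exI[of _ "(1, 0)"] exI[of _ "(c, d - a)"]) simp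
  next
    case False
    define r1 r2 where "r1 = (a - d + \<delta>) / (2 * b)" "r2 = (a - d - \<delta>) / (2 * b)"
    have sum: "b * (r1 + r2) = a - d" using False by (simp add: r1_r2_def field_simps)
    have "4 * b * (b * (r1 * r2)) = (a - d)\<^sup>2 - \<delta>\<^sup>2"
      using False by (simp add: r1_r2_def field_simps power2_eq_square)
    also have "\<dots> = 4 * b * (- c)" using \<delta> by (simp add: A)
    finally have prod: "b * (r1 * r2) = - c" using False mult_left_cancel[of "4 * b" "b * (r1 * r2)" "- c"] by simp
    have "cross v (mact A v) = 0 \<longleftrightarrow> cross (r1, 1) v = 0 \<or> cross (r2, 1) v = 0" for v
    proof -
      obtain x y where v: "v = (x, y)" by (cases v)
      have "cross v (mact A v) = b * x\<^sup>2 - (a - d) * x * y + (- c) * y\<^sup>2"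
        by (simp add: A v algebra_simps power2_eq_square)
      also have "\<dots> = b * (r1 * y - x) * (r2 * y - x)"
        unfolding sum[symmetric] prod[symmetric] by (simp add: algebra_simps power2_eq_square)
      finally show ?thesis using False by (simp add: v)
    qed
    moreover have "r1 \<noteq> r2" using \<open>\<delta> \<noteq> 0\<close> False by (simp add: r1_r2_def)
    ultimately show ?thesis by (intro exI[of _ "(r1, 1)"] exI[of _ "(r2, 1)"]) simp
  qed
  then obtain v1 v2 where v: "v1 \<noteq> (0, 0)" "v2 \<noteq> (0, 0)" "cross v1 v2 \<noteq> 0"
    "\<And>v. cross v (mact A v) = 0 \<longleftrightarrow> cross v1 v = 0 \<or> cross v2 v = 0" by blast
  have "mact A ` l = l \<longleftrightarrow> l = line v1 \<or> l = line v2" if l: "l \<in> lines" for l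
  proof -
    obtain w where w: "w \<noteq> (0, 0)" "l = line w" using l by (rule linesE)
    have "mact A ` l = l \<longleftrightarrow> cross v1 w = 0 \<or> cross v2 w = 0"
      unfolding w(2) line_fixed_iff[OF det w(1)] v(4) ..
    also have "\<dots> \<longleftrightarrow> line v1 = l \<or> line v2 = l"
      unfolding w(2) line_eq_iff[OF v(1) w(1)] line_eq_iff[OF v(2) w(1)] ..
    finally show ?thesis by auto
  qed
  hence "{l\<in>lines. mact A ` l = l} = {l\<in>lines. l = line v1 \<or> l = line v2}"
    by (intro Collect_cong conj_cong refl)
  also have "\<dots> = {line v1, line v2}"
    using line_in_lines[OF v(1)] line_in_lines[OF v(2)] by auto
  finally have "{l\<in>lines. mact A ` l = l} = {line v1, line v2}" .
  moreover have "line v1 \<noteq> line v2" using line_eq_iff[OF v(1,2)] v(3) by simp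
  ultimately show ?thesis by simp
qed

text \<open>
If the discriminant vanishes, A = r + N with a scalar r and N squared equal to zero. Then the m-th
power of A is r^m (1 + (m/r) N), and in characteristic zero it is a scalar matrix for some m > 0 only
if N = 0.
\<close>

lemma parabolic_infinite_order:
  fixes A :: "'a::field_char_0 mat2"
  assumes det: "mdet A \<noteq> 0" and disc: "mdisc A = 0" and n: "n > 0"
    and triv: "\<And>v. cross v ((mact A ^^ n) v) = 0"
  shows "mact A v = scale (fst A) v"
proof -
  obtain a b c d where A: "A = (a, b, c, d)" by (cases A)
  define r p where "r = (a + d) / 2" "p = (a - d) / 2"
  have ad: "a = r + p" "d = r - p" by (simp_all add: r_p_def field_simps)
  have "4 * (p * p + b * c) = mdisc A" unfolding A ad by (simp add: power2_eq_square algebra_simps)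
  hence pp: "p * p + b * c = 0" unfolding disc by (simp only: mult_eq_0_iff) simp
  have "r * r = mdet A + (p * p + b * c)" unfolding A ad by (simp add: algebra_simps)
  hence r: "r \<noteq> 0" using det pp by auto
  have pow: "(mact A ^^ m) (x, y) = (r ^ m * (x + of_nat m / r * (p * x + c * y)),
      r ^ m * (y + of_nat m / r * (b * x - p * y)))" for m x y
  proof (induction m)
    case (Suc m)
    define s where "s = of_nat m / r"
    have s: "of_nat (Suc m) / r = s + 1 / r" by (simp add: s_def add_divide_distrib)
    define X' Y where "X' = p * x + c * y" "Y = b * x - p * y"
    have NN: "p * X' + c * Y = 0" "b * X' - p * Y = 0"
    proof -
      have "p * X' + c * Y = (p * p + b * c) * x" "b * X' - p * Y = (p * p + b * c) * y"
        by (simp_all add: X'_Y_def algebra_simps)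
      thus "p * X' + c * Y = 0" "b * X' - p * Y = 0" using pp by simp_all
    qed
    have "(mact A ^^ Suc m) (x, y) = mact A (r ^ m * (x + s * X'), r ^ m * (y + s * Y))"
      using Suc.IH by (simp add: s_def X'_Y_def)
    also have "\<dots> = (r ^ m * (r * (x + s * X') + X' + s * (p * X' + c * Y)),
        r ^ m * (r * (y + s * Y) + Y + s * (b * X' - p * Y)))"
      unfolding A ad by (simp add: X'_Y_def algebra_simps)
    also have "\<dots> = (r ^ Suc m * (x + (s + 1 / r) * X'), r ^ Suc m * (y + (s + 1 / r) * Y))"
      unfolding NN using r by (simp add: field_simps)
    finally show ?case unfolding s X'_Y_def .
  qed simp
  have "cross (1, 0) ((mact A ^^ n) (1, 0)) = 0" "cross (0, 1) ((mact A ^^ n) (0, 1)) = 0"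
    using triv by blast+
  hence "b = 0" "c = 0" using r n unfolding pow by auto
  hence "p = 0" using pp by simp
  thus ?thesis using \<open>b = 0\<close> \<open>c = 0\<close> by (cases v) (simp add: A ad)
qed

text \<open>
Elements of the group are determined by their action on lines. The matrix of an element is unique
only up to a scalar, so no choice of matrices that respects products is part of the data.
\<close>

locale line_action = group G for G (structure) +
  fixes act :: "'a \<Rightarrow> ('c::{alg_closed_field, field_char_0} \<times> 'c) set \<Rightarrow> ('c \<times> 'c) set"
  assumes finG: "finite (carrier G)" and perf: "perfect G"
    and matrix: "g \<in> carrier G \<Longrightarrow> \<exists>A. mdet A \<noteq> 0 \<and> (\<forall>l\<in>lines. act g l = mact A ` l)"
    and act_1: "l \<in> lines \<Longrightarrow> act \<one> l = l"
    and act_mult: "g \<in> carrier G \<Longrightarrow> h \<in> carrier G \<Longrightarrow> l \<in> lines \<Longrightarrow> act (g \<otimes> h) l = act g (act h l)"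
    and faithful: "g \<in> carrier G \<Longrightarrow> (\<And>l. l \<in> lines \<Longrightarrow> act g l = l) \<Longrightarrow> g = \<one>"
begin

lemma act_lines:
  assumes g: "g \<in> carrier G" and l: "l \<in> lines" shows "act g l \<in> lines"
proof -
  obtain A where A: "mdet A \<noteq> 0" "\<forall>l\<in>lines. act g l = mact A ` l" using matrix[OF g] by blast
  obtain v where v: "v \<noteq> (0, 0)" "l = line v" using l by (rule linesE)
  have "act g l = line (mact A v)" using A(2) l unfolding v(2) by (simp add: image_line)
  thus ?thesis using line_in_lines[OF mact_nonzero[OF A(1) v(1)]] by simp
qed

lemma act_pow:
  assumes g: "g \<in> carrier G" and A: "\<forall>l\<in>lines. act g l = mact A ` l" and "l \<in> lines"
  shows "act (g [^] (n::nat)) l = (mact A ^^ n) ` l"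
  using assms(3)
proof (induction n arbitrary: l)
  case (Suc n)
  have "act (g [^] Suc n) l = act (g [^] n) (act g l)" using Suc.prems g by (simp add: act_mult)
  also have "\<dots> = (mact A ^^ n) ` act g l" using Suc.IH act_lines[OF g Suc.prems] by simp
  also have "act g l = mact A ` l" using A Suc.prems by blast
  finally show ?case by (simp only: image_image funpow_Suc_right comp_apply)
qed (simp add: act_1)

lemma trivial_if_parabolic:
  assumes g: "g \<in> carrier G" and A: "mdet A \<noteq> 0" "\<forall>l\<in>lines. act g l = mact A ` l" and disc: "mdisc A = 0"
  shows "g = \<one>"
proof -
  define n where "n = Coset.order G"
  have n: "n > 0" using finG by (simp add: n_def order_gt_0_iff_finite)
  have gn: "g [^] n = \<one>" using pow_order_eq_1[OF g] by (simp add: n_def)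
  have "cross v ((mact A ^^ n) v) = 0" for v
  proof (cases "v = (0, 0)")
    case False
    note L = line_in_lines[OF False]
    have "(mact A ^^ n) ` line v = line v"
      using act_pow[OF g A(2) L, of n] act_1[OF L] unfolding gn by simp
    hence "(mact A ^^ n) v \<in> line v" using self_in_line by blast
    then obtain t where "(mact A ^^ n) v = scale t v" by (auto simp: line_def)
    thus ?thesis by (cases v) simp
  qed (cases "(mact A ^^ n) v", simp)
  from parabolic_infinite_order[OF A(1) disc n this]
  have sc: "mact A v = scale (fst A) v" for v .
  have "act g l = l" if l: "l \<in> lines" for l
  proof -
    obtain v where v: "v \<noteq> (0, 0)" "l = line v" using l by (rule linesE)
    have "fst A \<noteq> 0" using mact_nonzero[OF A(1) v(1)] unfolding sc by (simp add: scale_eq_0_iff)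
    moreover have "act g l = line (mact A v)" using A(2) l unfolding v(2) by (simp add: image_line)
    ultimately show ?thesis unfolding sc v(2) by (simp add: line_scale)
  qed
  thus ?thesis using faithful[OF g] by blast
qed

lemma two_fixed_lines:
  assumes g: "g \<in> carrier G" "g \<noteq> \<one>"
  shows "card {l\<in>lines. act g l = l} = 2"
proof -
  obtain A where A: "mdet A \<noteq> 0" "\<forall>l\<in>lines. act g l = mact A ` l" using matrix[OF g(1)] by blast
  hence "mdisc A \<noteq> 0" using trivial_if_parabolic g by blast
  moreover have "{l\<in>lines. act g l = l} = {l\<in>lines. mact A ` l = l}" using A(2) by auto
  ultimately show ?thesis using fixed_lines_two[OF A(1)] by simp
qed

text \<open>
Matrices A and B with a common eigenvector v satisfy A B v = B A v. So the matrix C of the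
commutator, defined with the adjugate of B A in place of the inverse, has the eigenvalue
\<Delta> = det(A) det(B) at v. As det(C) is the square of \<Delta>, the other eigenvalue is the same,
and a group element with such a matrix is trivial.
\<close>

lemma common_fixed_line_commute:
  assumes l: "l \<in> lines" and g: "g \<in> carrier G" "act g l = l" and h: "h \<in> carrier G" "act h l = l"
  shows "g \<otimes> h = h \<otimes> g"
proof -
  obtain A where A: "mdet A \<noteq> 0" "\<forall>l\<in>lines. act g l = mact A ` l" using matrix[OF g(1)] by blast
  obtain B where B: "mdet B \<noteq> 0" "\<forall>l\<in>lines. act h l = mact B ` l" using matrix[OF h(1)] by blast
  define k where "k = g \<otimes> h \<otimes> inv (h \<otimes> g)"
  define C where "C = mmul (mmul A B) (madj (mmul B A))"
  define \<Delta> where "\<Delta> = mdet A * mdet B"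
  have k: "k \<in> carrier G" using g h by (simp add: k_def)
  have detC: "mdet C = \<Delta>\<^sup>2"
    by (simp add: C_def mdet_mmul mdet_madj \<Delta>_def power2_eq_square mult_ac)
  have \<Delta>: "\<Delta> \<noteq> 0" using A B by (simp add: \<Delta>_def)
  have C: "act k m = mact C ` m" if m: "m \<in> lines" for m
  proof -
    obtain v where v: "v \<noteq> (0, 0)" "m = line v" using m by (rule linesE)
    define w where "w = mact (madj (mmul B A)) v"
    have w: "w \<noteq> (0, 0)" unfolding w_def using A B v by (intro mact_nonzero) (simp_all add: mdet_mmul mdet_madj)
    note L = line_in_lines[OF w]
    have gl: "act g (line w) = line (mact A w)" "act h (line w) = line (mact B w)"
      using A(2) B(2) L by (simp_all add: image_line)
    have L2: "line (mact A w) \<in> lines" "line (mact B w) \<in> lines"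
      using line_in_lines mact_nonzero A(1) B(1) w by blast+
    have "act (h \<otimes> g) (line w) = line (mact (mmul B A) w)"
      using act_mult[OF h(1) g(1) L] B(2) L2(1) unfolding gl by (simp add: image_line mact_mmul)
    also have "\<dots> = line (scale (mdet (mmul B A)) v)" by (simp only: w_def mact_madj)
    also have "\<dots> = m" using A B v by (simp add: line_scale mdet_mmul)
    finally have 1: "act (h \<otimes> g) (line w) = m" .
    have "act k m = act (k \<otimes> (h \<otimes> g)) (line w)"
      using act_mult[OF k m_closed[OF h(1) g(1)] L] unfolding 1 by simp
    also have "k \<otimes> (h \<otimes> g) = g \<otimes> h" using g h by (simp add: k_def m_assoc del: inv_mult_group)
    also have "act (g \<otimes> h) (line w) = line (mact (mmul A B) w)"
      using act_mult[OF g(1) h(1) L] A(2) L2(2) unfolding gl by (simp add: image_line mact_mmul)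
    also have "\<dots> = mact C ` m" unfolding v(2) image_line by (simp add: C_def w_def mact_mmul)
    finally show ?thesis .
  qed
  obtain v where v: "v \<noteq> (0, 0)" "l = line v" using l by (rule linesE)
  have "mact A ` line v = line v" "mact B ` line v = line v"
    using A(2) B(2) l g(2) h(2) unfolding v(2) by auto
  then obtain s t where s: "mact A v = scale s v" and t: "mact B v = scale t v"
    using line_fixed_eigenvector by metis
  have st: "s * t \<noteq> 0"
    using mact_nonzero[OF A(1) v(1)] mact_nonzero[OF B(1) v(1)] unfolding s t by (auto simp: scale_eq_0_iff)
  have AB: "mact (mmul A B) v = scale (s * t) v" "mact (mmul B A) v = scale (s * t) v"
    by (simp_all add: mact_mmul s t mact_scale scale_scale mult.commute)
  have "scale (s * t) (mact C v) = mact (mmul A B) (mact (madj (mmul B A)) (mact (mmul B A) v))"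
    unfolding AB(2) by (simp only: C_def mact_mmul[of "mmul A B"] mact_scale)
  also have "\<dots> = scale (s * t) (scale \<Delta> v)"
    by (simp only: mact_madj mact_scale AB(1) mdet_mmul \<Delta>_def scale_scale mult_ac)
  finally have Cv: "mact C v = scale \<Delta> v"
    using scale_left_inj[OF st] by blast
  have "mdisc C = 0"
  proof -
    obtain a b c d where abcd: "C = (a, b, c, d)" by (cases C)
    obtain x y where xy: "v = (x, y)" by (cases v)
    have e: "(a - \<Delta>) * x + c * y = 0" "b * x + (d - \<Delta>) * y = 0"
      using Cv by (simp_all add: abcd xy algebra_simps)
    have "((a - \<Delta>) * (d - \<Delta>) - b * c) * x = (d - \<Delta>) * ((a - \<Delta>) * x + c * y) - c * (b * x + (d - \<Delta>) * y)"
      "((a - \<Delta>) * (d - \<Delta>) - b * c) * y = (a - \<Delta>) * (b * x + (d - \<Delta>) * y) - b * ((a - \<Delta>) * x + c * y)"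
      by (simp_all add: algebra_simps)
    hence 0: "(a - \<Delta>) * (d - \<Delta>) - b * c = 0" using v(1) unfolding e by (auto simp: xy)
    have 1: "a * d - b * c = \<Delta> * \<Delta>" using detC by (simp add: abcd power2_eq_square)
    have "\<Delta> * (2 * \<Delta> - (a + d)) = ((a - \<Delta>) * (d - \<Delta>) - b * c) - ((a * d - b * c) - \<Delta> * \<Delta>)"
      by (simp add: algebra_simps)
    hence "\<Delta> * (2 * \<Delta> - (a + d)) = 0" unfolding 0 1 by simp
    hence 2: "a + d = 2 * \<Delta>" using \<Delta> by simp
    have "mdisc C = (a + d) * (a + d) - 4 * (a * d - b * c)"
      by (simp add: abcd power2_eq_square algebra_simps)
    thus ?thesis unfolding 1 2 by simp
  qed
  hence "k = \<one>" using trivial_if_parabolic[OF k, of C] C detC \<Delta> by simp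
  hence "g \<otimes> h \<otimes> inv (h \<otimes> g) \<otimes> (h \<otimes> g) = h \<otimes> g" using g h by (simp add: k_def)
  thus ?thesis using g h by (simp add: m_assoc del: inv_mult_group)
qed

theorem trivial_or_alt_group_5: "carrier G = {\<one>} \<or> G \<cong> alt_group 5"
proof -
  define P where "P = {l\<in>lines. \<exists>g\<in>carrier G - {\<one>}. act g l = l}"
  define \<phi> where "\<phi> g = restrict (act g) P" for g
  have closed: "act g l \<in> P" if g: "g \<in> carrier G" and l: "l \<in> P" for g l
  proof -
    obtain h where h: "h \<in> carrier G" "h \<noteq> \<one>" "act h l = l" "l \<in> lines" using l by (auto simp: P_def)
    let ?c = "g \<otimes> h \<otimes> inv g"
    have c: "?c \<in> carrier G" using g h by simp
    have cg: "?c \<otimes> g = g \<otimes> h" using g h by (simp add: m_assoc)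
    have "act ?c (act g l) = act (?c \<otimes> g) l" using act_mult[OF c g h(4)] by simp
    also have "\<dots> = act g l" unfolding cg using act_mult[OF g h(1,4)] h(3) by simp
    finally have "act ?c (act g l) = act g l" .
    moreover have "?c \<noteq> \<one>"
    proof
      assume "?c = \<one>"
      hence "g \<otimes> h = g" using cg g by simp
      thus False using g h by simp
    qed
    ultimately show ?thesis using c act_lines[OF g h(4)] by (auto simp: P_def)
  qed
  have Pl: "P \<subseteq> lines" by (auto simp: P_def)
  have "group_action G P \<phi>"
    unfolding \<phi>_def
    by (rule restrict_group_action[OF group_axioms closed]) (use Pl act_1 act_mult in auto)
  then interpret group_action G P \<phi> .
  have finP: "finite P"
  proof -
    have "P = (\<Union>g\<in>carrier G - {\<one>}. {l\<in>lines. act g l = l})" by (auto simp: P_def)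
    moreover have "finite {l\<in>lines. act g l = l}" if "g \<in> carrier G - {\<one>}" for g
      using two_fixed_lines[of g] that by (intro card_ge_0_finite) simp
    ultimately show ?thesis using finG by simp
  qed
  have "pole_action G P \<phi>"
  proof unfold_locales
    show "card {x\<in>P. \<phi> g x = x} = 2" if g: "g \<in> carrier G" "g \<noteq> \<one>" for g
    proof -
      have "{x\<in>P. \<phi> g x = x} = {l\<in>lines. act g l = l}" using g by (auto simp: P_def \<phi>_def)
      thus ?thesis using two_fixed_lines[OF g] by simp
    qed
    show "g \<otimes> h = h \<otimes> g" if "x \<in> P" "g \<in> stabilizer G \<phi> x" "h \<in> stabilizer G \<phi> x" for x g h
      using that Pl by (intro common_fixed_line_commute[of x]) (auto simp: stabilizer_def \<phi>_def)
    show "stabilizer G \<phi> x \<noteq> {\<one>}" if "x \<in> P" for x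
      using that by (auto simp: stabilizer_def \<phi>_def P_def)
  qed (use finG finP perf in auto)
  thus ?thesis by (rule pole_action.trivial_or_alt_group_5)
qed

end

section \<open>Relative algebraic closure\<close>

text \<open>
The coefficients of an equation of x over L generate a finite extension of K, and x generates a finite
extension of that.
\<close>

lemma (in Ring.field) algebraic_trans:
  assumes K: "subfield K R" and L: "subfield L R" and x: "x \<in> carrier R"
    and alg: "\<And>y. y \<in> L \<Longrightarrow> (algebraic over K) y" and "(algebraic over L) x"
  shows "(algebraic over K) x"
proof -
  obtain p where p: "p \<in> carrier (L[X])" "p \<noteq> []" "eval p x = \<zero>"
    using algebraicE[OF subfieldE(1)[OF L] x assms(5)] by blast
  hence pL: "set p \<subseteq> L" "Polynomials.lead_coeff p \<noteq> \<zero>" by (auto simp: univ_poly_def polynomial_def)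
  hence pR: "set p \<subseteq> carrier R" using subfieldE(3)[OF L] by blast
  have palg: "\<And>y. y \<in> set p \<Longrightarrow> (algebraic over K) y" using pL alg by blast
  define F where "F = finite_extension K p"
  have F: "subfield F R" "finite_dimension K F"
    unfolding F_def
    using finite_extension_is_subfield[OF K pR palg] finite_extension_finite_dimension(1)[OF K pR palg] by blast+
  have "set p \<subseteq> F" unfolding F_def by (rule finite_extension_mem[OF subfieldE(1)[OF K] pR])
  hence "p \<in> carrier (F[X])" using p pL by (auto simp: univ_poly_def polynomial_def)
  hence xF: "(algebraic over F) x" using algebraicI p(2,3) by blast
  define E where "E = simple_extension F x"
  have "finite_dimension F E"
    unfolding E_def using finite_dimension_simple_extension[OF F(1) x] xF by blast
  hence "finite_dimension K E" using telescopic_base_dim(1)[OF K F] by blast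
  moreover have "subring E R" "x \<in> E"
    unfolding E_def using simple_extension_is_subring simple_extension_mem subfieldE(1)[OF F(1)] x by blast+
  ultimately show ?thesis using finite_dimension_imp_algebraic[OF K] by blast
qed

text \<open>
Translation between the operations of a field type and those of the record that represents it.
\<close>

lemma rta_simps [simp]:
  "carrier (ring_of_type_algebra :: 'f::field ring) = UNIV"
  "x \<oplus>\<^bsub>ring_of_type_algebra\<^esub> y = (x + y :: 'f)"
  "x \<otimes>\<^bsub>ring_of_type_algebra\<^esub> y = x * y"
  "\<zero>\<^bsub>ring_of_type_algebra\<^esub> = (0 :: 'f)" "\<one>\<^bsub>ring_of_type_algebra\<^esub> = (1 :: 'f)"
  by (simp_all add: ring_of_type_algebra_def)

lemma rta_minus: "\<ominus>\<^bsub>ring_of_type_algebra\<^esub> x = (- x :: 'f::field)"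
proof -
  interpret R: Ring.field "ring_of_type_algebra :: 'f ring" by (rule field_from_type_algebra)
  show ?thesis by (rule R.minus_equality) auto
qed

lemma rta_inv: "x \<noteq> 0 \<Longrightarrow> inv\<^bsub>ring_of_type_algebra\<^esub> x = (inverse x :: 'f::field)"
proof -
  interpret R: Ring.field "ring_of_type_algebra :: 'f ring" by (rule field_from_type_algebra)
  assume "x \<noteq> 0" thus ?thesis by (intro R.comm_inv_char) auto
qed

lemma rta_pow: "x [^]\<^bsub>ring_of_type_algebra\<^esub> (n::nat) = (x ^ n :: 'f::field)"
proof -
  interpret R: Ring.field "ring_of_type_algebra :: 'f ring" by (rule field_from_type_algebra)
  show ?thesis by (induction n) (simp_all add: mult.commute)
qed

lemma rta_eval: "ring.eval ring_of_type_algebra p x = poly (Poly (rev p)) (x :: 'f::field)"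
proof -
  interpret R: Ring.field "ring_of_type_algebra :: 'f ring" by (rule field_from_type_algebra)
  show ?thesis by (induction p) (simp_all add: Poly_append poly_monom rta_pow add.commute mult.commute)
qed

context field_embedding
begin

lemma subfield_iff:
  "is_subfield S \<longleftrightarrow> subfield S ring_of_type_algebra \<and> range c \<subseteq> S"
proof -
  interpret R: Ring.field "ring_of_type_algebra :: 'f ring" by (rule field_from_type_algebra)
  show ?thesis
  proof (intro iffI conjI)
    assume S: "is_subfield S"
    show "range c \<subseteq> S" using S by (simp add: is_subfield_def)
    show "subfield S ring_of_type_algebra"
    proof (rule R.subfieldI'[OF R.subringI])
      show "inv\<^bsub>ring_of_type_algebra\<^esub> k \<in> S" if "k \<in> S - {\<zero>\<^bsub>ring_of_type_algebra\<^esub>}" for k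
        using that is_subfieldD(9)[OF S] by (simp add: rta_inv)
    qed (simp_all add: rta_minus is_subfieldD[OF S])
  next
    assume S: "subfield S ring_of_type_algebra \<and> range c \<subseteq> S"
    hence sr: "subring S ring_of_type_algebra" using subfieldE(1) by blast
    have "inverse x \<in> S" if "x \<in> S" for x
      using R.subfield_m_inv(1)[of S x] S that by (cases "x = 0") (auto simp: rta_inv)
    moreover have "- x \<in> S" if "x \<in> S" for x using subringE(5)[OF sr that] by (simp add: rta_minus)
    moreover have "x + y \<in> S" "x * y \<in> S" if "x \<in> S" "y \<in> S" for x y
      using subringE(6,7)[OF sr that] by simp_all
    ultimately show "is_subfield S" using S by (simp add: is_subfield_def)
  qed
qed

lemma generate_field_eq_fracs:
  "generate_field ring_of_type_algebra (insert x (range c)) = fracs x"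
proof -
  interpret R: Ring.field "ring_of_type_algebra :: 'f ring" by (rule field_from_type_algebra)
  let ?F = "generate_field ring_of_type_algebra (insert x (range c))"
  have sub: "insert x (range c) \<subseteq> ?F" by (intro subsetI generate_field.incl)
  have "is_subfield ?F" unfolding subfield_iff using R.generate_field_is_subfield[of "insert x (range c)"] sub by auto
  hence "fracs x \<subseteq> ?F" using fracs_least sub by blast
  moreover have "?F \<subseteq> fracs x"
  proof (rule R.generate_field_min_subfield1)
    show "subfield (fracs x) ring_of_type_algebra" "insert x (range c) \<subseteq> fracs x"
      using is_subfield_fracs[of x] self_in_fracs[of x] unfolding subfield_iff by blast+
  qed simp
  ultimately show ?thesis by blast
qed

definition algebraic_over :: "'f set \<Rightarrow> 'f \<Rightarrow> bool" where
  "algebraic_over S x \<longleftrightarrow> (\<exists>f. poly_over S f \<and> f \<noteq> 0 \<and> poly f x = 0)"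

lemma algebraic_iff:
  assumes S: "is_subfield S"
  shows "(ring.algebraic ring_of_type_algebra over S) x \<longleftrightarrow> algebraic_over S x"
proof -
  interpret R: Ring.field "ring_of_type_algebra :: 'f ring" by (rule field_from_type_algebra)
  have sf: "subfield S ring_of_type_algebra" using S subfield_iff by blast
  show ?thesis
  proof
    assume alg: "(ring.algebraic ring_of_type_algebra over S) x"
    have xc: "x \<in> carrier ring_of_type_algebra" by simp
    obtain p where p: "p \<in> carrier (univ_poly ring_of_type_algebra S)" "p \<noteq> []" "ring.eval ring_of_type_algebra p x = \<zero>\<^bsub>ring_of_type_algebra\<^esub>"
      by (rule R.algebraicE[OF subfieldE(1)[OF sf] xc alg])
    hence pS: "set p \<subseteq> S" "hd p \<noteq> 0" by (auto simp: univ_poly_def polynomial_def)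
    let ?f = "Poly (rev p)"
    have "?f \<noteq> 0"
    proof
      assume "?f = 0"
      then obtain n where n: "rev p = replicate n 0" by (auto simp: Poly_eq_0)
      hence "set (rev p) \<subseteq> {0}" by (simp add: set_replicate_conv_if)
      moreover have "hd p \<in> set (rev p)" using p(2) by simp
      ultimately have "hd p = 0" by blast
      thus False using pS by simp
    qed
    moreover have "poly_over S ?f"
      unfolding poly_over_def
    proof
      fix i
      show "coeff ?f i \<in> S"
      proof (cases "i < length p")
        case True
        hence "coeff ?f i \<in> set (rev p)" using nth_mem[of i "rev p"] by (simp add: nth_default_def)
        thus ?thesis using pS(1) by auto
      next
        case False
        thus ?thesis using is_subfieldD(2)[OF S] by (simp add: nth_default_def)
      qed
    qed
    moreover have "poly ?f x = 0" using p(3) by (simp add: rta_eval)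
    ultimately show "algebraic_over S x" by (auto simp: algebraic_over_def)
  next
    assume "algebraic_over S x"
    then obtain f where f: "poly_over S f" "f \<noteq> 0" "poly f x = 0" by (auto simp: algebraic_over_def)
    let ?p = "rev (coeffs f)"
    have "set (coeffs f) \<subseteq> S" using f(1) by (auto simp: coeffs_def poly_over_def)
    moreover have "hd ?p \<noteq> 0" using f(2) by (simp add: hd_rev last_coeffs_eq_coeff_degree)
    ultimately have "?p \<in> carrier (univ_poly ring_of_type_algebra S)"
      by (simp add: univ_poly_def polynomial_def)
    moreover have "?p \<noteq> []" using f(2) by simp
    moreover have "ring.eval ring_of_type_algebra ?p x = \<zero>\<^bsub>ring_of_type_algebra\<^esub>"
      using f(3) by (simp add: rta_eval)
    ultimately show "(ring.algebraic ring_of_type_algebra over S) x" by (rule R.algebraicI)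
  qed
qed

definition relative_closure :: "'f \<Rightarrow> 'f set" where
  "relative_closure \<phi> = {x. algebraic_over (fracs \<phi>) x}"

lemma fracs_subset_closure: "fracs \<phi> \<subseteq> relative_closure \<phi>"
proof
  fix x assume x: "x \<in> fracs \<phi>"
  note S = is_subfield_fracs[of \<phi>]
  have "- x \<in> fracs \<phi>" "1 \<in> fracs \<phi>" "0 \<in> fracs \<phi>"
    using is_subfieldD(2,3)[OF S] is_subfieldD(8)[OF S x] by blast+
  hence "poly_over (fracs \<phi>) [:- x, 1:]"
    by (simp add: poly_over_def coeff_pCons split: nat.splits)
  thus "x \<in> relative_closure \<phi>" unfolding relative_closure_def algebraic_over_def
    by (intro CollectI exI[of _ "[:- x, 1:]"]) simp
qed

lemma is_subfield_closure: "is_subfield (relative_closure \<phi>)"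
proof -
  interpret R: Ring.field "ring_of_type_algebra :: 'f ring" by (rule field_from_type_algebra)
  note S = is_subfield_fracs[of \<phi>]
  have "subfield {x \<in> carrier ring_of_type_algebra. (ring.algebraic ring_of_type_algebra over fracs \<phi>) x} ring_of_type_algebra"
    using R.subfield_of_algebraics S subfield_iff by blast
  also have "{x \<in> carrier ring_of_type_algebra. (ring.algebraic ring_of_type_algebra over fracs \<phi>) x} = relative_closure \<phi>"
    by (simp add: relative_closure_def algebraic_iff[OF S])
  finally show ?thesis
    unfolding subfield_iff using fracs_subset_closure[of \<phi>] is_subfieldD(1)[OF S] by blast
qed

lemma closure_closed:
  assumes "(ring.algebraic ring_of_type_algebra over relative_closure \<phi>) x"
  shows "x \<in> relative_closure \<phi>"
proof -
  interpret R: Ring.field "ring_of_type_algebra :: 'f ring" by (rule field_from_type_algebra)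
  note S = is_subfield_fracs[of \<phi>]
  have "(ring.algebraic ring_of_type_algebra over fracs \<phi>) x"
  proof (rule R.algebraic_trans[OF _ _ _ _ assms])
    show "(ring.algebraic ring_of_type_algebra over fracs \<phi>) y" if "y \<in> relative_closure \<phi>" for y
      using that by (simp add: relative_closure_def algebraic_iff[OF S])
  qed (use S is_subfield_closure subfield_iff in \<open>blast, blast, simp\<close>)
  thus ?thesis by (simp add: relative_closure_def algebraic_iff[OF S])
qed

text \<open>
Applying \<sigma> to an equation of x over k(\<phi>) does not change its coefficients.
\<close>

lemma closure_invariant:
  assumes add: "\<And>x y. \<sigma> (x + y) = \<sigma> x + \<sigma> y" and mult: "\<And>x y. \<sigma> (x * y) = \<sigma> x * \<sigma> y"
    and fixc: "\<And>a. \<sigma> (c a) = c a" and \<phi>: "\<sigma> \<phi> = \<phi>" and x: "x \<in> relative_closure \<phi>"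
  shows "\<sigma> x \<in> relative_closure \<phi>"
proof -
  have one: "\<sigma> 1 = 1" using fixc[of 1] by simp
  interpret \<sigma>: field_embedding \<sigma>
    by (rule field_embedding.intro[OF add mult one])
  have ev: "\<sigma> (ev p y) = ev p (\<sigma> y)" for p y
    by (induction p) (simp_all add: ev_pCons add mult fixc)
  have fixf: "\<sigma> y = y" if "y \<in> fracs \<phi>" for y
    using that by (auto simp: fracs_def \<sigma>.c_divide ev \<phi>)
  obtain f where f: "poly_over (fracs \<phi>) f" "f \<noteq> 0" "poly f x = 0"
    using x by (auto simp: relative_closure_def algebraic_over_def)
  have "\<sigma> (poly f x) = poly f (\<sigma> x)"
    using f(1) unfolding poly_altdef \<sigma>.c_sum
    by (intro sum.cong refl) (auto simp: mult fixf poly_over_def \<sigma>.c_power)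
  thus ?thesis using f by (auto simp: relative_closure_def algebraic_over_def)
qed

end

section \<open>Generators of the same simple extension\<close>

context field_embedding
begin

lemma ev_altdef_le: "degree p \<le> n \<Longrightarrow> ev p x = (\<Sum>i\<le>n. c (coeff p i) * x ^ i)"
  unfolding ev_altdef by (rule sum.mono_neutral_left) (auto simp: coeff_eq_0)

lemma ev_at_constant: "ev p (c t) = c (poly p t)"
  by (induction p) (simp_all add: ev_pCons c_add c_mult)

lemma transcendental_not_in_fracs_constant: "transcendental x \<Longrightarrow> x \<notin> fracs (c t)"
proof
  assume x: "transcendental x" and "x \<in> fracs (c t)"
  then obtain s where "x = c s" by (auto simp: fracs_def ev_at_constant simp flip: c_divide)
  hence "ev [:- s, 1:] x = 0" by (simp add: ev_pCons c_minus)
  thus False using transcendentalD[OF x] by simp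
qed

text \<open>
Write y = u/v with coprime polynomials u and v in x, and x = R(y)/Q(y). Then the sum of the
W_j y^j vanishes, where W_j = Q_j x - R_j has degree at most one in x. Let m and n be the least and
the largest j with W_j \<noteq> 0. Multiplication by v^n and division by u^m yield a polynomial
identity, in which v divides all terms but the last, so v divides W_n, and u divides all terms but
the first, so u divides W_m. Hence u and v are linear.
\<close>

lemma same_fracs_moebius:
  assumes x: "transcendental x" and y: "y \<in> fracs x" and xy: "x \<in> fracs y"
  shows "\<exists>a b d e. a * e - b * d \<noteq> 0 \<and> c d * x + c e \<noteq> 0 \<and> y * (c d * x + c e) = c a * x + c b"
proof -
  obtain U V where UV: "ev V x \<noteq> 0" "y = ev U x / ev V x" using y by (auto simp: fracs_def)
  have "V \<noteq> 0" using UV(1) by auto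
  then obtain g r s u v where uv: "U = u * g" "V = v * g" "r * u + s * v = 1"
    using poly_bezout[of U V] by metis
  have vx: "ev v x \<noteq> 0" and yv: "ev u x = y * ev v x"
    using UV by (auto simp: uv ev_mult)
  obtain R Q where RQ: "ev Q y \<noteq> 0" "x = ev R y / ev Q y" using xy by (auto simp: fracs_def)
  have y_const: "y \<noteq> c t" for t using transcendental_not_in_fracs_constant[OF x] xy by metis
  have y0: "y \<noteq> 0" using y_const[of 0] by simp
  define W where "W j = [:- coeff R j, coeff Q j:]" for j
  define J where "J = max (degree R) (degree Q)"
  define A where "A = {j. j \<le> J \<and> W j \<noteq> 0}"
  have evW: "ev (W j) x = x * c (coeff Q j) - c (coeff R j)" for j
    by (simp add: W_def ev_pCons c_minus)
  have "(\<Sum>j\<le>J. ev (W j) x * y ^ j) = x * (\<Sum>j\<le>J. c (coeff Q j) * y ^ j) - (\<Sum>j\<le>J. c (coeff R j) * y ^ j)"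
    by (simp add: evW sum_subtractf sum_distrib_left algebra_simps)
  also have "\<dots> = x * ev Q y - ev R y" by (simp add: ev_altdef_le[of _ J] J_def)
  also have "\<dots> = 0" using RQ by simp
  finally have sumJ: "(\<Sum>j\<le>J. ev (W j) x * y ^ j) = 0" .
  have "Q \<noteq> 0" using RQ(1) by auto
  hence "degree Q \<in> A" by (simp add: A_def W_def J_def)
  hence A: "finite A" "A \<noteq> {}" by (auto simp: A_def)
  define m n where "m = Min A" "n = Max A"
  have mn: "m \<in> A" "n \<in> A" "m \<le> n" using A by (auto simp: m_n_def intro: Min_in Max_in Min_le)
  have sub: "A \<subseteq> {m..n}" using A by (auto simp: m_n_def)
  define F where "F = (\<Sum>j\<in>{m..n}. W j * u ^ (j - m) * v ^ (n - j))"
  have W0: "W j = 0" if "j \<le> J" "j \<notin> {m..n}" for j using that sub by (auto simp: A_def)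
  have nJ: "n \<le> J" using mn by (simp add: A_def)
  have "ev F x * y ^ m = (\<Sum>j\<in>{m..n}. ev (W j) x * y ^ j * ev v x ^ (n - m))"
    unfolding F_def ev_sum sum_distrib_right
  proof (intro sum.cong refl)
    fix j assume j: "j \<in> {m..n}"
    have "y ^ j = y ^ (j - m) * y ^ m" "ev v x ^ (n - m) = ev v x ^ (j - m) * ev v x ^ (n - j)"
      using j by (simp_all flip: power_add)
    thus "ev (W j * u ^ (j - m) * v ^ (n - j)) x * y ^ m = ev (W j) x * y ^ j * ev v x ^ (n - m)"
      by (simp add: ev_mult ev_power yv power_mult_distrib mult_ac)
  qed
  also have "\<dots> = (\<Sum>j\<in>{m..n}. ev (W j) x * y ^ j) * ev v x ^ (n - m)"
    by (simp add: sum_distrib_right)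
  also have "(\<Sum>j\<in>{m..n}. ev (W j) x * y ^ j) = (\<Sum>j\<le>J. ev (W j) x * y ^ j)"
    using nJ W0 by (intro sum.mono_neutral_left) auto
  finally have "ev F x = 0" using sumJ y0 by simp
  hence F0: "F = 0" using transcendentalD[OF x] by blast
  have dvS: "v dvd (\<Sum>j\<in>{m..<n}. W j * u ^ (j - m) * v ^ (n - j))"
    by (intro dvd_sum dvd_mult) (simp add: dvd_power)
  have "F = (\<Sum>j\<in>{m..<n}. W j * u ^ (j - m) * v ^ (n - j)) + W n * u ^ (n - m)"
  proof -
    have "{m..n} = insert n {m..<n}" using mn(3) by auto
    thus ?thesis by (simp add: F_def)
  qed
  hence "v dvd (\<Sum>j\<in>{m..<n}. W j * u ^ (j - m) * v ^ (n - j)) + W n * u ^ (n - m)"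
    unfolding F0 by (simp only: dvd_0_right)
  hence "v dvd W n * u ^ (n - m)" unfolding dvd_add_right_iff[OF dvS] .
  hence "v dvd u ^ (n - m) * W n" by (simp only: mult.commute)
  moreover have "s * v + r * u = 1" using uv(3) by (simp only: add.commute)
  ultimately have "v dvd W n" using bezout_cancel by blast
  moreover have "W n \<noteq> 0" using mn by (simp add: A_def)
  ultimately have "degree v \<le> degree (W n)" by (rule dvd_imp_degree_le)
  hence dv: "degree v \<le> 1" unfolding W_def using degree_pCons_le[of "- coeff R n" "[:coeff Q n:]"] by simp
  have duS: "u dvd (\<Sum>j\<in>{m<..n}. W j * u ^ (j - m) * v ^ (n - j))"
    by (intro dvd_sum dvd_mult2 dvd_mult) (simp add: dvd_power)
  have "F = (\<Sum>j\<in>{m<..n}. W j * u ^ (j - m) * v ^ (n - j)) + W m * v ^ (n - m)"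
  proof -
    have "{m..n} = insert m {m<..n}" using mn(3) by auto
    thus ?thesis by (simp add: F_def)
  qed
  hence "u dvd (\<Sum>j\<in>{m<..n}. W j * u ^ (j - m) * v ^ (n - j)) + W m * v ^ (n - m)"
    unfolding F0 by (simp only: dvd_0_right)
  hence "u dvd W m * v ^ (n - m)" unfolding dvd_add_right_iff[OF duS] .
  hence "u dvd v ^ (n - m) * W m" by (simp only: mult.commute)
  hence "u dvd W m" using bezout_cancel[OF uv(3)] by blast
  moreover have "W m \<noteq> 0" using mn by (simp add: A_def)
  ultimately have "degree u \<le> degree (W m)" by (rule dvd_imp_degree_le)
  hence du: "degree u \<le> 1" unfolding W_def using degree_pCons_le[of "- coeff R m" "[:coeff Q m:]"] by simp
  have lin: "f = [:coeff f 0, coeff f 1:]" if "degree f \<le> 1" for f :: "'k poly"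
    using that by (intro poly_eqI) (auto simp: coeff_pCons coeff_eq_0 split: nat.splits)
  obtain a b d e where abde: "u = [:b, a:]" "v = [:e, d:]" using lin[OF du] lin[OF dv] by blast
  have den: "c d * x + c e \<noteq> 0" using vx by (simp add: abde ev_pCons algebra_simps)
  have eq: "y * (c d * x + c e) = c a * x + c b" using yv by (simp add: abde ev_pCons algebra_simps)
  have "a * e - b * d \<noteq> 0"
  proof
    assume "a * e - b * d = 0"
    hence ae: "c b * c d = c a * c e" by (simp flip: c_mult)
    show False
    proof (cases "d = 0")
      case True
      hence "e \<noteq> 0" using den by auto
      hence "a = 0" using ae True by simp
      hence "y = c (b / e)" using eq True \<open>e \<noteq> 0\<close> by (simp add: c_divide field_simps)
      thus False using y_const by blast
    next
      case False
      have "(y * c d) * (c d * x + c e) = c d * (c a * x + c b)" unfolding eq[symmetric] by (simp only: mult_ac)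
      also have "\<dots> = c a * (c d * x + c e)" using ae by (simp add: algebra_simps)
      finally have "y * c d = c a" using den by simp
      hence "y = c (a / d)" using False by (simp add: c_divide field_simps)
      thus False using y_const by blast
    qed
  qed
  thus ?thesis using den eq by blast
qed

text \<open>
An automorphism that maps x to (a x + b)/(d x + e) is described by its effect on the linear forms
r x + s: it multiplies the vector (r, s) by a matrix, up to the common factor 1/(d x + e). In this
description composition of automorphisms is multiplication of matrices.
\<close>

definition form :: "'f \<Rightarrow> 'k \<times> 'k \<Rightarrow> 'f" where
  "form x v = c (fst v) * x + c (snd v)"

definition represents :: "'f \<Rightarrow> 'k mat2 \<Rightarrow> ('f \<Rightarrow> 'f) \<Rightarrow> bool" where
  "represents x A \<sigma> \<longleftrightarrow> mdet A \<noteq> 0 \<and> (\<exists>u. u \<noteq> 0 \<and> (\<forall>v. u * \<sigma> (form x v) = form x (mact A v)))"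

lemma form_scale: "form x (scale t v) = c t * form x v"
  by (cases v) (simp add: form_def c_mult algebra_simps)

lemma represents_id: "represents x (1, 0, 0, 1) id"
proof -
  have "mact (1, 0, 0, 1) v = v" for v :: "'k \<times> 'k" by (cases v) simp
  thus ?thesis by (auto simp: represents_def intro: exI[of _ 1])
qed

lemma represents_comp:
  assumes \<sigma>: "represents x A \<sigma>" "\<And>p q. \<sigma> (p * q) = \<sigma> p * \<sigma> q" "\<And>p. \<sigma> p = 0 \<longleftrightarrow> p = 0" and \<tau>: "represents x B \<tau>"
  shows "represents x (mmul A B) (\<sigma> \<circ> \<tau>)"
proof -
  obtain u where u: "u \<noteq> 0" "\<And>v. u * \<sigma> (form x v) = form x (mact A v)" using \<sigma>(1) by (auto simp: represents_def)
  obtain w where w: "w \<noteq> 0" "\<And>v. w * \<tau> (form x v) = form x (mact B v)" using \<tau> by (auto simp: represents_def)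
  have "(u * \<sigma> w) * (\<sigma> \<circ> \<tau>) (form x v) = form x (mact (mmul A B) v)" for v
    using u(2)[of "mact B v"] w(2)[of v, symmetric] by (simp add: \<sigma>(2) mact_mmul mult.assoc)
  moreover have "u * \<sigma> w \<noteq> 0" using u(1) w(1) \<sigma>(3) by simp
  moreover have "mdet (mmul A B) \<noteq> 0" using \<sigma>(1) \<tau> by (simp add: represents_def mdet_mmul)
  ultimately show ?thesis unfolding represents_def by blast
qed

text \<open>
If A and B represent the same automorphism, then C = B A^(-1) multiplies all forms by a single
element of the large field. Comparing the forms x and 1 gives a quadratic equation for x over k, which
is trivial because x is transcendental.
\<close>

lemma represents_unique:
  assumes x: "transcendental x" and A: "represents x A \<sigma>" and B: "represents x B \<sigma>"
  obtains t where "t \<noteq> 0" "\<And>v. mact B v = scale t (mact A v)"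
proof -
  obtain u where u: "u \<noteq> 0" "\<And>v. u * \<sigma> (form x v) = form x (mact A v)" using A by (auto simp: represents_def)
  obtain w where w: "w \<noteq> 0" "\<And>v. w * \<sigma> (form x v) = form x (mact B v)" using B by (auto simp: represents_def)
  have dA: "mdet A \<noteq> 0" and dB: "mdet B \<noteq> 0" using A B by (auto simp: represents_def)
  define z where "z = w / u"
  have z: "form x (mact B v) = z * form x (mact A v)" for v
    using u(1) by (simp add: z_def flip: u(2) w(2))
  define C where "C = mmul B (madj A)"
  obtain a b d e where C: "C = (a, b, d, e)" by (cases C)
  have zC: "form x (mact C v) = z * (c (mdet A) * form x v)" for v
    unfolding C_def mact_mmul z by (simp add: mact_madj form_scale)
  have 1: "c d * x + c e = z * c (mdet A)" using zC[of "(0, 1)"] by (simp add: C form_def)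
  have 2: "c a * x + c b = z * c (mdet A) * x" using zC[of "(1, 0)"] by (simp add: C form_def mult.assoc)
  have "ev [:b, a - e, - d:] x = 0"
    using 2 unfolding 1[symmetric] by (simp add: ev_pCons c_diff c_minus algebra_simps)
  hence abd: "b = 0" "a = e" "d = 0" using transcendentalD[OF x] by auto
  have sc: "mact C v = scale a v" for v using abd by (cases v) (simp add: C)
  have "mdet C \<noteq> 0" using dA dB by (simp add: C_def mdet_mmul mdet_madj)
  hence "a \<noteq> 0" using abd by (auto simp: C)
  have "mact B v = scale (a / mdet A) (mact A v)" for v
  proof -
    have "scale (mdet A) (mact B v) = mact B (mact (madj A) (mact A v))" by (simp add: mact_madj mact_scale)
    also have "\<dots> = scale a (mact A v)" using sc[of "mact A v"] by (simp add: C_def mact_mmul)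
    also have "\<dots> = scale (mdet A) (scale (a / mdet A) (mact A v))" using dA by (simp add: scale_scale)
    finally show ?thesis using scale_left_inj[OF dA] by blast
  qed
  thus ?thesis using that[of "a / mdet A"] \<open>a \<noteq> 0\<close> dA by simp
qed

lemma represents_scalar:
  assumes "represents x (a, 0, 0, a) \<sigma>" "\<sigma> 1 = 1"
  shows "\<sigma> x = x"
proof -
  obtain u where u: "u \<noteq> 0" "\<And>v. u * \<sigma> (form x v) = form x (mact (a, 0, 0, a) v)"
    using assms(1) by (auto simp: represents_def)
  have "u = c a" using u(2)[of "(0, 1)"] assms(2) by (simp add: form_def)
  moreover have "u * \<sigma> x = c a * x" using u(2)[of "(1, 0)"] by (simp add: form_def)
  ultimately show ?thesis using u(1) by simp
qed

end

definition mat_ac :: "'k::field mat2 \<Rightarrow> 'k alg_closure mat2" where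
  "mat_ac = (\<lambda>(a, b, c, d). (to_ac a, to_ac b, to_ac c, to_ac d))"

lemma mat_ac_mmul: "mat_ac (mmul A B) = mmul (mat_ac A) (mat_ac B)"
  by (cases A; cases B) (simp add: mat_ac_def)

lemma mdet_mat_ac: "mdet (mat_ac A) = to_ac (mdet A)"
  by (cases A) (simp add: mat_ac_def)

lemma mat_ac_scale:
  assumes "\<And>v. mact B v = scale t (mact A v)"
  shows "mact (mat_ac B) w = scale (to_ac t) (mact (mat_ac A) w)"
proof -
  obtain a b c d a' b' c' d' where AB: "A = (a, b, c, d)" "B = (a', b', c', d')" by (cases A; cases B)
  have "a' = t * a" "b' = t * b" "c' = t * c" "d' = t * d"
    using assms[of "(1, 0)"] assms[of "(0, 1)"] by (simp_all add: AB)
  thus ?thesis by (cases w) (simp add: AB mat_ac_def algebra_simps)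
qed

lemma mat_ac_same_lines:
  assumes "\<And>v. mact B v = scale t (mact A v)" "t \<noteq> 0" "l \<in> lines"
  shows "mact (mat_ac B) ` l = mact (mat_ac A) ` l"
proof -
  obtain v where v: "l = line v" using assms(3) by (rule linesE)
  have "line (mact (mat_ac B) v) = line (mact (mat_ac A) v)"
    unfolding mat_ac_scale[OF assms(1)] using assms(2) by (intro line_scale) simp
  thus ?thesis by (simp only: v image_line)
qed

text \<open>
The lines through (1, 0), (0, 1) and (1, 1) suffice.
\<close>

lemma scalar_if_fixes_lines:
  assumes det: "mdet A \<noteq> 0" and fixes_lines: "\<And>l. l \<in> lines \<Longrightarrow> mact (mat_ac A) ` l = l"
  shows "\<exists>a. A = (a, 0, 0, a)"
proof -
  obtain a b c d where A: "A = (a, b, c, d)" by (cases A)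
  have "mdet (mat_ac A) \<noteq> 0" using det by (simp add: mdet_mat_ac)
  hence cr: "cross v (mact (mat_ac A) v) = 0" if "v \<noteq> (0, 0)" for v
    using line_fixed_iff[of "mat_ac A" v] fixes_lines[OF line_in_lines[OF that]] that by blast
  have "b = 0" "c = 0" using cr[of "(1, 0)"] cr[of "(0, 1)"] by (simp_all add: A mat_ac_def)
  moreover have "d = a" using cr[of "(1, 1)"] calculation by (simp add: A mat_ac_def)
  ultimately show ?thesis by (simp add: A)
qed

section \<open>Saturation of the field of invariants\<close>

lemma perfect_if_no_abelian_quotient:
  assumes "group G"
    and no: "\<And>N. N \<lhd> G \<Longrightarrow> comm_group (G Mod N) \<Longrightarrow> carrier (G Mod N) = {\<one>\<^bsub>G Mod N\<^esub>}"
  shows "perfect G"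
proof -
  interpret group G by fact
  let ?D = "derived G (carrier G)"
  have sub: "subgroup ?D G" by (rule derived_is_subgroup) simp
  have "carrier (G Mod ?D) = {\<one>\<^bsub>G Mod ?D\<^esub>}"
    by (rule no[OF derived_self_is_normal derived_quot_is_comm_group])
  hence "rcosets\<^bsub>G\<^esub> ?D = {?D}" by (simp add: FactGroup_def)
  hence "x \<in> ?D" if "x \<in> carrier G" for x
    using rcos_self[OF that sub] rcosetsI[OF subgroup.subset[OF sub] that] by auto
  thus ?thesis using subgroup.subset[OF sub] by (auto simp: perfect_def)
qed

interpretation rat: field_embedding "const :: 'k::field_char_0 \<Rightarrow> ('v::{finite,linorder}, 'k) ratfun"
proof (rule field_embedding.intro)
  fix a b :: 'k
  show "const (a + b) = (const a + const b :: ('v, 'k) ratfun)" by (simp add: const_def single_add)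
  show "const (a * b) = (const a * const b :: ('v, 'k) ratfun)" by (simp add: const_def mult_single)
  show "const 1 = (1 :: ('v, 'k) ratfun)" by (simp add: const_def One_fract_def)
qed

text \<open>
The theorem of Gordan and Igusa for the field of elements algebraic over k(\<phi>). The place takes a
transcendental value at \<phi>, so it is defined on k(\<phi>) and then on everything algebraic over it.
\<close>

theorem relative_closure_is_simple:
  fixes \<phi> :: "('v::{finite,linorder}, 'k::field_char_0) ratfun"
  assumes "\<phi> \<notin> constants"
  shows "\<exists>\<psi>. rat.transcendental \<psi> \<and> rat.relative_closure \<phi> = rat.fracs \<psi>"
proof -
  obtain Pl y where Pl: "place (const :: 'k \<Rightarrow> ('v, 'k) ratfun) fconst Pl" "Pl \<phi> y" "y \<notin> range fconst"
    using exists_place[of \<phi>] assms unfolding constants_def by blast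
  interpret place "const :: 'k \<Rightarrow> ('v, 'k) ratfun" fconst Pl by fact
  have transcendental: "ft.transcendental y" using nonconstant_imp_transcendental[OF Pl(3)] .
  note S = rat.is_subfield_fracs[of \<phi>]
  have dom: "\<forall>x\<in>rat.fracs \<phi>. \<exists>z. Pl x z" using Pl_fracs[OF Pl(2) transcendental] by blast
  have "\<forall>x\<in>rat.relative_closure \<phi>. \<exists>z. Pl x z"
    using Pl_algebraic[OF S dom] unfolding rat.relative_closure_def rat.algebraic_over_def by blast
  moreover have "\<phi> \<in> rat.relative_closure \<phi>" using rat.fracs_subset_closure rat.self_in_fracs by blast
  ultimately show ?thesis
    using subfield_with_trivial_place_is_simple[OF Pl(1) rat.is_subfield_closure _ _ Pl(2,3)] by blast
qed

lemma ratfun_autD: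
  assumes "\<sigma> \<in> carrier ratfun_aut"
  shows "\<sigma> (x + y) = \<sigma> x + \<sigma> y" "\<sigma> (x * y) = \<sigma> x * \<sigma> y" "\<sigma> (const a) = const a" "\<sigma> x = 0 \<longleftrightarrow> x = 0"
proof -
  have iso: "\<sigma> \<in> ring_hom ratfun_field ratfun_field" and b: "bij \<sigma>" and c: "\<And>a. \<sigma> (const a) = const a"
    using assms by (auto simp: ratfun_aut_def ring_iso_def)
  show "\<sigma> (x + y) = \<sigma> x + \<sigma> y" "\<sigma> (x * y) = \<sigma> x * \<sigma> y"
    using ring_hom_add[OF iso, of x y] ring_hom_mult[OF iso, of x y] by simp_all
  show "\<sigma> (const a) = const a" by (rule c)
  have "\<sigma> 0 = 0" using c[of 0] by simp
  thus "\<sigma> x = 0 \<longleftrightarrow> x = 0" using bij_is_inj[OF b] by (metis injD)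
qed

lemma is_subfield_fixed:
  fixes G :: "(('v::{finite,linorder}, 'k::field_char_0) ratfun \<Rightarrow> ('v, 'k) ratfun) set"
  assumes "G \<subseteq> carrier ratfun_aut"
  shows "rat.is_subfield (fixed_subfield G)"
proof -
  have D: "\<sigma> (x + y) = \<sigma> x + \<sigma> y" "\<sigma> (x * y) = \<sigma> x * \<sigma> y" "\<sigma> (const a) = const a" "\<sigma> x = 0 \<longleftrightarrow> x = 0"
    if "\<sigma> \<in> G" for \<sigma> :: "('v, 'k) ratfun \<Rightarrow> ('v, 'k) ratfun" and x y a
    using ratfun_autD[of \<sigma>] assms that by blast+
  have "\<sigma> (- x) = - x \<and> \<sigma> (inverse x) = inverse x" if \<sigma>: "\<sigma> \<in> G" and x: "\<sigma> x = x" for \<sigma> x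
  proof -
    have "\<sigma> 1 = 1" using D(3)[OF \<sigma>, of 1] by simp
    hence "field_embedding \<sigma>" by (intro field_embedding.intro D[OF \<sigma>])
    thus ?thesis using field_embedding.c_minus field_embedding.c_inverse x by metis
  qed
  thus ?thesis unfolding rat.is_subfield_def fixed_subfield_def by (auto simp: D)
qed

text \<open>
G acts on k(\<psi>) by Moebius transformations of \<psi>, hence on the projective line. The
matrices are taken over the algebraic closure of k, where fixed points exist. The image H of G is a
quotient of G, so it is not the alternating group and must be trivial. Then every \<sigma> in G has a
scalar matrix, which means that it fixes \<psi>.
\<close>

theorem automorphism_group_fixes_generator:
  fixes G :: "(('v::{finite,linorder}, 'k::field_char_0) ratfun \<Rightarrow> ('v, 'k) ratfun) set"
  defines "\<G> \<equiv> ratfun_aut\<lparr>carrier := G\<rparr>"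
  assumes G: "subgroup G ratfun_aut" "finite G" "perfect \<G>"
    and no_A5: "\<And>N. N \<lhd> \<G> \<Longrightarrow> \<not> (\<G> Mod N) \<cong> alt_group 5"
    and \<psi>: "rat.transcendental \<psi>" and inv: "\<And>\<sigma>. \<sigma> \<in> G \<Longrightarrow> \<sigma> \<psi> \<in> rat.fracs \<psi>"
    and \<sigma>: "\<sigma> \<in> G"
  shows "\<sigma> \<psi> = \<psi>"
proof -
  have group\<G>: "group \<G>" unfolding \<G>_def by (rule group.subgroup_imp_group[OF group_ratfun_aut G(1)])
  have \<G>: "carrier \<G> = G" "\<And>\<sigma> \<tau>. \<sigma> \<otimes>\<^bsub>\<G>\<^esub> \<tau> = \<sigma> \<circ> \<tau>" "\<one>\<^bsub>\<G>\<^esub> = id" by (simp_all add: \<G>_def ratfun_aut_def)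
  have aut: "\<sigma> \<in> carrier ratfun_aut" if "\<sigma> \<in> G" for \<sigma> using subgroup.subset[OF G(1)] that by blast
  have one: "\<sigma> 1 = 1" if "\<sigma> \<in> G" for \<sigma> using ratfun_autD(3)[OF aut[OF that], of 1] by simp
  have emb: "field_embedding \<sigma>" if "\<sigma> \<in> G" for \<sigma>
    by (intro field_embedding.intro ratfun_autD[OF aut[OF that]] one[OF that])
  have ev: "\<sigma> (rat.ev p x) = rat.ev p (\<sigma> x)" if "\<sigma> \<in> G" for \<sigma> p x
    using ratfun_autD[OF aut[OF that]] field_embedding.c_0[OF emb[OF that]]
    by (induction p) (simp_all add: rat.ev_pCons)
  have rep: "\<exists>A. rat.represents \<psi> A \<sigma>" if \<sigma>: "\<sigma> \<in> G" for \<sigma>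
  proof -
    obtain \<tau> where \<tau>: "\<tau> \<in> G" "\<sigma> \<circ> \<tau> = id"
      using group.r_inv[OF group\<G>, of \<sigma>] group.inv_closed[OF group\<G>, of \<sigma>] \<sigma> unfolding \<G> by blast
    \<comment> \<open>Apply \<open>\<sigma>\<close> to the representation of \<open>\<tau> \<psi>\<close> as a fraction in \<open>\<psi>\<close>.\<close>
    have "\<psi> \<in> rat.fracs (\<sigma> \<psi>)"
    proof -
      obtain p q where pq: "rat.ev q \<psi> \<noteq> 0" "\<tau> \<psi> = rat.ev p \<psi> / rat.ev q \<psi>"
        using inv[OF \<tau>(1)] by (auto simp: rat.fracs_def)
      have "\<psi> = \<sigma> (\<tau> \<psi>)" using \<tau>(2) by (simp add: fun_eq_iff)
      also have "\<dots> = rat.ev p (\<sigma> \<psi>) / rat.ev q (\<sigma> \<psi>)"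
        unfolding pq(2) field_embedding.c_divide[OF emb[OF \<sigma>]] ev[OF \<sigma>] ..
      finally have 1: "\<psi> = rat.ev p (\<sigma> \<psi>) / rat.ev q (\<sigma> \<psi>)" .
      have "rat.ev q (\<sigma> \<psi>) \<noteq> 0"
        unfolding ev[OF \<sigma>, symmetric] using pq(1) ratfun_autD(4)[OF aut[OF \<sigma>]] by blast
      thus ?thesis using 1 unfolding rat.fracs_def by blast
    qed
    from rat.same_fracs_moebius[OF \<psi> inv[OF \<sigma>] this] obtain a b d e where
      m: "a * e - b * d \<noteq> 0" "const d * \<psi> + const e \<noteq> 0"
      "\<sigma> \<psi> * (const d * \<psi> + const e) = const a * \<psi> + const b" by blast
    have "(const d * \<psi> + const e) * \<sigma> (rat.form \<psi> v) = rat.form \<psi> (mact (a, b, d, e) v)" for v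
    proof -
      obtain r s where v: "v = (r, s)" by (cases v)
      have "(const d * \<psi> + const e) * \<sigma> (rat.form \<psi> v) =
          const r * (\<sigma> \<psi> * (const d * \<psi> + const e)) + const s * (const d * \<psi> + const e)"
        by (simp add: v rat.form_def ratfun_autD[OF aut[OF \<sigma>]] algebra_simps)
      thus ?thesis unfolding m(3) by (simp add: v rat.form_def rat.c_add rat.c_mult algebra_simps)
    qed
    hence "rat.represents \<psi> (a, b, d, e) \<sigma>"
      unfolding rat.represents_def using m(1,2) by auto
    thus ?thesis by blast
  qed
  \<comment> \<open>The chosen matrix is unique up to a scalar, so its action on lines does not depend on the choice.\<close>
  define act where "act \<sigma> l = mact (mat_ac (SOME A. rat.represents \<psi> A \<sigma>)) ` l" for \<sigma> l
  have act: "act \<sigma> l = mact (mat_ac A) ` l" if A: "rat.represents \<psi> A \<sigma>" and l: "l \<in> lines" for \<sigma> A l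
  proof -
    have "rat.represents \<psi> (SOME A. rat.represents \<psi> A \<sigma>) \<sigma>" using A by (rule someI)
    from rat.represents_unique[OF \<psi> A this] obtain t where
      "t \<noteq> 0" "\<And>v. mact (SOME A. rat.represents \<psi> A \<sigma>) v = scale t (mact A v)" by blast
    thus ?thesis unfolding act_def using mat_ac_same_lines l by blast
  qed
  have det: "mdet (mat_ac A) \<noteq> 0" if "rat.represents \<psi> A \<sigma>" for A \<sigma>
    using that by (simp add: rat.represents_def mdet_mat_ac)
  have act_closed: "act \<sigma> l \<in> lines" if \<sigma>: "\<sigma> \<in> G" and l: "l \<in> lines" for \<sigma> l
  proof -
    obtain A where A: "rat.represents \<psi> A \<sigma>" using rep[OF \<sigma>] by blast
    obtain v where v: "v \<noteq> (0, 0)" "l = line v" using l by (rule linesE)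
    have "act \<sigma> l = line (mact (mat_ac A) v)" unfolding act[OF A l] unfolding v(2) image_line ..
    thus ?thesis using line_in_lines[OF mact_nonzero[OF det[OF A] v(1)]] by simp
  qed
  have act_id: "act id l = l" if l: "l \<in> lines" for l
  proof -
    have "mact (mat_ac (1, 0, 0, 1)) w = w" for w :: "'k alg_closure \<times> 'k alg_closure" by (cases w) (simp add: mat_ac_def)
    thus ?thesis using act[OF rat.represents_id l] by simp
  qed
  have act_comp: "act (\<sigma> \<circ> \<tau>) l = act \<sigma> (act \<tau> l)" if \<sigma>: "\<sigma> \<in> G" and \<tau>: "\<tau> \<in> G" and l: "l \<in> lines" for \<sigma> \<tau> l
  proof -
    obtain A where A: "rat.represents \<psi> A \<sigma>" using rep[OF \<sigma>] by blast
    obtain B where B: "rat.represents \<psi> B \<tau>" using rep[OF \<tau>] by blast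
    have "rat.represents \<psi> (mmul A B) (\<sigma> \<circ> \<tau>)"
      by (rule rat.represents_comp[OF A ratfun_autD(2,4)[OF aut[OF \<sigma>]] B])
    hence "act (\<sigma> \<circ> \<tau>) l = mact (mat_ac A) ` mact (mat_ac B) ` l"
      using act l by (simp add: mat_ac_mmul mact_mmul image_image)
    also have "\<dots> = act \<sigma> (act \<tau> l)" using act[OF B l] act[OF A act_closed[OF \<tau> l]] by simp
    finally show ?thesis .
  qed
  define \<rho> where "\<rho> \<sigma> = restrict (act \<sigma>) lines" for \<sigma>
  have "group_action \<G> lines \<rho>"
    unfolding \<rho>_def by (rule restrict_group_action[OF group\<G>]) (simp_all add: \<G> act_closed act_id act_comp del: o_apply)
  then interpret \<rho>: group_hom \<G> "BijGroup lines" \<rho> by (rule group_action.group_hom)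
  define H where "H = (BijGroup lines)\<lparr>carrier := \<rho> ` G\<rparr>"
  have subH: "subgroup (\<rho> ` G) (BijGroup lines)" using \<rho>.img_is_subgroup unfolding \<G> .
  have groupH: "group H" unfolding H_def by (rule group.subgroup_imp_group[OF group_BijGroup subH])
  have H: "carrier H = \<rho> ` G" "\<one>\<^bsub>H\<^esub> = \<one>\<^bsub>BijGroup lines\<^esub>"
    "\<And>x y. x \<otimes>\<^bsub>H\<^esub> y = x \<otimes>\<^bsub>BijGroup lines\<^esub> y" by (simp_all add: H_def)
  have homH: "group_hom \<G> H \<rho>"
    using \<rho>.hom_mult by (intro group_hom.intro group\<G> groupH) (auto simp: group_hom_axioms_def hom_def H \<G>)
  have bij: "h \<in> Bij lines" if "h \<in> \<rho> ` G" for h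
    using subgroup.subset[OF subH] that by (auto simp: BijGroup_def)
  have "line_action H (\<lambda>h. h)"
  proof (rule line_action.intro[OF groupH], unfold_locales)
    show "finite (carrier H)" using G(2) by (simp add: H)
    show "perfect H" by (rule perfect_hom_image[OF homH _ G(3)]) (simp add: H \<G>)
    show "\<exists>A. mdet A \<noteq> 0 \<and> (\<forall>l\<in>lines. h l = mact A ` l)" if h: "h \<in> carrier H" for h
    proof -
      obtain \<sigma> where \<sigma>: "\<sigma> \<in> G" "h = \<rho> \<sigma>" using h H by auto
      obtain A where A: "rat.represents \<psi> A \<sigma>" using rep[OF \<sigma>(1)] by blast
      have "\<forall>l\<in>lines. h l = mact (mat_ac A) ` l" using act[OF A] by (simp add: \<sigma>(2) \<rho>_def)
      thus ?thesis using det[OF A] by blast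
    qed
    show "\<one>\<^bsub>H\<^esub> l = l" if "l \<in> lines" for l using that by (simp add: H BijGroup_def)
    show "(g \<otimes>\<^bsub>H\<^esub> h) l = g (h l)" if "g \<in> carrier H" "h \<in> carrier H" "l \<in> lines" for g h l
      using that bij by (simp add: H BijGroup_def compose_def)
    show "h = \<one>\<^bsub>H\<^esub>" if "h \<in> carrier H" "\<And>l. l \<in> lines \<Longrightarrow> h l = l" for h
      using that bij[of h] by (intro extensionalityI[of _ lines]) (auto simp: H BijGroup_def Bij_def)
  qed
  from line_action.trivial_or_alt_group_5[OF this] show ?thesis
  proof
    assume "carrier H = {\<one>\<^bsub>H\<^esub>}"
    hence "\<rho> \<sigma> = \<one>\<^bsub>H\<^esub>" using \<sigma> by (auto simp: H)
    hence "\<rho> \<sigma> = (\<lambda>l\<in>lines. l)" by (simp add: H BijGroup_def)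
    hence "\<rho> \<sigma> l = (\<lambda>l\<in>lines. l) l" for l by (rule fun_cong)
    hence fixl: "act \<sigma> l = l" if "l \<in> lines" for l
      using that unfolding \<rho>_def by (metis restrict_apply')
    obtain A where A: "rat.represents \<psi> A \<sigma>" using rep[OF \<sigma>] by blast
    have "mdet A \<noteq> 0" using A by (simp add: rat.represents_def)
    then obtain a where "A = (a, 0, 0, a)"
      using scalar_if_fixes_lines[of A] fixl act[OF A] by metis
    thus ?thesis using rat.represents_scalar[of \<psi> a \<sigma>] A one[OF \<sigma>] by simp
  next
    assume iso: "H \<cong> alt_group 5"
    have "(\<G> Mod kernel \<G> H \<rho>) \<cong> H"
      by (rule group_hom.FactGroup_iso[OF homH]) (simp add: H \<G>)
    hence "(\<G> Mod kernel \<G> H \<rho>) \<cong> alt_group 5" using iso iso_trans by blast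
    thus ?thesis using no_A5[OF group_hom.normal_kernel[OF homH]] by blast
  qed
qed

theorem theorem2:
  fixes G :: "(('v::{finite,linorder}, 'k::field_char_0) ratfun \<Rightarrow> ('v, 'k) ratfun) set"
  assumes "subgroup G ratfun_aut"
    and "finite G"
    and "\<And>N. N \<lhd> (ratfun_aut\<lparr>carrier := G\<rparr>) \<Longrightarrow>
           comm_group (ratfun_aut\<lparr>carrier := G\<rparr> Mod N) \<Longrightarrow>
           carrier (ratfun_aut\<lparr>carrier := G\<rparr> Mod N) = {\<one>\<^bsub>ratfun_aut\<lparr>carrier := G\<rparr> Mod N\<^esub>}"
    and "\<And>N. N \<lhd> (ratfun_aut\<lparr>carrier := G\<rparr>) \<Longrightarrow>
           \<not> (ratfun_aut\<lparr>carrier := G\<rparr> Mod N) \<cong> alt_group 5"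
  shows "saturated (fixed_subfield G)"
proof -
  have sub: "G \<subseteq> carrier ratfun_aut" by (rule subgroup.subset[OF assms(1)])
  have perf: "perfect (ratfun_aut\<lparr>carrier := G\<rparr>)"
    by (rule perfect_if_no_abelian_quotient[OF group.subgroup_imp_group[OF group_ratfun_aut assms(1)] assms(3)])
  have "\<exists>\<psi>\<in>fixed_subfield G. generative \<psi> \<phi>" if \<phi>: "\<phi> \<in> fixed_subfield G - constants" for \<phi>
  proof -
    obtain \<psi> where \<psi>: "rat.transcendental \<psi>" "rat.relative_closure \<phi> = rat.fracs \<psi>"
      using relative_closure_is_simple[of \<phi>] \<phi> by blast
    have "\<sigma> \<psi> \<in> rat.fracs \<psi>" if "\<sigma> \<in> G" for \<sigma>
    proof -
      have \<sigma>: "\<sigma> \<in> carrier ratfun_aut" "\<sigma> \<phi> = \<phi>" using that sub \<phi> by (auto simp: fixed_subfield_def)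
      have "\<psi> \<in> rat.relative_closure \<phi>" unfolding \<psi>(2) by (rule rat.self_in_fracs)
      from rat.closure_invariant[OF ratfun_autD(1-3)[OF \<sigma>(1)] \<sigma>(2) this]
      show ?thesis unfolding \<psi>(2) .
    qed
    hence "\<sigma> \<psi> = \<psi>" if "\<sigma> \<in> G" for \<sigma>
      using automorphism_group_fixes_generator[OF assms(1,2) perf assms(4) \<psi>(1) _ that] by blast
    hence "\<psi> \<in> fixed_subfield G" by (simp add: fixed_subfield_def)
    moreover have "generative \<psi> \<phi>"
      unfolding generative_def closed_ratfun_def
    proof (intro conjI)
      show "\<psi> \<notin> constants"
      proof
        assume "\<psi> \<in> constants"
        then obtain a where "\<psi> = const a" by (auto simp: constants_def)
        thus False using rat.transcendental_not_in_fracs_constant[OF \<psi>(1)] rat.self_in_fracs by blast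
      qed
      show "algebraically_closed_in (generate_field ratfun_field (insert \<psi> constants)) ratfun_field"
        unfolding constants_def rat.generate_field_eq_fracs algebraically_closed_in_def \<psi>(2)[symmetric]
        using rat.closure_closed by blast
      have "\<phi> \<in> rat.fracs \<psi>"
        unfolding \<psi>(2)[symmetric] using rat.fracs_subset_closure rat.self_in_fracs by blast
      thus "\<exists>p q :: 'k poly. poly (map_poly const q) \<psi> \<noteq> 0 \<and>
          \<phi> = poly (map_poly const p) \<psi> / poly (map_poly const q) \<psi>"
        by (simp add: rat.fracs_def rat.ev_def)
    qed
    ultimately show ?thesis by blast
  qed
  thus ?thesis
    using is_subfield_fixed[OF sub] unfolding saturated_def rat.subfield_iff constants_def by blast
qed

end
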